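(* Let $\Theta\subset\mathbb{R}^q$ be a known compact set and $\theta\in\Theta$ an uncertain constant parameter. Consider the system $\dot x=f_1(x)+\phi(\theta,x)+g_1(x)u$, $x\in\mathbb{R}^n$, $u\in\mathbb{R}^m$, with $e=x-x_r(t)$, $\beta_a=\beta_a(x_r,\hat e,e)=\varsigma(\hat e+x_r)e$, $\epsilon_e=e-\hat e$, the filter $$\dot{\hat e}=K(\epsilon_e)+f_1(x)+\phi(\mathrm{satv}(\hat\theta+\beta_a),x)+g_1(x)u-\dot x_r,$$ the parameter estimator $$\dot{\hat\theta}=-\varsigma(\hat e+x_r)\big[f_1(x)+\phi(\mathrm{satv}(\hat\theta+\beta_a),x)+g_1(x)u-\dot x_r\big]-\frac{\partial\beta_a}{\partial\hat e}\dot{\hat e}-\frac{\partial\beta_a}{\partial x_r}\dot x_r-k_{dz}\,\mathrm{dzv}(\hat\theta+\beta_a),$$ and the feedback controller $u=\psi(x_r,\dot x_r,\mathrm{satv}(\hat\theta+\beta_a),e)$. Suppose that Assumptions 1–4 stated in the context hold, and that there exists a constant $\tau_{err}>1$ such that for all $s\in\mathbb{R}_+$ $$\alpha_3(s)\ge\tau_{err}\;\gamma_s\Big(a^\ast l_\gamma\,\varrho_2\big(\alpha_1^{-1}(\alpha_2(s))\big)\Big)\cdot\alpha_4(s)\cdot\kappa_1(s),$$ with $\alpha_i,\gamma_s,l_\gamma,\kappa_1,\varrho_i,\varrho_1^\ast,a_1,a^\ast$ as in the context. Suppose there exist functions $K_1,K_2$ such that $$\epsilon_e^\top K_1(\epsilon_e)\ge|\epsilon_e|\cdot\pi_{\epsilon,e}\circ\check\gamma_{e,\tilde\theta}\circ\check\gamma_{\tilde\theta,\epsilon}(|\epsilon_e|^2),\qquad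 \epsilon_e^\top K_2(\epsilon_e)\ge|\epsilon_e|\cdot\pi_{\epsilon,\tilde\theta}\circ\check\gamma_{\tilde\theta,\epsilon}(|\epsilon_e|^2),$$ where $$\check\gamma_{\tilde\theta,e}(s)=a_1(\tau_{est}a^\ast l_\gamma)^2[\varrho_2(\alpha_1^{-1}(s))]^2,\qquad \check\gamma_{\tilde\theta,\epsilon}(s)=\frac{4\tau_{est}^2}{(\tau_{est}-1)^2}a_1(\tau_{est}a^\ast l_\gamma)^2[\varrho_3(\sqrt s)]^2,$$ $$\check\gamma_{e,\tilde\theta}(s)=\check\gamma_{\tilde\theta,e}^{-1}\Big(\frac{\tau_{est}}{\tau_{err}'}s\Big),\quad \pi_{\epsilon,\tilde\theta}(s)=\varrho_1^\ast\gamma_s\big(\sqrt{s/a_1}\big)+\tfrac14\gamma_s\big(\sqrt{s/a_1}\big)^2,\quad \pi_{\epsilon,e}(s)=[\varrho_1(\alpha_1^{-1}(s))]^2,$$ with $\tau_{err}>\tau_{err}'>\tau_{est}>1$. Then, choosing $K(\epsilon_e)=k_\epsilon\epsilon_e+K_1(\epsilon_e)+K_2(\epsilon_e)$ with $k_\epsilon>0$, the zero equilibrium point of the extended closed-loop system in the coordinates $(e,\tilde\theta,\epsilon_e)$, $\tilde\theta=\hat\theta-\theta+\beta_a$, $$\dot e=F(x_r,\dot x_r,\mathrm{satv}(\tilde\theta+\theta),e)-\tilde\phi_s(\theta,\tilde\theta,e+x_r),$$ $$\dot{\tilde\theta}=H(\theta,\tilde\theta,x_r)+\Delta_f(\theta,\tilde\theta,x_r,e,\epsilon_e),\qquad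 \dot\epsilon_e=-K(\epsilon_e)-\tilde\phi_s(\theta,\tilde\theta,e+x_r),$$ is uniformly globally asymptotically stable.
   Context: Notation. $|\cdot|$ is the Euclidean norm (induced norm for matrices), $\mathbb{B}_r^k=\{x\in\mathbb{R}^k:|x|\le r\}$, $\mathbb{R}_+=[0,\infty)$. $\mathcal{SN}$: continuous nondecreasing functions $\mathbb{R}_+\to\mathbb{R}_+$. $\mathcal{K}$: strictly increasing functions in $\mathcal{SN}$ vanishing at $0$. $\mathcal{K}_\infty$: unbounded functions in $\mathcal{K}$. A superscript $-1$ on a function denotes its inverse function. Saturation and dead zone. $l_\theta\ge\max_{\theta\in\Theta}|\theta|$; saturation level $l_s>l_\theta$ (chosen as in Assumption 3), margin $0<\epsilon_s\le1$. $\mathrm{sat}(s)=s$ if $|s|\le l_s$; $\mathrm{sat}(s)=s-\mathrm{sign}(s)\frac{(|s|-l_s)^2}{2\epsilon_s}$ if $l_s\le|s|\le l_s+\epsilon_s$; $\mathrm{sat}(s)=(l_s+0.5\epsilon_s)\mathrm{sign}(s)$ if $|s|\ge l_s+\epsilon_s$. $\mathrm{dz}(s)=0$ if $|s|\le l_\theta$; $\mathrm{dz}(s)=(|s|-l_\theta)^2[2(l_\theta+1)^2-(2l_\theta+1)|s|]\,\mathrm{sign}(s)$ if $l_\theta<|s|<l_\theta+1$; $\mathrm{dz}(s)=s$ if $|s|\ge l_\theta+1$. $\mathrm{satv}$ and $\mathrm{dzv}$ apply $\mathrm{sat}$ and $\mathrm{dz}$ componentwise on $\mathbb{R}^q$.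 Assumption 1. $\phi(\theta,x)$ is $C^1$ in $\theta\in\mathbb{R}^q$, for all $x\in\mathbb{R}^n$. Assumption 2. The reference $x_r(t)$ is $C^1$; there is $r_1>0$ with $x_r(t)\in\mathbb{B}_{r_1}^n$ for all $t\ge0$; $x_r(t)$ and $\dot x_r(t)$ are known a priori. Assumption 3. There exist $l_s>\sqrt q\,l_\theta$ and a continuous $\varsigma:\mathbb{R}^n\to\mathbb{R}^{q\times n}$ such that $(\theta'-\theta)^\top\varsigma(x_r)[\phi(\theta',x_r)-\phi(\theta,x_r)]\ge(\theta'-\theta)^\top M_1(x_r)(\theta'-\theta)\ge0$ for all $\theta\in\Theta$ and $|\theta'|\le l_s$ (with $x_r=x_r(t)$ the reference), for some continuous $M_1:\mathbb{R}^n\to\mathbb{R}^{q\times q}$ satisfying $\int_t^{t+\delta}\big(M_1(x_r(\tau))+M_1^\top(x_r(\tau))\big)d\tau\ge\mu I$ for some constants $\delta,\mu>0$ and all $t\ge0$. Assumption 4. There is a function $\psi(x_r,\dot x_r,\theta,e)$ such that, with $F(x_r,\dot x_r,\theta,e)=f_1(e+x_r)+\phi(\theta,e+x_r)+g_1(e+x_r)\psi(x_r,\dot x_r,\theta,e)-\dot x_r$, the zero equilibrium of $\dot e=F(x_r,\dot x_r,\theta,e)$ is globally asymptotically stable, uniformly in $t\in\mathbb{R}_+$ and $\theta\in\mathbb{R}^q$; more specifically, there are a strict Lyapunov function $V_{err}(t,e)$ and $\alpha_1,\dots,\alpha_4\in\mathcal{K}_\infty$ such that for all $\theta\in\mathbb{R}^q$: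 $\alpha_1(|e|)\le V_{err}(t,e)\le\alpha_2(|e|)$, $\frac{\partial V_{err}}{\partial t}+\frac{\partial V_{err}}{\partial e}F(x_r,\dot x_r,\theta,e)\le-\alpha_3(|e|)$, $\left|\frac{\partial V_{err}}{\partial e}\right|\le\alpha_4(|e|)$. Derived objects. $\tilde\phi_s(\theta^\dag,\theta^\ddag,x)=\phi(\mathrm{satv}(\theta^\dag+\theta^\ddag),x)-\phi(\mathrm{satv}(\theta^\dag),x)$. $\gamma_s\in\mathcal{K}\setminus\mathcal{K}_\infty$ and the constant $l_\gamma>0$ satisfy $\gamma_s(s)\le l_\gamma$, $\gamma_s(s)\le s$ for all $s\ge0$, and $|\mathrm{satv}(\theta+\tilde\theta)-\theta|\le\gamma_s(|\tilde\theta|)$ for all $\theta\in\Theta$, $\tilde\theta\in\mathbb{R}^q$. $\kappa_1\in\mathcal{SN}$ is such that $\kappa_1(s)\ge\sup\left|\frac{\partial\phi(\theta,e+x_r)}{\partial\theta}\right|$, the supremum being over $(\theta,x_r,e)\in\mathbb{B}^q_{l_s+0.5\epsilon_s}\times\mathbb{B}_{r_1}^n\times\mathbb{B}_s^n$. $H(\theta,\tilde\theta,x_r)=-\varsigma(x_r)\tilde\phi_s(\theta,\tilde\theta,x_r)-k_{dz}\,\mathrm{dzv}(\tilde\theta+\theta)$ and $\Delta_f(\theta,\tilde\theta,x_r,e,\epsilon_e)=\varsigma(x_r)\tilde\phi_s(\theta,\tilde\theta,x_r)-\varsigma(e+x_r-\epsilon_e)\tilde\phi_s(\theta,\tilde\theta,e+x_r)$.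 $\varrho_1,\varrho_2,\varrho_3\in\mathcal{K}$ and the constant $\varrho_1^\ast\ge0$ (whose existence the paper derives from Assumptions 1 and 2) are such that $|\tilde\phi_s(\theta,\tilde\theta,e+x_r)|\le(\varrho_1(|e|)+\varrho_1^\ast)\gamma_s(|\tilde\theta|)$ and $|\Delta_f(\theta,\tilde\theta,x_r,e,\epsilon_e)|\le(\varrho_2(|e|)+\varrho_3(|\epsilon_e|))\gamma_s(|\tilde\theta|)$ for all $\theta\in\Theta$, $\tilde\theta\in\mathbb{R}^q$, $x_r\in\mathbb{B}_{r_1}^n$, $e,\epsilon_e\in\mathbb{R}^n$. Choice of $k_{dz}$ and constants $a_i$. The paper derives from Assumptions 1–3 that there is $k_{dz}^\star>0$ such that for all $k_{dz}\ge k_{dz}^\star$ there are a $C^1$ function $V_{est}:\mathbb{R}_+\times\mathbb{R}^q\to\mathbb{R}_+$ and constants $a_1,\dots,a_4>0$ with $a_1|\tilde\theta|^2\le V_{est}(t,\tilde\theta)\le a_2|\tilde\theta|^2$, $\frac{\partial V_{est}}{\partial t}+\frac{\partial V_{est}}{\partial\tilde\theta}H(\theta,\tilde\theta,x_r)\le-a_3|\tilde\theta|^2$, $\left|\frac{\partial V_{est}}{\partial\tilde\theta}\right|\le a_4|\tilde\theta|$. The design gain is fixed with $k_{dz}\ge k_{dz}^\star$, the $a_i$ are these constants, and $a^\ast=\frac{\sqrt{a_2}\,a_4}{\sqrt{a_1}\,a_3}$.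
   Formalization: The bound κ_1 is taken over the box |θ_i| ≤ l_s+0.5ε_s (the claim fails with the Euclidean ball for q ≥ 2); γ̌_{θ̃,e} is assumed onto R_+ so its inverse exists; f_1, g_1, φ, ψ, K_1, K_2 are assumed continuous and ς differentiable. *)

theory Defs
  imports "HOL-Analysis.Analysis"
begin

text \<open>Functions on the nonnegative half-line are total functions on the reals of which only the
  restriction to \<open>{0..}\<close> matters. Accordingly the inverse of such an \<open>f\<close> is \<open>inv_into {0..} f\<close>.\<close>

definition class_SN :: "(real \<Rightarrow> real) set" where
  "class_SN = {f. continuous_on {0..} f \<and> mono_on {0..} f \<and> (\<forall>s\<ge>0. f s \<ge> 0)}"

definition class_K :: "(real \<Rightarrow> real) set" where
  "class_K = {f \<in> class_SN. strict_mono_on {0..} f \<and> f 0 = 0}"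

definition class_Kinf :: "(real \<Rightarrow> real) set" where
  "class_Kinf = {f \<in> class_K. \<not> bdd_above (f ` {0..})}"

definition ode_solution ::
    "(real \<Rightarrow> 'a \<Rightarrow> 'a) \<Rightarrow> real set \<Rightarrow> (real \<Rightarrow> 'a::real_normed_vector) \<Rightarrow> bool" where
  "ode_solution f I X \<longleftrightarrow> (\<forall>t\<in>I. (X has_vector_derivative f t (X t)) (at t within I))"

text \<open>Uniform global asymptotic stability of the origin on the time axis \<open>{0..}\<close>: the origin is an
  equilibrium, every initial condition has a solution on \<open>{t0..}\<close>, the origin is uniformly stable
  with a \<open>\<delta>\<close> that can be chosen to tend to infinity, and it is uniformly globally attractive.
  The last two are required of all solutions, unique or not, on whatever interval they exist;
  quantifying over the end point \<open>t\<close> of a compact interval covers every interval of existence.\<close>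

definition zero_UGAS :: "(real \<Rightarrow> 'a \<Rightarrow> 'a::real_normed_vector) \<Rightarrow> bool" where
  "zero_UGAS f \<longleftrightarrow>
     (\<forall>t\<ge>0. f t 0 = 0) \<and>
     (\<forall>t0\<ge>0. \<forall>x0. \<exists>X. X t0 = x0 \<and> ode_solution f {t0..} X) \<and>
     (\<exists>\<delta>. filterlim \<delta> at_top at_top \<and>
        (\<forall>\<epsilon>>0. \<delta> \<epsilon> > (0::real) \<and>
           (\<forall>t0\<ge>0. \<forall>t\<ge>t0. \<forall>X. ode_solution f {t0..t} X \<and> norm (X t0) < \<delta> \<epsilon> \<longrightarrow> norm (X t) < \<epsilon>))) \<and>
     (\<forall>c>0. \<forall>\<eta>>0. \<exists>T>0. \<forall>t0\<ge>0. \<forall>t\<ge>t0 + T. \<forall>X.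
        ode_solution f {t0..t} X \<and> norm (X t0) < c \<longrightarrow> norm (X t) < \<eta>)"

text \<open>\<open>V\<close> is continuously differentiable on \<open>{0..} \<times> UNIV\<close> (one-sided in time at 0), with time derivative
  \<open>Vt\<close> and state gradient \<open>Vx\<close>; the row vector of partial derivatives acts through the inner product.\<close>

definition C1_time_state ::
    "(real \<Rightarrow> 'a \<Rightarrow> real) \<Rightarrow> (real \<Rightarrow> 'a \<Rightarrow> real) \<Rightarrow> (real \<Rightarrow> 'a \<Rightarrow> 'a::euclidean_space) \<Rightarrow> bool" where
  "C1_time_state V Vt Vx \<longleftrightarrow>
     continuous_on ({0..} \<times> UNIV) (\<lambda>(t, x). Vt t x) \<and>
     continuous_on ({0..} \<times> UNIV) (\<lambda>(t, x). Vx t x) \<and>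
     (\<forall>t\<ge>0. \<forall>x. ((\<lambda>(s, y). V s y) has_derivative (\<lambda>(s, y). s * Vt t x + Vx t x \<bullet> y))
                   (at (t, x) within {0..} \<times> UNIV))"

definition sat :: "real \<Rightarrow> real \<Rightarrow> real \<Rightarrow> real" where
  "sat l_s \<epsilon>_s s =
     (if \<bar>s\<bar> \<le> l_s then s
      else if \<bar>s\<bar> \<le> l_s + \<epsilon>_s then s - sgn s * ((\<bar>s\<bar> - l_s)\<^sup>2 / (2 * \<epsilon>_s))
      else (l_s + 0.5 * \<epsilon>_s) * sgn s)"

definition dz :: "real \<Rightarrow> real \<Rightarrow> real" where
  "dz l_\<theta> s =
     (if \<bar>s\<bar> \<le> l_\<theta> then 0
      else if \<bar>s\<bar> < l_\<theta> + 1
        then (\<bar>s\<bar> - l_\<theta>)\<^sup>2 * (2 * (l_\<theta> + 1)\<^sup>2 - (2 * l_\<theta> + 1) * \<bar>s\<bar>) * sgn s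
      else s)"

definition satv :: "real \<Rightarrow> real \<Rightarrow> real^'q \<Rightarrow> real^'q" where
  "satv l_s \<epsilon>_s v = (\<chi> i. sat l_s \<epsilon>_s (v $ i))"

definition dzv :: "real \<Rightarrow> real^'q \<Rightarrow> real^'q" where
  "dzv l_\<theta> v = (\<chi> i. dz l_\<theta> (v $ i))"

definition C1_in_parameter :: "(real^'q \<Rightarrow> real^'n \<Rightarrow> real^'n) \<Rightarrow> bool" where
  "C1_in_parameter \<phi> \<longleftrightarrow>
     (\<forall>x. \<exists>D :: real^'q \<Rightarrow> real^'q^'n. continuous_on UNIV D \<and>
        (\<forall>\<theta>. ((\<lambda>\<theta>. \<phi> \<theta> x) has_derivative (\<lambda>h. D \<theta> *v h)) (at \<theta>)))"

definition reference_signal :: "(real \<Rightarrow> real^'n) \<Rightarrow> (real \<Rightarrow> real^'n) \<Rightarrow> real \<Rightarrow> bool" where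
  "reference_signal x_r dx_r r_1 \<longleftrightarrow>
     (\<forall>t\<ge>0. (x_r has_vector_derivative dx_r t) (at t within {0..})) \<and>
     continuous_on {0..} dx_r \<and>
     r_1 > 0 \<and> (\<forall>t\<ge>0. x_r t \<in> cball 0 r_1)"

definition monotone_excited ::
    "(real^'q) set \<Rightarrow> real \<Rightarrow> real \<Rightarrow> (real^'q \<Rightarrow> real^'n \<Rightarrow> real^'n) \<Rightarrow> (real \<Rightarrow> real^'n)
      \<Rightarrow> (real^'n \<Rightarrow> real^'n^'q) \<Rightarrow> bool" where
  "monotone_excited \<Theta> l_\<theta> l_s \<phi> x_r \<sigma> \<longleftrightarrow>
     l_s > sqrt (real CARD('q)) * l_\<theta> \<and>
     continuous_on UNIV \<sigma> \<and>
     (\<exists>(M1 :: real^'n \<Rightarrow> real^'q^'q) \<delta> \<mu>.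
        continuous_on UNIV M1 \<and> \<delta> > 0 \<and> \<mu> > 0 \<and>
        (\<forall>\<theta>\<in>\<Theta>. \<forall>\<theta>'. norm \<theta>' \<le> l_s \<longrightarrow> (\<forall>t\<ge>0.
           (\<theta>' - \<theta>) \<bullet> (\<sigma> (x_r t) *v (\<phi> \<theta>' (x_r t) - \<phi> \<theta> (x_r t)))
             \<ge> (\<theta>' - \<theta>) \<bullet> (M1 (x_r t) *v (\<theta>' - \<theta>)) \<and>
           (\<theta>' - \<theta>) \<bullet> (M1 (x_r t) *v (\<theta>' - \<theta>)) \<ge> 0)) \<and>
        (\<forall>t\<ge>0. \<forall>v.
           v \<bullet> (integral {t..t + \<delta>} (\<lambda>\<tau>. M1 (x_r \<tau>) + transpose (M1 (x_r \<tau>))) *v v)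
             \<ge> \<mu> * (v \<bullet> v)))"

definition F_field ::
    "(real^'n \<Rightarrow> real^'n) \<Rightarrow> (real^'q \<Rightarrow> real^'n \<Rightarrow> real^'n) \<Rightarrow> (real^'n \<Rightarrow> real^'m^'n)
      \<Rightarrow> (real^'n \<Rightarrow> real^'n \<Rightarrow> real^'q \<Rightarrow> real^'n \<Rightarrow> real^'m)
      \<Rightarrow> real^'n \<Rightarrow> real^'n \<Rightarrow> real^'q \<Rightarrow> real^'n \<Rightarrow> real^'n" where
  "F_field f_1 \<phi> g_1 \<psi> xr dxr \<theta> e =
     f_1 (e + xr) + \<phi> \<theta> (e + xr) + g_1 (e + xr) *v \<psi> xr dxr \<theta> e - dxr"

definition error_lyapunov ::
    "(real^'n \<Rightarrow> real^'n \<Rightarrow> real^'q \<Rightarrow> real^'n \<Rightarrow> real^'n) \<Rightarrow> (real \<Rightarrow> real^'n) \<Rightarrow> (real \<Rightarrow> real^'n)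
      \<Rightarrow> (real \<Rightarrow> real^'n \<Rightarrow> real)
      \<Rightarrow> (real \<Rightarrow> real) \<Rightarrow> (real \<Rightarrow> real) \<Rightarrow> (real \<Rightarrow> real) \<Rightarrow> (real \<Rightarrow> real) \<Rightarrow> bool" where
  "error_lyapunov F x_r dx_r V_err \<alpha>_1 \<alpha>_2 \<alpha>_3 \<alpha>_4 \<longleftrightarrow>
     {\<alpha>_1, \<alpha>_2, \<alpha>_3, \<alpha>_4} \<subseteq> class_Kinf \<and>
     (\<forall>\<theta>. \<forall>t\<ge>0. F (x_r t) (dx_r t) \<theta> 0 = 0) \<and>
     (\<exists>Vt Ve. C1_time_state V_err Vt Ve \<and>
        (\<forall>t\<ge>0. \<forall>e. \<alpha>_1 (norm e) \<le> V_err t e \<and> V_err t e \<le> \<alpha>_2 (norm e) \<and>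
                    norm (Ve t e) \<le> \<alpha>_4 (norm e) \<and>
                    (\<forall>\<theta>. Vt t e + Ve t e \<bullet> F (x_r t) (dx_r t) \<theta> e \<le> - \<alpha>_3 (norm e))))"

definition phi_s ::
    "real \<Rightarrow> real \<Rightarrow> (real^'q \<Rightarrow> real^'n \<Rightarrow> real^'n) \<Rightarrow> real^'q \<Rightarrow> real^'q \<Rightarrow> real^'n \<Rightarrow> real^'n" where
  "phi_s l_s \<epsilon>_s \<phi> \<theta>1 \<theta>2 x = \<phi> (satv l_s \<epsilon>_s (\<theta>1 + \<theta>2)) x - \<phi> (satv l_s \<epsilon>_s \<theta>1) x"

definition H_field ::
    "real \<Rightarrow> real \<Rightarrow> real \<Rightarrow> real \<Rightarrow> (real^'q \<Rightarrow> real^'n \<Rightarrow> real^'n) \<Rightarrow> (real^'n \<Rightarrow> real^'n^'q)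
      \<Rightarrow> real^'q \<Rightarrow> real^'q \<Rightarrow> real^'n \<Rightarrow> real^'q" where
  "H_field l_\<theta> l_s \<epsilon>_s k_dz \<phi> \<sigma> \<theta> \<theta>t xr =
     - (\<sigma> xr *v phi_s l_s \<epsilon>_s \<phi> \<theta> \<theta>t xr) - k_dz *\<^sub>R dzv l_\<theta> (\<theta>t + \<theta>)"

definition Delta_f ::
    "real \<Rightarrow> real \<Rightarrow> (real^'q \<Rightarrow> real^'n \<Rightarrow> real^'n) \<Rightarrow> (real^'n \<Rightarrow> real^'n^'q)
      \<Rightarrow> real^'q \<Rightarrow> real^'q \<Rightarrow> real^'n \<Rightarrow> real^'n \<Rightarrow> real^'n \<Rightarrow> real^'q" where
  "Delta_f l_s \<epsilon>_s \<phi> \<sigma> \<theta> \<theta>t xr e \<epsilon>e =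
     \<sigma> xr *v phi_s l_s \<epsilon>_s \<phi> \<theta> \<theta>t xr - \<sigma> (e + xr - \<epsilon>e) *v phi_s l_s \<epsilon>_s \<phi> \<theta> \<theta>t (e + xr)"

definition estimation_lyapunov ::
    "(real^'q) set \<Rightarrow> (real^'q \<Rightarrow> real^'q \<Rightarrow> real^'n \<Rightarrow> real^'q) \<Rightarrow> (real \<Rightarrow> real^'n)
      \<Rightarrow> (real \<Rightarrow> real^'q \<Rightarrow> real) \<Rightarrow> real \<Rightarrow> real \<Rightarrow> real \<Rightarrow> real \<Rightarrow> bool" where
  "estimation_lyapunov \<Theta> H x_r V_est a_1 a_2 a_3 a_4 \<longleftrightarrow>
     a_1 > 0 \<and> a_2 > 0 \<and> a_3 > 0 \<and> a_4 > 0 \<and>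
     (\<exists>Vt V\<theta>. C1_time_state V_est Vt V\<theta> \<and>
        (\<forall>t\<ge>0. \<forall>\<theta>t. a_1 * (norm \<theta>t)\<^sup>2 \<le> V_est t \<theta>t \<and> V_est t \<theta>t \<le> a_2 * (norm \<theta>t)\<^sup>2 \<and>
                     norm (V\<theta> t \<theta>t) \<le> a_4 * norm \<theta>t \<and>
                     (\<forall>\<theta>\<in>\<Theta>. Vt t \<theta>t + V\<theta> t \<theta>t \<bullet> H \<theta> \<theta>t (x_r t) \<le> - a_3 * (norm \<theta>t)\<^sup>2)))"

definition beta_a :: "(real^'n \<Rightarrow> real^'n^'q) \<Rightarrow> real^'n \<Rightarrow> real^'n \<Rightarrow> real^'n \<Rightarrow> real^'q" where
  "beta_a \<sigma> xr eh e = \<sigma> (eh + xr) *v e"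

text \<open>Plant, filter, parameter estimator and controller, in the original state \<open>(x, eh, \<theta>h)\<close>.
  The partial derivatives of \<open>beta_a\<close> are Frechet derivatives in the respective argument.\<close>

definition closed_loop ::
    "real \<Rightarrow> real \<Rightarrow> real \<Rightarrow> real \<Rightarrow> (real^'n \<Rightarrow> real^'n) \<Rightarrow> (real^'q \<Rightarrow> real^'n \<Rightarrow> real^'n)
      \<Rightarrow> (real^'n \<Rightarrow> real^'m^'n) \<Rightarrow> (real^'n \<Rightarrow> real^'n \<Rightarrow> real^'q \<Rightarrow> real^'n \<Rightarrow> real^'m)
      \<Rightarrow> (real^'n \<Rightarrow> real^'n^'q) \<Rightarrow> (real^'n \<Rightarrow> real^'n) \<Rightarrow> (real \<Rightarrow> real^'n) \<Rightarrow> (real \<Rightarrow> real^'n)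
      \<Rightarrow> real^'q \<Rightarrow> real \<Rightarrow> (real^'n) \<times> (real^'n) \<times> (real^'q) \<Rightarrow> (real^'n) \<times> (real^'n) \<times> (real^'q)" where
  "closed_loop l_\<theta> l_s \<epsilon>_s k_dz f_1 \<phi> g_1 \<psi> \<sigma> K x_r dx_r \<theta> t = (\<lambda>(x, eh, \<theta>h).
     let e = x - x_r t;
         \<beta> = beta_a \<sigma> (x_r t) eh e;
         \<theta>s = satv l_s \<epsilon>_s (\<theta>h + \<beta>);
         u = \<psi> (x_r t) (dx_r t) \<theta>s e;
         w = f_1 x + \<phi> \<theta>s x + g_1 x *v u - dx_r t;
         deh = K (e - eh) + w
     in (f_1 x + \<phi> \<theta> x + g_1 x *v u,
         deh,
         - (\<sigma> (eh + x_r t) *v w)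
           - frechet_derivative (\<lambda>z. beta_a \<sigma> (x_r t) z e) (at eh) deh
           - frechet_derivative (\<lambda>z. beta_a \<sigma> z eh e) (at (x_r t)) (dx_r t)
           - k_dz *\<^sub>R dzv l_\<theta> (\<theta>h + \<beta>)))"

definition error_coords ::
    "(real^'n \<Rightarrow> real^'n^'q) \<Rightarrow> (real \<Rightarrow> real^'n) \<Rightarrow> real^'q \<Rightarrow> real
      \<Rightarrow> (real^'n) \<times> (real^'n) \<times> (real^'q) \<Rightarrow> (real^'n) \<times> (real^'q) \<times> (real^'n)" where
  "error_coords \<sigma> x_r \<theta> t = (\<lambda>(x, eh, \<theta>h).
     let e = x - x_r t in (e, \<theta>h - \<theta> + beta_a \<sigma> (x_r t) eh e, e - eh))"

definition extended_error_system ::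
    "real \<Rightarrow> real \<Rightarrow> real \<Rightarrow> real \<Rightarrow> (real^'n \<Rightarrow> real^'n) \<Rightarrow> (real^'q \<Rightarrow> real^'n \<Rightarrow> real^'n)
      \<Rightarrow> (real^'n \<Rightarrow> real^'m^'n) \<Rightarrow> (real^'n \<Rightarrow> real^'n \<Rightarrow> real^'q \<Rightarrow> real^'n \<Rightarrow> real^'m)
      \<Rightarrow> (real^'n \<Rightarrow> real^'n^'q) \<Rightarrow> (real^'n \<Rightarrow> real^'n) \<Rightarrow> (real \<Rightarrow> real^'n) \<Rightarrow> (real \<Rightarrow> real^'n)
      \<Rightarrow> real^'q \<Rightarrow> real \<Rightarrow> (real^'n) \<times> (real^'q) \<times> (real^'n) \<Rightarrow> (real^'n) \<times> (real^'q) \<times> (real^'n)" where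
  "extended_error_system l_\<theta> l_s \<epsilon>_s k_dz f_1 \<phi> g_1 \<psi> \<sigma> K x_r dx_r \<theta> t = (\<lambda>(e, \<theta>t, \<epsilon>e).
     (F_field f_1 \<phi> g_1 \<psi> (x_r t) (dx_r t) (satv l_s \<epsilon>_s (\<theta>t + \<theta>)) e
        - phi_s l_s \<epsilon>_s \<phi> \<theta> \<theta>t (e + x_r t),
      H_field l_\<theta> l_s \<epsilon>_s k_dz \<phi> \<sigma> \<theta> \<theta>t (x_r t)
        + Delta_f l_s \<epsilon>_s \<phi> \<sigma> \<theta> \<theta>t (x_r t) e \<epsilon>e,
      - K \<epsilon>e - phi_s l_s \<epsilon>_s \<phi> \<theta> \<theta>t (e + x_r t)))"

end

theory Submission
  imports Defs "HOL-Complex_Analysis.Great_Picard"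
begin

text \<open>The Lyapunov function is the maximum \<open>U\<close> of the three rescaled functions \<open>\<sigma>1 V_err\<close>, \<open>V_est\<close> and
  \<open>\<sigma>3 |\<epsilon>e|\<^sup>2\<close>. Whichever of them attains the maximum decreases strictly: for \<open>V_err\<close> and \<open>V_est\<close> by the
  small-gain conditions, for \<open>|\<epsilon>e|\<^sup>2\<close> by the choice of \<open>K_1\<close>, \<open>K_2\<close> and \<open>k_\<epsilon>\<close>. The rescalings are merely
  continuous. Composing \<open>U\<close> with \<open>\<Gamma> = \<Sum> inv \<sigma>i\<close> gives a function that decreases at a uniform rate
  to the right of every time at which it exceeds a given level, because \<open>\<Gamma> \<circ> \<sigma>i\<close> expands distances. A
  continuity argument turns this into stability and attractivity, and the resulting a priori bound
  together with Peano's theorem gives global solutions.\<close>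

section \<open>Comparison functions\<close>

text \<open>A maximum rather than a sum fits because each hypothesis is an implication: it yields
  decrease of one function only where that function dominates the other two. The chain \<tau>_err >
  \<tau>_err' > \<tau>_est > 1 leaves room on both sides of the loop. \<open>\<sigma>1\<close> is
  the inverse of \<open>g_e\<theta>\<close>. Its factor \<open>\<tau>_err' / \<tau>_est\<close>
  exceeds 1, so \<open>V_est\<close> decreases where it dominates; where \<open>V_err\<close>
  dominates, the excess factor in the bound on the estimation error is the geometric mean of
  \<tau>_err' and \<tau>_est, which is still below \<tau>_err. That factor appears inside
  \<gamma>_s, and \<gamma>_s is not assumed to satisfy
  \<open>\<gamma>_s (c * y) \<le> c * \<gamma>_s y\<close>; the factor is moved outside by concavity
  of the saturation, applied to the deviation that \<gamma>_s dominates. The right-hand side is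
  assumed only continuous, so solutions need not be unique, and the rescalings contain inverses of
  class K functions, which need not be differentiable. Hence decrease is always stated on a right
  neighbourhood of one time, for any curve tangent to the field there.\<close>

lemma class_KinfI:
  assumes "strict_mono_on {0..} f" and "f ` {0..} = {0..}"
  shows "f \<in> class_Kinf"
proof -
  \<comment> \<open>The identity on the negative axis makes \<open>?F\<close> a monotone map onto
    the whole line. Its range is open, and a monotone map with open range is continuous.\<close>
  let ?F = "\<lambda>x. if 0 \<le> x then f x else x"
  have nonneg: "0 \<le> f s" if "0 \<le> s" for s
    using assms(2) that by auto
  have mono: "f s \<le> f s'" if "0 \<le> s" "s \<le> s'" for s s'
    using strict_mono_on_leD[OF assms(1)] that by auto
  have "0 \<in> f ` {0..}"
    using assms(2) by simp
  then have zero: "f 0 = 0"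
    using mono nonneg by (metis atLeast_iff dual_order.antisym imageE order_refl)
  have "\<exists>x. y = ?F x" for y
  proof (cases "0 \<le> y")
    case True
    then have "y \<in> f ` {0..}"
      using assms(2) by simp
    then show ?thesis by auto
  qed (auto intro: exI[of _ y])
  then have "?F ` UNIV = UNIV"
    by blast
  then have "continuous_on UNIV ?F"
    using mono nonneg by (intro continuous_onI_mono) (auto intro: order_trans[of _ 0])
  then have "continuous_on {0..} ?F"
    by (rule continuous_on_subset) simp
  then have "continuous_on {0..} f"
    by (rule continuous_on_eq) simp
  moreover have "\<not> bdd_above {0::real..}"
  proof
    assume "bdd_above {0::real..}"
    then obtain M where "\<And>x::real. 0 \<le> x \<Longrightarrow> x \<le> M"
      by (auto simp: bdd_above_def)
    from this[of "max 0 M + 1"] show False by simp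
  qed
  ultimately show ?thesis
    using assms nonneg mono zero
    by (auto simp: class_Kinf_def class_K_def class_SN_def mono_on_def)
qed

lemma class_K_props:
  assumes "f \<in> class_K"
  shows class_K_continuous: "continuous_on {0..} f"
    and class_K_strict: "\<And>s s'. 0 \<le> s \<Longrightarrow> s < s' \<Longrightarrow> f s < f s'"
    and class_K_mono: "\<And>s s'. 0 \<le> s \<Longrightarrow> s \<le> s' \<Longrightarrow> f s \<le> f s'"
    and class_K_0: "f 0 = 0"
    and class_K_nonneg: "\<And>s. 0 \<le> s \<Longrightarrow> 0 \<le> f s"
    and class_K_pos: "\<And>s. 0 < s \<Longrightarrow> 0 < f s"
  using assms
  by (auto simp: class_K_def class_SN_def monotone_on_def)
    (metis order_refl less_imp_le atLeast_iff)

lemma class_Kinf_K: "f \<in> class_Kinf \<Longrightarrow> f \<in> class_K"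
  by (simp add: class_Kinf_def)

lemmas class_Kinf_props = class_K_props[OF class_Kinf_K]

lemma class_KI:
  assumes "continuous_on {0..} f" and "\<And>s s'. 0 \<le> s \<Longrightarrow> s < s' \<Longrightarrow> f s < f s'" and "f 0 = 0"
  shows "f \<in> class_K"
  using assms by (fastforce simp: class_K_def class_SN_def monotone_on_def order_le_less)

lemma class_KinfI_unbounded:
  assumes "f \<in> class_K" and "\<And>c. \<exists>s\<ge>0. f s \<ge> c"
  shows "f \<in> class_Kinf"
proof -
  have "\<not> bdd_above (f ` {0..})"
  proof
    assume "bdd_above (f ` {0..})"
    then obtain c where "\<And>s. 0 \<le> s \<Longrightarrow> f s \<le> c"
      by (auto simp: bdd_above_def)
    with assms(2)[of "c + 1"] show False
      by force
  qed
  with assms(1) show ?thesis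
    by (simp add: class_Kinf_def)
qed

lemma class_Kinf_unbounded:
  assumes "f \<in> class_Kinf" shows "\<exists>s\<ge>0. f s \<ge> c"
  using assms unfolding class_Kinf_def bdd_above_def
  by (auto simp: not_le) (meson less_imp_le atLeast_iff)

lemma class_Kinf_image:
  assumes "f \<in> class_Kinf" shows "f ` {0..} = {0..}"
proof (intro equalityI subsetI)
  fix y :: real assume y: "y \<in> {0..}"
  obtain s where s: "s \<ge> 0" "f s \<ge> y"
    using class_Kinf_unbounded[OF assms] by blast
  have "\<exists>x\<ge>0. x \<le> s \<and> f x = y"
    using s y class_Kinf_props[OF assms]
    by (intro IVT') (auto elim: continuous_on_subset)
  then show "y \<in> f ` {0..}" by auto
qed (auto simp: class_Kinf_props[OF assms])

abbreviation (input) inv0 :: "(real \<Rightarrow> real) \<Rightarrow> real \<Rightarrow> real" where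
  "inv0 f \<equiv> inv_into {0..} f"

text \<open>Strict monotonicity and surjectivity onto \<open>{0..}\<close> pass to the inverse, so
  \<open>class_KinfI\<close> supplies its continuity without a separate argument.\<close>

lemma class_Kinf_inv:
  assumes "f \<in> class_Kinf"
  shows inv0_nonneg: "\<And>s. 0 \<le> s \<Longrightarrow> 0 \<le> inv0 f s"
    and f_inv0: "\<And>s. 0 \<le> s \<Longrightarrow> f (inv0 f s) = s"
    and inv0_f: "\<And>s. 0 \<le> s \<Longrightarrow> inv0 f (f s) = s"
    and inv0_Kinf: "inv0 f \<in> class_Kinf"
proof -
  note im = class_Kinf_image[OF assms]
  show 1: "0 \<le> inv0 f s" if "0 \<le> s" for s
    using inv_into_into[of s f "{0..}"] that im by simp
  show 2: "f (inv0 f s) = s" if "0 \<le> s" for s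
    using f_inv_into_f[of s f "{0..}"] that im by simp
  have inj: "inj_on f {0..}"
    using assms by (simp add: class_Kinf_def class_K_def strict_mono_on_imp_inj_on)
  show 3: "inv0 f (f s) = s" if "0 \<le> s" for s
    using inv_into_f_f[OF inj] that by simp
  show "inv0 f \<in> class_Kinf"
  proof (rule class_KinfI)
    show "strict_mono_on {0..} (inv0 f)"
    proof (rule strict_mono_onI)
      fix r s :: real assume "r \<in> {0..}" "s \<in> {0..}" "r < s"
      then show "inv0 f r < inv0 f s"
        using 1 2 class_Kinf_props(3)[OF assms, of "inv0 f s" "inv0 f r"] by fastforce
    qed
    show "inv0 f ` {0..} = {0..}"
      using inj im inv_into_image_cancel[OF inj] by (metis order_refl)
  qed
qed

lemma inv0_iff:
  assumes "f \<in> class_Kinf" "0 \<le> s" "0 \<le> u"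
  shows inv0_le_iff: "inv0 f u \<le> s \<longleftrightarrow> u \<le> f s"
    and le_inv0_iff: "s \<le> inv0 f u \<longleftrightarrow> f s \<le> u"
    and less_inv0_iff: "s < inv0 f u \<longleftrightarrow> f s < u"
  using class_Kinf_inv[OF assms(1)] class_Kinf_props(2,3)[OF assms(1)] assms(2,3)
  by (metis not_le)+

lemma class_K_comp:
  assumes "f \<in> class_K" "g \<in> class_K" shows "(\<lambda>s. f (g s)) \<in> class_K"
  using class_K_props[OF assms(1)] class_K_props[OF assms(2)]
  by (intro class_KI) (auto intro!: continuous_on_compose2[of "{0..}" f "{0..}" g])

lemma class_Kinf_comp:
  assumes "f \<in> class_Kinf" "g \<in> class_Kinf" shows "(\<lambda>s. f (g s)) \<in> class_Kinf"
proof (rule class_KinfI)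
  show "strict_mono_on {0..} (\<lambda>s. f (g s))"
    using class_Kinf_props[OF assms(1)] class_Kinf_props[OF assms(2)] by (auto intro: strict_mono_onI)
  show "(\<lambda>s. f (g s)) ` {0..} = {0..}"
    using class_Kinf_image[OF assms(1)] class_Kinf_image[OF assms(2)] by (metis image_image)
qed

lemma class_Kinf_ge:
  assumes "f \<in> class_K" "g \<in> class_Kinf" "\<And>s. 0 \<le> s \<Longrightarrow> g s \<le> f s" shows "f \<in> class_Kinf"
  using assms(1)
proof (rule class_KinfI_unbounded)
  show "\<exists>s\<ge>0. c \<le> f s" for c
    using class_Kinf_unbounded[OF assms(2), of c] assms(3) by force
qed

lemma class_K_max:
  assumes "f \<in> class_K" "g \<in> class_K" shows "(\<lambda>s. max (f s) (g s)) \<in> class_K"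
proof (rule class_KI)
  note F = class_K_props[OF assms(1)] and G = class_K_props[OF assms(2)]
  show "continuous_on {0..} (\<lambda>s. max (f s) (g s))"
    using F(1) G(1) by (rule continuous_on_max)
  show "max (f s) (g s) < max (f s') (g s')" if "0 \<le> s" "s < s'" for s s'
    using F(2)[OF that] G(2)[OF that] by linarith
qed (simp add: class_K_props[OF assms(1)] class_K_props[OF assms(2)])

lemma class_Kinf_max:
  assumes "f \<in> class_K" "g \<in> class_Kinf" shows "(\<lambda>s. max (f s) (g s)) \<in> class_Kinf"
  by (rule class_Kinf_ge[OF class_K_max[OF assms(1) class_Kinf_K[OF assms(2)]] assms(2)]) simp

lemma class_Kinf_min:
  assumes "f \<in> class_Kinf" "g \<in> class_Kinf" shows "(\<lambda>s. min (f s) (g s)) \<in> class_Kinf"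
proof (rule class_KinfI_unbounded)
  note F = class_Kinf_props[OF assms(1)] and G = class_Kinf_props[OF assms(2)]
  show "(\<lambda>s. min (f s) (g s)) \<in> class_K"
    using F G by (intro class_KI continuous_on_min) (auto simp: min_less_iff_disj)
  show "\<exists>s\<ge>0. c \<le> min (f s) (g s)" for c
  proof -
    obtain s s' where "s \<ge> 0" "f s \<ge> c" "s' \<ge> 0" "g s' \<ge> c"
      using class_Kinf_unbounded assms by meson
    then show ?thesis
      using F(3)[of s "max s s'"] G(3)[of s' "max s s'"] by (intro exI[of _ "max s s'"]) auto
  qed
qed

text \<open>The first summand is taken from \<open>class_SN\<close> because it may be a class K
  function times a coefficient that can vanish, such as \<open>\<rho>_1s\<close>.\<close>

lemma class_K_add:
  assumes "f \<in> class_SN" "f 0 = 0" "g \<in> class_K" shows "(\<lambda>s. f s + g s) \<in> class_K"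
  using class_K_props[OF assms(3)] assms(1,2)
  by (intro class_KI continuous_on_add add_le_less_mono) (auto simp: class_SN_def monotone_on_def)

lemma class_Kinf_add:
  assumes "f \<in> class_SN" "f 0 = 0" "g \<in> class_Kinf" shows "(\<lambda>s. f s + g s) \<in> class_Kinf"
  by (rule class_Kinf_ge[OF class_K_add[OF assms(1,2) class_Kinf_K[OF assms(3)]] assms(3)])
    (use assms(1) in \<open>auto simp: class_SN_def\<close>)

lemma class_SN_scale:
  assumes "f \<in> class_SN" "0 \<le> c" shows "(\<lambda>s. c * f s) \<in> class_SN"
  using assms by (auto simp: class_SN_def monotone_on_def intro!: continuous_on_mult_left mult_left_mono)

lemma class_K_SN: "f \<in> class_K \<Longrightarrow> f \<in> class_SN"
  by (simp add: class_K_def)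

lemma class_Kinf_id: "(\<lambda>s. s) \<in> class_Kinf"
  by (rule class_KinfI) (auto intro: strict_mono_onI)

lemma class_Kinf_scale: "0 < c \<Longrightarrow> (\<lambda>s. c * s) \<in> class_Kinf"
proof (rule class_KinfI_unbounded)
  show "0 < c \<Longrightarrow> \<exists>s\<ge>0. r \<le> c * s" for r
    by (rule exI[of _ "max 0 (r / c)"]) (auto simp: max_def field_simps)
qed (auto intro!: class_KI continuous_intros)

lemma class_Kinf_power2: "(\<lambda>s::real. s\<^sup>2) \<in> class_Kinf"
proof (rule class_KinfI)
  have "s \<in> (\<lambda>x. x\<^sup>2) ` {0..}" if "0 \<le> s" for s :: real
    using that by (intro image_eqI[of _ _ "sqrt s"]) auto
  then show "(\<lambda>x::real. x\<^sup>2) ` {0..} = {0..}" by auto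
qed (auto intro!: strict_mono_onI power_strict_mono)

lemma class_Kinf_sqrt: "sqrt \<in> class_Kinf"
proof (rule class_KinfI)
  have "s \<in> sqrt ` {0..}" if "0 \<le> s" for s :: real
    using that by (intro image_eqI[of _ _ "s\<^sup>2"]) auto
  then show "sqrt ` {0..} = {0..}" by auto
qed (auto intro!: strict_mono_onI)

lemma class_K_scale: "f \<in> class_K \<Longrightarrow> 0 < c \<Longrightarrow> (\<lambda>s. c * f s) \<in> class_K"
  by (rule class_K_comp[OF class_Kinf_K[OF class_Kinf_scale]])

lemma class_K_power2: "f \<in> class_K \<Longrightarrow> (\<lambda>s. (f s)\<^sup>2) \<in> class_K"
  by (rule class_K_comp[OF class_Kinf_K[OF class_Kinf_power2]])

lemma class_Kinf_filterlim:
  assumes "f \<in> class_Kinf" shows "filterlim f at_top at_top"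
proof (subst filterlim_at_top, intro allI)
  fix c
  obtain s where s: "s \<ge> 0" "f s \<ge> c"
    using class_Kinf_unbounded[OF assms] by blast
  show "\<forall>\<^sub>F x in at_top. c \<le> f x"
    using eventually_ge_at_top[of s]
    by eventually_elim (use s class_Kinf_props(3)[OF assms] in force)
qed

section \<open>Saturation and dead zone\<close>

text \<open>A one-sided Huber function: its derivative is the ramp \<open>x / \<epsilon>\<close>
  clipped to [0, 1]. \<open>sat\<close> differs from the identity by one such function at each end
  of the linear range, see \<open>sat_huber\<close>.\<close>

definition huber :: "real \<Rightarrow> real \<Rightarrow> real" where
  "huber \<epsilon> x = (max 0 (min x \<epsilon>))\<^sup>2 / (2 * \<epsilon>) + max 0 (x - \<epsilon>)"

text \<open>\<open>huber\<close> is the maximum of these affine functions, which gives convexity without case distinctions.\<close>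

lemma huber_ge:
  assumes "0 < \<epsilon>" "0 \<le> \<mu>" "\<mu> \<le> 1"
  shows "\<mu> * x - \<mu>\<^sup>2 * \<epsilon> / 2 \<le> huber \<epsilon> x"
proof -
  have quad: "\<mu> * y - \<mu>\<^sup>2 * \<epsilon> / 2 \<le> y\<^sup>2 / (2 * \<epsilon>)" for y
  proof -
    have "0 \<le> (y - \<mu> * \<epsilon>)\<^sup>2"
      by simp
    then show ?thesis
      using assms(1) by (simp add: field_simps power2_eq_square)
  qed
  consider "x \<le> 0" | "0 < x" "x \<le> \<epsilon>" | "\<epsilon> < x"
    by linarith
  then show ?thesis
  proof cases
    case 1
    then have "\<mu> * x \<le> 0"
      using assms by (simp add: mult_nonneg_nonpos)
    moreover have "0 \<le> \<mu>\<^sup>2 * \<epsilon> / 2"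
      using assms by simp
    moreover have "huber \<epsilon> x = 0"
      using 1 assms by (simp add: huber_def)
    ultimately show ?thesis by linarith
  next
    case 2
    then show ?thesis
      using quad[of x] by (simp add: huber_def)
  next
    case 3
    have "\<mu> * (x - \<epsilon>) \<le> 1 * (x - \<epsilon>)"
      using 3 assms by (intro mult_right_mono) auto
    then show ?thesis
      using quad[of \<epsilon>] 3 assms by (simp add: huber_def algebra_simps)
  qed
qed

lemma huber_attained:
  assumes "0 < \<epsilon>"
  obtains \<mu> where "0 \<le> \<mu>" "\<mu> \<le> 1" "huber \<epsilon> x = \<mu> * x - \<mu>\<^sup>2 * \<epsilon> / 2"
proof
  \<comment> \<open>The optimal slope is the derivative of \<open>huber\<close> at \<open>x\<close>,
    the clipped ramp.\<close>
  show "huber \<epsilon> x = max 0 (min (x / \<epsilon>) 1) * x - (max 0 (min (x / \<epsilon>) 1))\<^sup>2 * \<epsilon> / 2"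
    using assms by (auto simp: huber_def max_def min_def field_simps power2_eq_square)
qed auto

lemma huber_mono:
  assumes "0 < \<epsilon>" "x \<le> y" shows "huber \<epsilon> x \<le> huber \<epsilon> y"
proof -
  obtain \<mu> where \<mu>: "0 \<le> \<mu>" "\<mu> \<le> 1" "huber \<epsilon> x = \<mu> * x - \<mu>\<^sup>2 * \<epsilon> / 2"
    using huber_attained[OF assms(1)] by blast
  show ?thesis
    using huber_ge[OF assms(1) \<mu>(1,2), of y] \<mu> mult_left_mono[OF assms(2) \<mu>(1)] by linarith
qed

text \<open>Convexity together with the value 0 at 0. The affine function attaining the value at
  \<open>x\<close> has constant term at most 0, and stretching the argument by \<open>c\<close>
  multiplies its slope part by \<open>c\<close> but leaves that constant as it is.\<close>

lemma huber_mult_ge: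
  assumes "0 < \<epsilon>" "1 \<le> c" shows "c * huber \<epsilon> x \<le> huber \<epsilon> (c * x)"
proof -
  obtain \<mu> where \<mu>: "0 \<le> \<mu>" "\<mu> \<le> 1" "huber \<epsilon> x = \<mu> * x - \<mu>\<^sup>2 * \<epsilon> / 2"
    using huber_attained[OF assms(1)] by blast
  have "1 * (\<mu>\<^sup>2 * \<epsilon> / 2) \<le> c * (\<mu>\<^sup>2 * \<epsilon> / 2)"
    using assms by (intro mult_right_mono) auto
  moreover have "c * huber \<epsilon> x = \<mu> * (c * x) - c * (\<mu>\<^sup>2 * \<epsilon> / 2)"
    by (simp add: \<mu>(3) algebra_simps)
  ultimately show ?thesis
    using huber_ge[OF assms(1) \<mu>(1,2), of "c * x"] by linarith
qed

lemma huber_bounds: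
  assumes "0 < \<epsilon>"
  shows huber_nonneg: "0 \<le> huber \<epsilon> x" and huber_le: "huber \<epsilon> x \<le> max 0 x" and huber_nonpos: "x \<le> 0 \<Longrightarrow> huber \<epsilon> x = 0"
proof -
  obtain \<mu> where \<mu>: "0 \<le> \<mu>" "\<mu> \<le> 1" "huber \<epsilon> x = \<mu> * x - \<mu>\<^sup>2 * \<epsilon> / 2"
    using huber_attained[OF assms(1)] by blast
  show nonneg: "0 \<le> huber \<epsilon> x"
    using huber_ge[OF assms, of 0 x] by simp
  have "\<mu> * x \<le> max 0 x"
    using \<mu> mult_right_mono[OF \<mu>(2), of x] mult_nonneg_nonpos[of \<mu> x] by (cases "0 \<le> x") auto
  moreover have "0 \<le> \<mu>\<^sup>2 * \<epsilon> / 2"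
    using assms by simp
  ultimately show le: "huber \<epsilon> x \<le> max 0 x"
    using \<mu>(3) by linarith
  show "x \<le> 0 \<Longrightarrow> huber \<epsilon> x = 0"
    using nonneg le by auto
qed

lemma sat_huber:
  assumes "0 \<le> l" "0 < \<epsilon>"
  shows "sat l \<epsilon> s = s - huber \<epsilon> (s - l) + huber \<epsilon> (- s - l)"
  using assms by (auto simp: sat_def huber_def sgn_if abs_if max_def min_def field_simps power2_eq_square)

lemma sat_minus: "sat l \<epsilon> (- s) = - sat l \<epsilon> s"
  by (simp add: sat_def)

lemma sat_bound:
  assumes "0 \<le> l" "0 < \<epsilon>" shows "\<bar>sat l \<epsilon> s\<bar> \<le> l + 0.5 * \<epsilon>"
proof -
  \<comment> \<open>The cap \<open>l + 0.5 * \<epsilon>\<close> comes from the supporting line of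
    \<open>huber\<close> with slope 1.\<close>
  have pos: "0 \<le> sat l \<epsilon> s \<and> sat l \<epsilon> s \<le> l + 0.5 * \<epsilon>" if "0 \<le> s" for s
    using assms that huber_ge[OF assms(2), of 1 "s - l"] huber_le[OF assms(2), of "s - l"]
      huber_nonpos[OF assms(2), of "- s - l"]
    by (auto simp: sat_huber[OF assms])
  show ?thesis
    using pos[of s] pos[of "- s"] by (cases "0 \<le> s") (auto simp: sat_minus)
qed

text \<open>The reason is that \<open>sat\<close> is concave on \<open>{- l..}\<close>.\<close>

lemma sat_star_shaped:
  assumes "0 < \<epsilon>" and a: "\<bar>a\<bar> \<le> l" and c: "1 \<le> c"
  shows "\<bar>sat l \<epsilon> (a + c * d) - a\<bar> \<le> c * \<bar>sat l \<epsilon> (a + d) - a\<bar>"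
proof -
  have l: "0 \<le> l" using a by linarith
  have pos: "\<bar>sat l \<epsilon> (a + c * d) - a\<bar> \<le> c * \<bar>sat l \<epsilon> (a + d) - a\<bar>"
    if a: "\<bar>a\<bar> \<le> l" and d: "0 \<le> d" for a d
  proof -
    \<comment> \<open>Moving right from \<open>a \<ge> - l\<close> never reaches the lower corner,
      so only the upper correction remains.\<close>
    have eq: "sat l \<epsilon> (a + e) - a = e - huber \<epsilon> (a + e - l)" if "0 \<le> e" for e
      using a that huber_nonpos[OF assms(1), of "- (a + e) - l"]
      by (simp add: sat_huber[OF l assms(1)])
    have nonneg: "0 \<le> e - huber \<epsilon> (a + e - l)" if "0 \<le> e" for e
      using huber_le[OF assms(1), of "a + e - l"] a that by auto
    \<comment> \<open>Here \<open>a \<le> l\<close> enters: the two sides differ by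
      \<open>(c - 1) * (l - a)\<close>.\<close>
    have "c * (a + d - l) \<le> a + c * d - l"
      using mult_right_mono[OF c, of "l - a"] a by (simp add: algebra_simps)
    then have "c * huber \<epsilon> (a + d - l) \<le> huber \<epsilon> (a + c * d - l)"
      using huber_mult_ge[OF assms(1) c, of "a + d - l"] huber_mono[OF assms(1)] by (meson order_trans)
    moreover have "0 \<le> c * d"
      using c d by simp
    ultimately show ?thesis
      using nonneg[OF d] nonneg[of "c * d"] d by (simp add: eq algebra_simps)
  qed
  show ?thesis
  proof (cases "0 \<le> d")
    case False
    have "\<bar>- (sat l \<epsilon> (a + c * d) - a)\<bar> \<le> c * \<bar>- (sat l \<epsilon> (a + d) - a)\<bar>"
      using pos[of "- a" "- d"] a False sat_minus[of l \<epsilon> "a + c * d"] sat_minus[of l \<epsilon> "a + d"]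
      by simp
    then show ?thesis
      by (simp only: abs_minus_cancel)
  qed (rule pos[OF a])
qed

lemma satv_star_shaped:
  fixes \<theta> d :: "real^'q"
  assumes "0 < \<epsilon>" "\<And>i. \<bar>\<theta> $ i\<bar> \<le> l" "1 \<le> c"
  shows "norm (satv l \<epsilon> (\<theta> + c *\<^sub>R d) - \<theta>) \<le> c * norm (satv l \<epsilon> (\<theta> + d) - \<theta>)"
proof -
  have "norm (satv l \<epsilon> (\<theta> + c *\<^sub>R d) - \<theta>) \<le> norm (c *\<^sub>R (satv l \<epsilon> (\<theta> + d) - \<theta>))"
    using assms sat_star_shaped[OF assms(1) assms(2) assms(3)]
    by (intro norm_le_componentwise_cart) (simp add: satv_def abs_mult)
  then show ?thesis
    using assms(3) by simp
qed

text \<open>The small-gain argument needs \<open>\<gamma> (c * y) \<le> c * \<gamma> y\<close>, which fails for a general class K function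
  but is true of the quantity that \<open>\<gamma>\<close> bounds.\<close>

lemma satv_deviation_scaled:
  fixes \<theta> d :: "real^'q"
  assumes "0 < \<epsilon>" "\<And>i. \<bar>\<theta> $ i\<bar> \<le> l" "\<gamma> \<in> class_K"
    and \<gamma>: "\<And>d. norm (satv l \<epsilon> (\<theta> + d) - \<theta>) \<le> \<gamma> (norm d)"
    and "1 \<le> c" "0 \<le> y" "norm d \<le> c * y"
  shows "norm (satv l \<epsilon> (\<theta> + d) - \<theta>) \<le> c * \<gamma> y"
proof (cases "norm d \<le> y")
  case True
  then have "\<gamma> (norm d) \<le> \<gamma> y"
    by (rule class_K_mono[OF assms(3) norm_ge_zero])
  moreover have "1 * \<gamma> y \<le> c * \<gamma> y"
    using assms class_K_nonneg[OF assms(3)] by (intro mult_right_mono) auto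
  ultimately show ?thesis
    using \<gamma>[of d] by linarith
next
  case False
  show ?thesis
  proof (cases "y = 0")
    case True
    then show ?thesis
      using False assms(7) by simp
  next
    case y: False
    \<comment> \<open>\<open>r\<close> is the overshoot of \<open>d\<close> beyond radius
      \<open>y\<close>. The bound \<gamma> is applied only to the point \<open>d'\<close> of the
      same ray at radius \<open>y\<close>, and the way out to \<open>d\<close> is covered by
      \<open>satv_star_shaped\<close>.\<close>
    define r where "r = norm d / y"
    have r: "1 \<le> r" "r \<le> c"
      using False y assms(6,7) by (auto simp: r_def field_simps)
    define d' where "d' = (1 / r) *\<^sub>R d"
    have d': "d = r *\<^sub>R d'" "norm d' = y"
      using r y False assms(6) by (auto simp: d'_def r_def)
    have "norm (satv l \<epsilon> (\<theta> + d) - \<theta>) \<le> r * norm (satv l \<epsilon> (\<theta> + d') - \<theta>)"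
      unfolding d'(1) by (rule satv_star_shaped[OF assms(1,2) r(1)])
    also have "\<dots> \<le> r * \<gamma> y"
      using \<gamma>[of d'] r d'(2) by (intro mult_left_mono) auto
    also have "\<dots> \<le> c * \<gamma> y"
      using r class_K_nonneg[OF assms(3,6)] by (intro mult_right_mono) auto
    finally show ?thesis .
  qed
qed

lemma satv_ident:
  assumes "norm \<theta> \<le> l" shows "satv l \<epsilon> \<theta> = \<theta>"
proof -
  have "\<bar>\<theta> $ i\<bar> \<le> l" for i
    using component_le_norm_cart[of \<theta> i] assms by linarith
  then show ?thesis
    by (simp add: satv_def sat_def vec_eq_iff)
qed

lemma dzv_eq_0:
  assumes "norm \<theta> \<le> l" shows "dzv l \<theta> = 0"
proof -
  have "\<bar>\<theta> $ i\<bar> \<le> l" for i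
    using component_le_norm_cart[of \<theta> i] assms by linarith
  then show ?thesis
    by (simp add: dzv_def dz_def vec_eq_iff)
qed

lemma continuous_on_vec_map:
  fixes h :: "real \<Rightarrow> real"
  assumes "continuous_on UNIV h"
  shows "continuous_on UNIV (\<lambda>v::real^'q. (\<chi> i. h (v $ i)))"
  by (intro continuous_on_vec_lambda continuous_on_compose2[OF assms] continuous_intros) auto

lemma continuous_on_satv:
  assumes "0 \<le> l" "0 < \<epsilon>" shows "continuous_on UNIV (satv l \<epsilon> :: real^'q \<Rightarrow> real^'q)"
proof -
  have "continuous_on UNIV (\<lambda>s. s - huber \<epsilon> (s - l) + huber \<epsilon> (- s - l))"
    unfolding huber_def using assms by (intro continuous_intros) auto
  then have "continuous_on UNIV (sat l \<epsilon>)"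
    using assms by (simp add: sat_huber cong: continuous_on_cong)
  from continuous_on_vec_map[OF this] show ?thesis
    by (simp add: satv_def[abs_def])
qed

lemma continuous_on_dzv:
  assumes "0 \<le> l" shows "continuous_on UNIV (dzv l :: real^'q \<Rightarrow> real^'q)"
proof -
  \<comment> \<open>The positive branch of \<open>dz\<close> with its corner moved to 0. Clamping
    the variable to [0, 1] puts the cubic transition and the linear tail into one continuous
    expression; at \<open>y = 1\<close> the cubic has the value \<open>l + 1\<close>, where the tail
    takes over.\<close>
  define p where "p x = (let y = max 0 (min x 1) in
    y\<^sup>2 * (2 * (l + 1)\<^sup>2 - (2 * l + 1) * (l + y)) + max 0 (x - 1))" for x
  have p0: "p x = 0" if "x \<le> 0" for x
    using that by (simp add: p_def)
  have p1: "p x = l + x" if "1 \<le> x" for x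
    using that by (simp add: p_def Let_def algebra_simps power2_eq_square)
  have p01: "p x = x\<^sup>2 * (2 * (l + 1)\<^sup>2 - (2 * l + 1) * (l + x))" if "0 < x" "x < 1" for x
    using that by (simp add: p_def Let_def)
  have "dz l s = p (s - l) - p (- s - l)" for s
  proof -
    consider "\<bar>s\<bar> \<le> l" | "l < \<bar>s\<bar>" "\<bar>s\<bar> < l + 1" | "l + 1 \<le> \<bar>s\<bar>"
      by linarith
    then show ?thesis
    proof cases
      case 2
      then show ?thesis
        using assms p0[of "s - l"] p0[of "- s - l"] p01[of "s - l"] p01[of "- s - l"]
        by (cases "0 \<le> s") (auto simp: dz_def)
    next
      case 3
      then show ?thesis
        using assms p0[of "s - l"] p0[of "- s - l"] p1[of "s - l"] p1[of "- s - l"]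
        by (cases "0 \<le> s") (auto simp: dz_def)
    qed (use p0[of "s - l"] p0[of "- s - l"] in \<open>auto simp: dz_def\<close>)
  qed
  then have "dz l = (\<lambda>s. p (s - l) - p (- s - l))"
    by blast
  moreover have "continuous_on UNIV (\<lambda>s. p (s - l) - p (- s - l))"
    unfolding p_def Let_def by (intro continuous_intros)
  ultimately show ?thesis
    using continuous_on_vec_map[of "dz l"] by (simp add: dzv_def[abs_def])
qed

section \<open>Peano's existence theorem\<close>

lemma continuous_on_Ici_iff:
  fixes f :: "real \<Rightarrow> 'a::topological_space"
  shows "continuous_on {a..} f \<longleftrightarrow> (\<forall>b. continuous_on {a..b} f)"
proof
  assume *: "\<forall>b. continuous_on {a..b} f"
  have "continuous (at x within {a..}) f" if "a \<le> x" for x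
  proof -
    have "at x within {a..x + 1} = at x within {a..}"
      by (rule at_within_nhd[of x "{x - 1<..<x + 1}"]) auto
    with *[rule_format, of "x + 1"] that show ?thesis
      by (auto simp: continuous_on_eq_continuous_within dest!: bspec[of _ _ x])
  qed
  then show "continuous_on {a..} f"
    by (simp add: continuous_on_eq_continuous_within)
qed (auto elim: continuous_on_subset)

lemma continuous_on_indefinite_integral_Ici:
  fixes f :: "real \<Rightarrow> 'a::banach"
  assumes "continuous_on {a..} f"
  shows "continuous_on {a..} (\<lambda>t. integral {a..t} f)"
  unfolding continuous_on_Ici_iff
proof
  fix b
  have "continuous_on {a..b} f"
    using assms by (auto elim: continuous_on_subset)
  then show "continuous_on {a..b} (\<lambda>t. integral {a..t} f)"
    by (intro indefinite_integral_continuous_1 integrable_continuous_real)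
qed

lemma indefinite_integral_Lipschitz:
  fixes f :: "real \<Rightarrow> 'a::banach"
  assumes "continuous_on {a..} f" and "\<And>t. a \<le> t \<Longrightarrow> t \<le> T \<Longrightarrow> norm (f t) \<le> M"
    and "s \<in> {a..T}" "t \<in> {a..T}"
  shows "norm (integral {a..t} f - integral {a..s} f) \<le> M * \<bar>t - s\<bar>"
proof -
  have *: "norm (integral {a..t} f - integral {a..s} f) \<le> M * (t - s)"
    if "a \<le> s" "s \<le> t" "t \<le> T" for s t
  proof -
    have cont: "continuous_on {a..t} f" "continuous_on {s..t} f"
      using assms(1) that by (auto elim: continuous_on_subset)
    then have "integral {a..t} f - integral {a..s} f = integral {s..t} f"
      using Henstock_Kurzweil_Integration.integral_combine[OF that(1,2) integrable_continuous_real]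
      by (metis add_diff_cancel_left')
    then show ?thesis
      using integral_bound[OF that(2) cont(2), of M] assms(2) that by simp
  qed
  show ?thesis
    using *[of s t] *[of t s] assms(3,4) by (cases "s \<le> t") (auto simp: norm_minus_commute)
qed

lemma continuous_on_Ici_compose2:
  fixes f :: "real \<Rightarrow> 'a::topological_space \<Rightarrow> 'b::topological_space"
  assumes "continuous_on ({a..} \<times> UNIV) (\<lambda>(t, x). f t x)" and "continuous_on {a..} v"
  shows "continuous_on {a..} (\<lambda>s. f s (v s))"
  using continuous_on_compose2[OF assms(1) continuous_on_Pair[OF continuous_on_id assms(2)]] by auto

text \<open>Tonelli's delayed equation. Its Picard iterates become stationary, one delay at a time.\<close>

lemma delayed_solution_exists:
  fixes f :: "real \<Rightarrow> 'a::banach \<Rightarrow> 'a" and h T :: real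
  assumes f: "continuous_on ({t0..} \<times> UNIV) (\<lambda>(t, x). f t x)" and h: "0 < h"
  obtains u v where "continuous_on {t0..} v"
    "\<And>t. t0 \<le> t \<Longrightarrow> u t = x0 + integral {t0..t} (\<lambda>s. f s (v s))"
    "\<And>s. t0 \<le> s \<Longrightarrow> s \<le> T \<Longrightarrow> v s = u (max t0 (s - h))"
proof -
  \<comment> \<open>\<open>max t0\<close> freezes the history at its initial value during the first
    delay.\<close>
  define z where
    "z = rec_nat (\<lambda>_. x0) (\<lambda>_ w t. x0 + integral {t0..t} (\<lambda>s. f s (w (max t0 (s - h)))))"
  have z0: "z 0 = (\<lambda>_. x0)"
    and zSuc: "z (Suc k) = (\<lambda>t. x0 + integral {t0..t} (\<lambda>s. f s (z k (max t0 (s - h)))))" for k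
    by (simp_all add: z_def)
  have shift: "continuous_on {t0..} (\<lambda>s. w (max t0 (s - h)))" if "continuous_on {t0..} w"
    for w :: "real \<Rightarrow> 'a"
    by (rule continuous_on_compose2[OF that]) (auto intro!: continuous_intros)
  have cont: "continuous_on {t0..} (z k)" for k
  proof (induction k)
    case (Suc k)
    show ?case unfolding zSuc
      by (intro continuous_intros continuous_on_indefinite_integral_Ici
          continuous_on_Ici_compose2[OF f] shift Suc)
  qed (simp add: z0)
  have stationary: "z k t = z (Suc k) t" if "t \<in> {t0..t0 + real k * h}" for k t
    using that
  proof (induction k arbitrary: t)
    case 0
    then have "t = t0" by simp
    then show ?case by (simp add: z0 zSuc)
  next
    case (Suc k)
    have "integral {t0..t} (\<lambda>s. f s (z k (max t0 (s - h))))
        = integral {t0..t} (\<lambda>s. f s (z (Suc k) (max t0 (s - h))))"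
    proof (rule integral_cong)
      fix s assume "s \<in> {t0..t}"
      then have "max t0 (s - h) \<in> {t0..t0 + real k * h}"
        using Suc.prems h by (auto simp: algebra_simps)
      then show "f s (z k (max t0 (s - h))) = f s (z (Suc k) (max t0 (s - h)))"
        using Suc.IH by simp
    qed
    then show ?case
      by (simp add: zSuc[of k] zSuc[of "Suc k"] del: of_nat_Suc)
  qed
  obtain N :: nat where "(T - t0) / h \<le> real N"
    using real_arch_simple by blast
  then have N: "T \<le> t0 + real N * h"
    using h by (simp add: field_simps)
  \<comment> \<open>\<open>N\<close> delays cover the interval up to \<open>T\<close>, so there the
    iterates \<open>N\<close> and \<open>N + 1\<close> agree. Thus \<open>u\<close> is the later
    iterate and \<open>v\<close> the delayed earlier one, and the delayed equation is claimed only
    up to \<open>T\<close>.\<close>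
  show thesis
  proof
    show "continuous_on {t0..} (\<lambda>s. z N (max t0 (s - h)))"
      by (intro shift cont)
    show "z (Suc N) t = x0 + integral {t0..t} (\<lambda>s. f s (z N (max t0 (s - h))))" for t
      by (simp add: zSuc)
    show "z N (max t0 (s - h)) = z (Suc N) (max t0 (s - h))" if "t0 \<le> s" "s \<le> T" for s
      using that N h by (intro stationary) auto
  qed
qed

text \<open>Arzela-Ascoli on intervals of integer length, followed by a diagonal choice. Pointwise
  convergence is all that is kept, since the limit equation is obtained by dominated
  convergence.\<close>

lemma convergent_subsequence_Ici:
  fixes u :: "nat \<Rightarrow> real \<Rightarrow> 'a::euclidean_space"
  assumes bound: "\<And>T n t. t0 \<le> t \<Longrightarrow> t \<le> T \<Longrightarrow> norm (u n t) \<le> B T"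
    and Lip: "\<And>T n s t. s \<in> {t0..T} \<Longrightarrow> t \<in> {t0..T} \<Longrightarrow> norm (u n t - u n s) \<le> M T * \<bar>t - s\<bar>"
  obtains k :: "nat \<Rightarrow> nat" where "strict_mono k" "\<And>t. t0 \<le> t \<Longrightarrow> convergent (\<lambda>n. u (k n) t)"
proof -
  define P where "P i r \<longleftrightarrow> (\<forall>t\<in>{t0..t0 + real i}. convergent (\<lambda>n. u (r n) t))"
    for i :: nat and r :: "nat \<Rightarrow> nat"
  have sub: "\<exists>k. strict_mono (k :: nat \<Rightarrow> nat) \<and> P i (r \<circ> k)" for i r
  proof -
    \<comment> \<open>The maximum with 1 makes \<open>e / ?M\<close> a positive radius whatever the
      value of \<open>M\<close>.\<close>
    let ?S = "{t0..t0 + real i}" and ?M = "max (M (t0 + real i)) 1"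
    have equi: "\<exists>d>0. \<forall>n y. y \<in> ?S \<and> norm (x - y) < d \<longrightarrow> norm (u (r n) x - u (r n) y) < e"
      if "x \<in> ?S" "0 < e" for x e
    proof (intro exI[of _ "e / ?M"] conjI allI impI)
      fix n y assume y: "y \<in> ?S \<and> norm (x - y) < e / ?M"
      have "norm (u (r n) x - u (r n) y) \<le> M (t0 + real i) * \<bar>x - y\<bar>"
        using y that by (intro Lip) auto
      also have "\<dots> \<le> ?M * \<bar>x - y\<bar>"
        by (intro mult_right_mono) auto
      also have "\<dots> < e"
        using y by (simp add: pos_less_divide_eq mult.commute)
      finally show "norm (u (r n) x - u (r n) y) < e" .
    qed (use that in auto)
    have bounded: "\<And>n t. t \<in> ?S \<Longrightarrow> norm (u (r n) t) \<le> B (t0 + real i)"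
      using bound by auto
    obtain g and k :: "nat \<Rightarrow> nat" where k: "strict_mono k"
      and g: "\<And>e. 0 < e \<Longrightarrow> \<exists>N. \<forall>n x. N \<le> n \<and> x \<in> ?S \<longrightarrow> norm (u (r (k n)) x - g x) < e"
      by (rule Arzela_Ascoli[of ?S "\<lambda>n. u (r n)", OF compact_Icc bounded equi]) blast+
    have "(\<lambda>n. u (r (k n)) t) \<longlonglongrightarrow> g t" if "t \<in> ?S" for t
      using g that unfolding LIMSEQ_iff by meson
    then have "P i (r \<circ> k)"
      unfolding P_def convergent_def o_def by blast
    with k show ?thesis by blast
  qed
  \<comment> \<open>The diagonal sequence is only eventually drawn from the subsequence of stage
    \<open>i\<close>; convergence survives this because the indices drawn still tend to
    infinity.\<close>
  have P_P: "P i (r \<circ> k2)"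
    if k1: "P i (r \<circ> k1)" and k2: "\<And>j. N \<le> j \<Longrightarrow> \<exists>j'\<ge>j. k2 j = k1 j'" for i r k1 k2 N
    unfolding P_def
  proof
    fix t assume "t \<in> {t0..t0 + real i}"
    then have "convergent (\<lambda>n. u (r (k1 n)) t)"
      using k1 by (simp add: P_def)
    then obtain l where l: "(\<lambda>n. u (r (k1 n)) t) \<longlonglongrightarrow> l"
      by (auto simp: convergent_def)
    have "(\<lambda>n. u (r (k2 n)) t) \<longlonglongrightarrow> l"
      unfolding LIMSEQ_iff
    proof (intro allI impI)
      fix e :: real assume "0 < e"
      then obtain N' where "\<And>n. N' \<le> n \<Longrightarrow> norm (u (r (k1 n)) t - l) < e"
        using l unfolding LIMSEQ_iff by blast
      then show "\<exists>no. \<forall>n\<ge>no. norm (u (r (k2 n)) t - l) < e"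
        using k2 by (intro exI[of _ "max N N'"]) (metis max.bounded_iff order_trans)
    qed
    then show "convergent (\<lambda>n. u ((r \<circ> k2) n) t)"
      by (auto simp: convergent_def)
  qed
  obtain k :: "nat \<Rightarrow> nat" where k: "strict_mono k" "\<And>i. P i (id \<circ> k)"
  proof (rule subsequence_diagonalization_lemma[of P id])
    show "\<exists>k. strict_mono (k :: nat \<Rightarrow> nat) \<and> P i (r \<circ> k)" for i r
      by (rule sub)
    show "P i (r \<circ> k2)"
      if "P i (r \<circ> k1)" "\<And>j. N \<le> j \<Longrightarrow> \<exists>j'\<ge>j. k2 j = k1 j'" for i r k1 k2 N
      using that by (rule P_P)
  qed blast
  have "convergent (\<lambda>n. u (k n) t)" if "t0 \<le> t" for t
  proof -
    obtain i :: nat where "t - t0 \<le> real i"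
      using real_arch_simple by blast
    with k(2)[of i] that show ?thesis
      by (simp add: P_def)
  qed
  with k(1) show thesis
    using that by blast
qed

text \<open>A bound on the field over all states, uniform up to each time \<open>T\<close>, makes
  the approximations equicontinuous on every bounded interval and excludes finite escape, so the
  solution lives on the whole half-line.\<close>

theorem peano_global:
  fixes f :: "real \<Rightarrow> 'a::euclidean_space \<Rightarrow> 'a"
  assumes f: "continuous_on ({t0..} \<times> UNIV) (\<lambda>(t, x). f t x)"
    and M: "\<And>T t x. t0 \<le> t \<Longrightarrow> t \<le> T \<Longrightarrow> norm (f t x) \<le> M T"
  obtains X where "X t0 = x0" "ode_solution f {t0..} X"
proof -
  \<comment> \<open>The delay shrinks to 0 while the horizon \<open>t0 + real n\<close>, up to which
    approximation \<open>n\<close> satisfies its delayed equation, grows without bound.\<close>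
  define h where "h n = 1 / (real n + 1)" for n :: nat
  have h: "0 < h n" for n
    by (simp add: h_def)
  have "\<forall>n. \<exists>u v. continuous_on {t0..} v \<and>
    (\<forall>t\<ge>t0. u t = x0 + integral {t0..t} (\<lambda>s. f s (v s))) \<and>
    (\<forall>s. t0 \<le> s \<and> s \<le> t0 + real n \<longrightarrow> v s = u (max t0 (s - h n)))"
  proof
    fix n
    obtain u v where "continuous_on {t0..} v"
      "\<And>t. t0 \<le> t \<Longrightarrow> u t = x0 + integral {t0..t} (\<lambda>s. f s (v s))"
      "\<And>s. t0 \<le> s \<Longrightarrow> s \<le> t0 + real n \<Longrightarrow> v s = u (max t0 (s - h n))"
      using delayed_solution_exists[OF f h[of n], of x0 "t0 + real n"] by metis
    then show "\<exists>u v. continuous_on {t0..} v \<and>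
      (\<forall>t\<ge>t0. u t = x0 + integral {t0..t} (\<lambda>s. f s (v s))) \<and>
      (\<forall>s. t0 \<le> s \<and> s \<le> t0 + real n \<longrightarrow> v s = u (max t0 (s - h n)))"
      by blast
  qed
  then obtain u v where v: "\<And>n. continuous_on {t0..} (v n)"
    and u: "\<And>n t. t0 \<le> t \<Longrightarrow> u n t = x0 + integral {t0..t} (\<lambda>s. f s (v n s))"
    and vu: "\<And>n s. t0 \<le> s \<Longrightarrow> s \<le> t0 + real n \<Longrightarrow> v n s = u n (max t0 (s - h n))"
    by metis
  note fv = continuous_on_Ici_compose2[OF f v]
  have Lip: "norm (u n t - u n s) \<le> M T * \<bar>t - s\<bar>" if "s \<in> {t0..T}" "t \<in> {t0..T}" for n s t T
    using indefinite_integral_Lipschitz[OF fv M that] that by (simp add: u)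
  have bound: "norm (u n t) \<le> norm x0 + M T * (T - t0)" if "t0 \<le> t" "t \<le> T" for n t T
  proof -
    have "0 \<le> M T"
      using M[of t0 T x0] that norm_ge_zero[of "f t0 x0"] by linarith
    moreover have "norm (u n t - x0) \<le> M T * \<bar>t - t0\<bar>"
      using Lip[of t0 T t n] u[of t0 n] that by simp
    moreover have "M T * \<bar>t - t0\<bar> \<le> M T * (T - t0)"
      using that calculation(1) by (intro mult_left_mono) auto
    ultimately show ?thesis
      using norm_triangle_sub[of "u n t" x0] by linarith
  qed
  obtain k :: "nat \<Rightarrow> nat" where k: "strict_mono k"
    and conv: "\<And>t. t0 \<le> t \<Longrightarrow> convergent (\<lambda>n. u (k n) t)"
    using convergent_subsequence_Ici[of t0 u "\<lambda>T. norm x0 + M T * (T - t0)" M] bound Lip by blast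
  define X where "X t = lim (\<lambda>n. u (k n) t)" for t
  have X: "(\<lambda>n. u (k n) t) \<longlonglongrightarrow> X t" if "t0 \<le> t" for t
    using conv[OF that] by (simp add: X_def convergent_LIMSEQ_iff)
  have h0: "(\<lambda>n. h (k n)) \<longlonglongrightarrow> 0"
    using LIMSEQ_subseq_LIMSEQ[OF LIMSEQ_inverse_real_of_nat k]
    by (simp add: h_def o_def inverse_eq_divide add.commute)
  \<comment> \<open>The delayed argument lies within \<open>h (k n)\<close> of \<open>s\<close>, so
    by the Lipschitz bound \<open>v\<close> and \<open>u\<close> have the same limit.\<close>
  have vX: "(\<lambda>n. v (k n) s) \<longlonglongrightarrow> X s" if s: "t0 \<le> s" for s
  proof -
    obtain n0 :: nat where n0: "s - t0 \<le> real n0"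
      using real_arch_simple by blast
    have "\<forall>\<^sub>F n in sequentially. norm (v (k n) s - u (k n) s) \<le> M s * h (k n)"
      using eventually_ge_at_top[of n0]
    proof eventually_elim
      case (elim n)
      have Ms: "0 \<le> M s"
        using M[of s s x0] s norm_ge_zero[of "f s x0"] by linarith
      have "n \<le> k n"
        using k by (rule strict_mono_imp_increasing)
      then have "v (k n) s = u (k n) (max t0 (s - h (k n)))"
        using elim n0 s by (intro vu) auto
      then have "norm (v (k n) s - u (k n) s) \<le> M s * \<bar>max t0 (s - h (k n)) - s\<bar>"
        using Lip[of s s "max t0 (s - h (k n))" "k n"] s h[of "k n"] by auto
      also have "\<dots> \<le> M s * h (k n)"
        using s h[of "k n"] Ms by (intro mult_left_mono) auto
      finally show ?case .
    qed
    moreover have "(\<lambda>n. M s * h (k n)) \<longlonglongrightarrow> 0"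
      using tendsto_mult_right_zero[OF h0] .
    ultimately have "(\<lambda>n. v (k n) s - u (k n) s) \<longlonglongrightarrow> 0"
      by (rule Lim_null_comparison)
    from tendsto_add[OF this X[OF s]] show ?thesis
      by simp
  qed
  have eq: "X t = x0 + integral {t0..t} (\<lambda>s. f s (X s))" if t: "t0 \<le> t" for t
  proof -
    have "(\<lambda>n. integral {t0..t} (\<lambda>s. f s (v (k n) s))) \<longlonglongrightarrow> integral {t0..t} (\<lambda>s. f s (X s))"
    proof (rule dominated_convergence(2)[where h = "\<lambda>_. M t"])
      show "(\<lambda>s. f s (v (k n) s)) integrable_on {t0..t}" for n
        using fv[of "k n"] by (auto intro!: integrable_continuous_real elim: continuous_on_subset)
      show "(\<lambda>n. f s (v (k n) s)) \<longlonglongrightarrow> f s (X s)" if "s \<in> {t0..t}" for s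
      proof -
        have "continuous_on UNIV (\<lambda>x. (\<lambda>(t, x). f t x) (s, x))"
          by (rule continuous_on_compose2[OF f]) (use that in \<open>auto intro!: continuous_intros\<close>)
        then have "continuous_on UNIV (f s)"
          by simp
        then show ?thesis
          using continuous_on_tendsto_compose[of UNIV "f s", OF _ vX[of s]] that by auto
      qed
    qed (use M in auto)
    then have "(\<lambda>n. u (k n) t) \<longlonglongrightarrow> x0 + integral {t0..t} (\<lambda>s. f s (X s))"
      using t by (auto simp: u intro!: tendsto_intros)
    with X[OF t] show ?thesis
      by (rule LIMSEQ_unique)
  qed
  have LipX: "norm (X t - X s) \<le> M T * \<bar>t - s\<bar>" if "s \<in> {t0..T}" "t \<in> {t0..T}" for s t T
    using that by (intro LIMSEQ_le_const2[OF tendsto_norm[OF tendsto_diff[OF X X]]]) (auto intro!: exI[of _ 0] Lip)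
  have "continuous_on {t0..T} X" for T
  proof (cases "t0 \<le> T")
    case True
    then have "0 \<le> M T"
      using M[of t0 T x0] norm_ge_zero[of "f t0 x0"] by linarith
    then have "(M T)-lipschitz_on {t0..T} X"
      using LipX by (intro lipschitz_onI) (auto simp: dist_norm)
    then show ?thesis
      by (rule lipschitz_on_continuous_on)
  qed simp
  then have fX: "continuous_on {t0..} (\<lambda>s. f s (X s))"
    by (intro continuous_on_Ici_compose2[OF f]) (simp add: continuous_on_Ici_iff)
  have "(X has_vector_derivative f t (X t)) (at t within {t0..})" if t: "t0 \<le> t" for t
  proof -
    have "((\<lambda>u. integral {t0..u} (\<lambda>s. f s (X s))) has_vector_derivative f t (X t))
        (at t within {t0..t + 1})"
      using t by (intro integral_has_vector_derivative continuous_on_subset[OF fX]) auto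
    then have "((\<lambda>u. x0 + integral {t0..u} (\<lambda>s. f s (X s))) has_vector_derivative f t (X t))
        (at t within {t0..t + 1})"
      by (auto intro!: derivative_eq_intros)
    also have "at t within {t0..t + 1} = at t within {t0..}"
      by (rule at_within_nhd[of t "{t - 1<..<t + 1}"]) auto
    finally show ?thesis
      by (rule has_vector_derivative_transform_within[OF _ zero_less_one]) (use t eq in auto)
  qed
  moreover have "X t0 = x0"
    using eq[of t0] by simp
  ultimately show thesis
    using that unfolding ode_solution_def by auto
qed

section \<open>Uniform asymptotic stability from decrease to the right\<close>

text \<open>Continuous induction: the times up to \<open>t\<close> at which the bound holds form a
  closed set, so a last one exists; unless it is \<open>t\<close> itself, the step hypothesis
  carries the bound beyond it.\<close>

lemma right_induct_le:
  fixes z :: "real \<Rightarrow> real"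
  assumes cont: "continuous_on {a..b} z" and "z a \<le> C" and t: "t \<in> {a..b}"
    and step: "\<And>t. a \<le> t \<Longrightarrow> t < b \<Longrightarrow> z t \<le> C \<Longrightarrow> \<forall>\<^sub>F s in at_right t. z s \<le> C"
  shows "z t \<le> C"
proof (rule ccontr)
  assume "\<not> z t \<le> C"
  define S where "S = {s \<in> {a..t}. z s \<le> C}"
  have "continuous_on {a..t} z"
    using cont t by (auto elim: continuous_on_subset)
  then have "closed S"
    unfolding S_def by (intro continuous_on_closed_Collect_le) auto
  moreover have "S \<noteq> {}" "bdd_above S"
    using assms(2) t by (auto simp: S_def)
  ultimately have p: "Sup S \<in> S" and upper: "\<And>s. s \<in> S \<Longrightarrow> s \<le> Sup S"
    by (auto intro: closed_contains_Sup cSup_upper)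
  have "Sup S < t"
    using p \<open>\<not> z t \<le> C\<close> by (auto simp: S_def order_le_less)
  have "\<forall>\<^sub>F s in at_right (Sup S). z s \<le> C"
    using p \<open>Sup S < t\<close> t by (intro step) (auto simp: S_def)
  moreover have "\<forall>\<^sub>F s in at_right (Sup S). s \<in> {Sup S<..<t}"
    using \<open>Sup S < t\<close> by (rule eventually_at_right_real)
  ultimately have "\<forall>\<^sub>F s in at_right (Sup S). False"
  proof eventually_elim
    case (elim s)
    then have "s \<in> S"
      using p by (auto simp: S_def)
    with upper[of s] elim show False by auto
  qed
  then show False by simp
qed

lemma has_vector_derivative_at_right_Icc:
  assumes "(X has_vector_derivative D) (at t within {a..b})" "a \<le> t" "t < b"
  shows "(X has_vector_derivative D) (at_right t)"
proof -
  have "(X has_vector_derivative D) (at t within {t..b})"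
    using assms(1) by (rule has_vector_derivative_within_subset) (use assms in auto)
  then show ?thesis
    using assms by (simp add: at_within_Icc_at_right)
qed

lemma ode_solution_at_right:
  assumes "ode_solution f {a..b} X" "a \<le> t" "t < b"
  shows "(X has_vector_derivative f t (X t)) (at_right t)"
proof -
  have "(X has_vector_derivative f t (X t)) (at t within {a..b})"
    using assms by (auto simp: ode_solution_def)
  from has_vector_derivative_at_right_Icc[OF this assms(2,3)] show ?thesis .
qed

lemma ode_solution_subset:
  assumes "ode_solution f I X" "J \<subseteq> I" shows "ode_solution f J X"
  unfolding ode_solution_def
proof
  fix t assume "t \<in> J"
  then have "(X has_vector_derivative f t (X t)) (at t within I)"
    using assms by (auto simp: ode_solution_def)
  then show "(X has_vector_derivative f t (X t)) (at t within J)"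
    using assms(2) by (rule has_vector_derivative_within_subset)
qed

lemma ode_solution_continuous:
  assumes "ode_solution f I X" shows "continuous_on I X"
  unfolding continuous_on_eq_continuous_within
proof
  fix t assume "t \<in> I"
  then have "(X has_vector_derivative f t (X t)) (at t within I)"
    using assms by (simp add: ode_solution_def)
  then show "continuous (at t within I) X"
    by (rule has_vector_derivative_continuous)
qed

text \<open>Only the decrease of \<open>Z\<close> to the right of the current time is required, so that \<open>Z\<close> may be a
  maximum and need not be differentiable along solutions.\<close>

locale decreasing_function =
  fixes f :: "real \<Rightarrow> 'a::euclidean_space \<Rightarrow> 'a" and Z :: "real \<Rightarrow> 'a \<Rightarrow> real" and A B :: "real \<Rightarrow> real"
  assumes f0: "\<And>t. 0 \<le> t \<Longrightarrow> f t 0 = 0"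
    and f: "continuous_on ({0..} \<times> UNIV) (\<lambda>(t, x). f t x)"
    and Z: "continuous_on ({0..} \<times> UNIV) (\<lambda>(t, x). Z t x)"
    and A: "A \<in> class_Kinf" and B: "B \<in> class_Kinf"
    and AZ: "\<And>t x. 0 \<le> t \<Longrightarrow> A (norm x) \<le> Z t x" and ZB: "\<And>t x. 0 \<le> t \<Longrightarrow> Z t x \<le> B (norm x)"
    and dec: "\<And>l. 0 < l \<Longrightarrow> \<exists>m>0. \<forall>t\<ge>0. \<forall>X. (X has_vector_derivative f t (X t)) (at_right t) \<longrightarrow>
       l \<le> Z t (X t) \<longrightarrow> (\<forall>\<^sub>F s in at_right t. Z s (X s) \<le> Z t (X t) - m * (s - t))"
begin

lemma Z_along_continuous:
  assumes "continuous_on {a..b} X" "0 \<le> a"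
  shows "continuous_on {a..b} (\<lambda>s. Z s (X s))"
  using continuous_on_compose2[OF Z continuous_on_Pair[OF continuous_on_id assms(1)]] assms(2)
  by (simp add: image_subset_iff)

lemma Z_nonneg: "0 \<le> t \<Longrightarrow> 0 \<le> Z t x"
  using order_trans[OF class_Kinf_props(5)[OF A norm_ge_zero] AZ] .

text \<open>The differential equation is demanded only while \<open>Z\<close> is at most
  \<open>C\<close>. This lets the lemma be applied to a solution of a truncated field that agrees
  with \<open>f\<close> just on the sublevel set.\<close>

lemma Z_stays_below:
  assumes X: "continuous_on {a..b} X" and a: "0 \<le> a" and t: "t \<in> {a..b}"
    and C: "Z a (X a) \<le> C" "0 < C"
    and der: "\<And>t. a \<le> t \<Longrightarrow> t < b \<Longrightarrow> Z t (X t) \<le> C \<Longrightarrow> (X has_vector_derivative f t (X t)) (at_right t)"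
  shows "Z t (X t) \<le> C"
proof (rule right_induct_le[OF Z_along_continuous[OF X a] C(1) t])
  fix t assume t: "a \<le> t" "t < b" "Z t (X t) \<le> C"
  show "\<forall>\<^sub>F s in at_right t. Z s (X s) \<le> C"
  \<comment> \<open>On the level the decrease keeps \<open>Z\<close> from rising; strictly below it
    continuity is enough.\<close>
  proof (cases "Z t (X t) = C")
    case True
    have t': "0 \<le> t" "C \<le> Z t (X t)"
      using t(1) a True by auto
    obtain m where m: "m > 0" "\<forall>t\<ge>0. \<forall>X. (X has_vector_derivative f t (X t)) (at_right t) \<longrightarrow>
        C \<le> Z t (X t) \<longrightarrow> (\<forall>\<^sub>F s in at_right t. Z s (X s) \<le> Z t (X t) - m * (s - t))"
      using dec[OF C(2)] by (elim exE conjE)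
    from m(2)[rule_format, OF t'(1) der[OF t] t'(2)] eventually_at_right_less[of t] show ?thesis
    proof eventually_elim
      case (elim s)
      then have "0 \<le> m * (s - t)"
        using m(1) by auto
      with elim True show ?case by linarith
    qed
  next
    case False
    have "continuous_on {t..b} (\<lambda>s. Z s (X s))"
      using Z_along_continuous[OF X a] t by (auto elim: continuous_on_subset)
    then have "((\<lambda>s. Z s (X s)) \<longlongrightarrow> Z t (X t)) (at_right t)"
      unfolding continuous_on_def using t(2) by (subst at_within_Icc_at_right[symmetric, of t b]) auto
    then have "\<forall>\<^sub>F s in at_right t. Z s (X s) < C"
      using False t by (intro order_tendstoD) auto
    then show ?thesis
      by eventually_elim simp
  qed
qed

lemma Z_nonincreasing:
  assumes sol: "ode_solution f {a..b} X" and "0 \<le> a" "a \<le> b"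
  shows "Z b (X b) \<le> Z a (X a)"
\<comment> \<open>The initial value may be 0, where \<open>dec\<close> gives no information; every
  level strictly above it is positive.\<close>
proof (rule dense_ge)
  fix C assume C: "Z a (X a) < C"
  have "0 \<le> Z a (X a)"
    using assms by (intro Z_nonneg)
  with C assms show "Z b (X b) \<le> C"
    by - (rule Z_stays_below[OF ode_solution_continuous[OF sol]],
      auto intro: ode_solution_at_right[OF sol])
qed

text \<open>Since \<open>Z\<close> is nonincreasing, being at least \<open>l\<close> at the end
  forces it to be at least \<open>l\<close> on the whole interval, so one rate \<open>m\<close>
  applies throughout.\<close>

lemma Z_decay:
  assumes l: "0 < l"
  shows "\<exists>m>0. \<forall>a b X. 0 \<le> a \<longrightarrow> a \<le> b \<longrightarrow> ode_solution f {a..b} X \<longrightarrow> l \<le> Z b (X b)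
      \<longrightarrow> Z b (X b) \<le> Z a (X a) - m * (b - a)"
proof -
  obtain m where m: "m > 0" "\<forall>t\<ge>0. \<forall>X. (X has_vector_derivative f t (X t)) (at_right t) \<longrightarrow>
      l \<le> Z t (X t) \<longrightarrow> (\<forall>\<^sub>F s in at_right t. Z s (X s) \<le> Z t (X t) - m * (s - t))"
    using dec[OF l] by (elim exE conjE)
  have decay: "Z b (X b) \<le> Z a (X a) - m * (b - a)"
    if ab: "0 \<le> a" "a \<le> b" and sol: "ode_solution f {a..b} X" and "l \<le> Z b (X b)" for a b X
  proof -
    have ge: "l \<le> Z t (X t)" if "t \<in> {a..b}" for t
      using Z_nonincreasing[OF ode_solution_subset[OF sol, of "{t..b}"]] that ab \<open>l \<le> Z b (X b)\<close>
      by auto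
    have "Z b (X b) + m * (b - a) \<le> Z a (X a)"
    proof (rule right_induct_le[of a b "\<lambda>t. Z t (X t) + m * (t - a)"])
      show "continuous_on {a..b} (\<lambda>t. Z t (X t) + m * (t - a))"
        by (intro continuous_intros Z_along_continuous ode_solution_continuous[OF sol] ab)
      fix t assume t: "a \<le> t" "t < b" "Z t (X t) + m * (t - a) \<le> Z a (X a)"
      have "\<forall>\<^sub>F s in at_right t. Z s (X s) \<le> Z t (X t) - m * (s - t)"
        using t ab ge by (intro m(2)[rule_format] ode_solution_at_right[OF sol]) auto
      then show "\<forall>\<^sub>F s in at_right t. Z s (X s) + m * (s - a) \<le> Z a (X a)"
        by eventually_elim (use t in \<open>simp add: algebra_simps\<close>)
    qed (use ab in auto)
    then show ?thesis by simp
  qed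
  with m(1) show ?thesis
    by blast
qed

lemma global_solution_exists:
  assumes t0: "0 \<le> t0"
  obtains X where "X t0 = x0" "ode_solution f {t0..} X"
proof -
  \<comment> \<open>Adding 1 makes the level positive even for a start at the origin.\<close>
  define C where "C = Z t0 x0 + 1"
  have "0 \<le> Z t0 x0"
    using t0 by (rule Z_nonneg)
  then have C: "0 < C" "Z t0 x0 \<le> C"
    by (auto simp: C_def)
  define R where "R = inv0 A C"
  have R: "0 \<le> R"
    using inv0_nonneg[OF A] C by (simp add: R_def)
  have ball: "x \<in> cball 0 R" if "Z t x \<le> C" "0 \<le> t" for t x
  proof -
    have "A (norm x) \<le> C"
      using order_trans[OF AZ[OF that(2)] that(1)] .
    then show ?thesis
      using le_inv0_iff[OF A norm_ge_zero, of C x] C by (simp add: R_def)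
  qed
  \<comment> \<open>Composing with the projection onto a ball that contains the sublevel set leaves
    the field unchanged on the ball and makes it bounded up to each time, as
    \<open>peano_global\<close> requires.\<close>
  define p where "p = closest_point (cball (0::'a) R)"
  define g where "g t x = f t (p x)" for t x
  have ne: "cball (0::'a) R \<noteq> {}"
    using R by simp
  have p: "p x \<in> cball 0 R" "continuous_on UNIV p" "x \<in> cball 0 R \<Longrightarrow> p x = x" for x
    using ne closest_point_in_set[OF closed_cball ne, of x] closest_point_self[of x "cball 0 R"]
      continuous_on_closest_point[OF convex_cball closed_cball ne, of UNIV]
    by (simp_all only: p_def)
  have g: "continuous_on ({t0..} \<times> UNIV) (\<lambda>(t, x). g t x)"
  proof -
    have "continuous_on ({t0..} \<times> UNIV) (\<lambda>y. (\<lambda>(t, x). f t x) (fst y, p (snd y)))"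
    proof (rule continuous_on_compose2[OF f])
      have "continuous_on ({t0..} \<times> UNIV) (\<lambda>y. p (snd y))"
        by (rule continuous_on_compose2[OF p(2) continuous_on_snd[OF continuous_on_id]]) simp
      then show "continuous_on ({t0..} \<times> UNIV) (\<lambda>y. (fst y, p (snd y)))"
        by (intro continuous_intros)
    qed (use t0 in auto)
    then show ?thesis
      by (simp add: g_def case_prod_beta)
  qed
  have "\<forall>T. \<exists>M. \<forall>t x. t0 \<le> t \<longrightarrow> t \<le> T \<longrightarrow> norm (g t x) \<le> M"
  proof
    fix T
    have "compact ((\<lambda>(t, x). f t x) ` ({t0..T} \<times> cball 0 R))"
      using t0 by (intro compact_continuous_image continuous_on_subset[OF f] compact_Times) auto
    then have "bounded ((\<lambda>(t, x). f t x) ` ({t0..T} \<times> cball 0 R))"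
      by (rule compact_imp_bounded)
    then obtain M where "\<forall>y\<in>(\<lambda>(t, x). f t x) ` ({t0..T} \<times> cball 0 R). norm y \<le> M"
      unfolding bounded_iff by blast
    then have "norm (g t x) \<le> M" if "t0 \<le> t" "t \<le> T" for t x
      using p(1)[of x] that unfolding g_def by (auto simp del: mem_cball)
    then show "\<exists>M. \<forall>t x. t0 \<le> t \<longrightarrow> t \<le> T \<longrightarrow> norm (g t x) \<le> M"
      by blast
  qed
  then have "\<exists>M. \<forall>T t x. t0 \<le> t \<longrightarrow> t \<le> T \<longrightarrow> norm (g t x) \<le> M T"
    by (rule choice)
  then obtain M where "\<forall>T t x. t0 \<le> t \<longrightarrow> t \<le> T \<longrightarrow> norm (g t x) \<le> M T" ..
  then have M: "norm (g t x) \<le> M T" if "t0 \<le> t" "t \<le> T" for T t x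
    using that by simp
  obtain X where X: "X t0 = x0" "ode_solution g {t0..} X"
    using peano_global[where f = g, OF g M] .
  have sol: "ode_solution g {t0..b} X" for b
    using X(2) by (rule ode_solution_subset) auto
  \<comment> \<open>Inside the sublevel set \<open>g\<close> and \<open>f\<close> coincide, so the
    truncated solution obeys the decrease of \<open>Z\<close> and never leaves the region where the
    truncation is invisible.\<close>
  have below: "Z t (X t) \<le> C" if "t0 \<le> t" for t
  proof (rule Z_stays_below[OF ode_solution_continuous[OF sol[of t]]])
    fix s assume s: "t0 \<le> s" "s < t" "Z s (X s) \<le> C"
    have "g s (X s) = f s (X s)"
      using ball[OF s(3)] s t0 by (simp add: g_def p del: mem_cball)
    then show "(X has_vector_derivative f s (X s)) (at_right s)"
      using ode_solution_at_right[OF sol s(1,2)] by simp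
  qed (use that C X(1) t0 in auto)
  have "g t (X t) = f t (X t)" if "t0 \<le> t" for t
    using ball[OF below[OF that]] that t0 by (simp add: g_def p del: mem_cball)
  then have "ode_solution f {t0..} X"
    using X(2) by (simp add: ode_solution_def)
  with X(1) show thesis
    by (rule that)
qed

lemma norm_bound: "0 \<le> t \<Longrightarrow> 0 \<le> c \<Longrightarrow> Z t x < A c \<Longrightarrow> norm x < c"
  using AZ[of t x] class_Kinf_props(3)[OF A, of c "norm x"] by (cases "norm x < c") auto

theorem zero_UGAS: "zero_UGAS f"
  unfolding zero_UGAS_def
proof (intro conjI allI impI)
  show "\<exists>\<delta>. filterlim \<delta> at_top at_top \<and> (\<forall>\<epsilon>>0. \<delta> \<epsilon> > (0::real) \<and>
    (\<forall>t0\<ge>0. \<forall>t\<ge>t0. \<forall>X. ode_solution f {t0..t} X \<and> norm (X t0) < \<delta> \<epsilon> \<longrightarrow> norm (X t) < \<epsilon>))"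
  \<comment> \<open>Below this radius \<open>Z\<close> starts under \<open>A \<epsilon>\<close> and
    stays there; the radius tends to infinity because the composition is of class
    K-infinity.\<close>
  proof (intro exI[of _ "\<lambda>\<epsilon>. inv0 B (A \<epsilon>)"] conjI allI impI)
    show "filterlim (\<lambda>\<epsilon>. inv0 B (A \<epsilon>)) at_top at_top"
      by (rule class_Kinf_filterlim[OF class_Kinf_comp[OF inv0_Kinf[OF B] A]])
    show "0 < inv0 B (A \<epsilon>)" if "0 < \<epsilon>" for \<epsilon>
      by (rule class_Kinf_props(6)[OF inv0_Kinf[OF B] class_Kinf_props(6)[OF A that]])
    fix \<epsilon> t0 t :: real and X
    assume "0 < \<epsilon>" "0 \<le> t0" "t0 \<le> t" "ode_solution f {t0..t} X \<and> norm (X t0) < inv0 B (A \<epsilon>)"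
    moreover from this have "B (norm (X t0)) < A \<epsilon>"
      using less_inv0_iff[OF B norm_ge_zero, of "A \<epsilon>" "X t0"] class_Kinf_props(5)[OF A, of \<epsilon>] by simp
    ultimately show "norm (X t) < \<epsilon>"
      using Z_nonincreasing[of t0 t X] ZB[of t0 "X t0"] norm_bound[of t \<epsilon> "X t"] by force
  qed
next
  fix c \<eta> :: real assume "0 < c" "0 < \<eta>"
  then have "0 < A \<eta>"
    using class_Kinf_props(6)[OF A] by simp
  from Z_decay[OF this] obtain m where m: "m > 0"
    "\<forall>a b X. 0 \<le> a \<longrightarrow> a \<le> b \<longrightarrow> ode_solution f {a..b} X \<longrightarrow> A \<eta> \<le> Z b (X b)
      \<longrightarrow> Z b (X b) \<le> Z a (X a) - m * (b - a)"
    by (elim exE conjE)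
  \<comment> \<open>\<open>Z\<close> starts at \<open>B c\<close> at most and would lose
    \<open>m\<close> per unit of time while above \<open>A \<eta>\<close>, so after time
    \<open>T\<close> nothing positive would be left.\<close>
  define T where "T = B c / m"
  have "0 < T"
    using m class_Kinf_props(6)[OF B \<open>0 < c\<close>] by (simp add: T_def)
  moreover have "norm (X t) < \<eta>"
    if "0 \<le> t0" "t0 + T \<le> t" and sol: "ode_solution f {t0..t} X" and "norm (X t0) < c" for t0 t X
  proof (rule norm_bound)
    show "Z t (X t) < A \<eta>"
    proof (rule ccontr)
      assume "\<not> Z t (X t) < A \<eta>"
      then have "A \<eta> \<le> Z t0 (X t0) - m * (t - t0)"
        using m(2)[rule_format, of t0 t X] that \<open>0 < T\<close> by force
      moreover have "Z t0 (X t0) \<le> B c"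
        using ZB[OF that(1), of "X t0"] class_Kinf_props(3)[OF B norm_ge_zero, of "X t0" c] that by linarith
      moreover have "B c \<le> m * (t - t0)"
        using mult_left_mono[of T "t - t0" m] m(1) that by (simp add: T_def)
      ultimately show False
        using \<open>0 < A \<eta>\<close> by linarith
    qed
  qed (use that \<open>0 < T\<close> \<open>0 < \<eta>\<close> in auto)
  ultimately show "\<exists>T>0. \<forall>t0\<ge>0. \<forall>t\<ge>t0 + T. \<forall>X.
      ode_solution f {t0..t} X \<and> norm (X t0) < c \<longrightarrow> norm (X t) < \<eta>"
    by blast
next
  fix t0 x0 assume "0 \<le> (t0::real)"
  then obtain X where "X t0 = x0" "ode_solution f {t0..} X"
    by (rule global_solution_exists)
  then show "\<exists>X. X t0 = x0 \<and> ode_solution f {t0..} X"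
    by blast
qed (rule f0)

end

section \<open>A maximum of rescaled functions\<close>

lemma C1_time_state_continuous:
  assumes "C1_time_state V Vt Vx" shows "continuous_on ({0..} \<times> UNIV) (\<lambda>(t, x). V t x)"
proof -
  have "continuous (at p within {0..} \<times> UNIV) (\<lambda>(t, x). V t x)" if "p \<in> {0..} \<times> UNIV" for p
    using assms that unfolding C1_time_state_def
    by (cases p) (auto intro: has_derivative_continuous)
  then show ?thesis
    by (simp add: continuous_on_eq_continuous_within)
qed

lemma C1_time_state_derivative:
  assumes V: "C1_time_state V Vt Vx" and "0 \<le> t"
    and X: "(X has_vector_derivative d) (at_right t)"
  shows "((\<lambda>s. V s (X s)) has_real_derivative Vt t (X t) + Vx t (X t) \<bullet> d) (at_right t)"
proof -
  have 1: "((\<lambda>(s, y). V s y) has_derivative (\<lambda>(s, y). s * Vt t (X t) + Vx t (X t) \<bullet> y))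
     (at (t, X t) within {0..} \<times> UNIV)"
    using V \<open>0 \<le> t\<close> by (simp add: C1_time_state_def)
  have 2: "((\<lambda>s. (s, X s)) has_derivative (\<lambda>h. (h, h *\<^sub>R d))) (at_right t)"
    using X unfolding has_vector_derivative_def
    by (intro has_derivative_Pair has_derivative_ident)
  have "((\<lambda>s. (\<lambda>(s, y). V s y) (s, X s)) has_derivative
      (\<lambda>h. (\<lambda>(s, y). s * Vt t (X t) + Vx t (X t) \<bullet> y) (h, h *\<^sub>R d))) (at_right t)"
    by (rule has_derivative_in_compose[OF 2], rule has_derivative_subset[OF 1])
      (use \<open>0 \<le> t\<close> in auto)
  moreover have "(\<lambda>h. (\<lambda>(s, y). s * Vt t (X t) + Vx t (X t) \<bullet> y) (h, h *\<^sub>R d))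
      = (*) (Vt t (X t) + Vx t (X t) \<bullet> d)"
    by (auto simp: algebra_simps)
  ultimately show ?thesis
    by (simp add: has_field_derivative_def)
qed

text \<open>Since \<open>\<Gamma>\<close> grows at least as fast as \<open>inv0 \<sigma>\<close>, a decrease of \<open>w\<close> is not compressed by \<open>\<Gamma> \<circ> \<sigma>\<close>,
  although neither function need be differentiable.\<close>

lemma component_right_decrease:
  assumes \<Gamma>: "\<Gamma> \<in> class_Kinf" and \<sigma>: "\<sigma> \<in> class_Kinf"
    and expand: "\<And>u v. 0 \<le> v \<Longrightarrow> v \<le> u \<Longrightarrow> inv0 \<sigma> u - inv0 \<sigma> v \<le> \<Gamma> u - \<Gamma> v"
    and nonneg: "\<And>s. t \<le> s \<Longrightarrow> 0 \<le> w s"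
    and w: "(w has_real_derivative D) (at_right t)"
    and le: "\<sigma> (w t) \<le> u" and D: "\<sigma> (w t) = u \<Longrightarrow> D < - m"
    and m: "0 \<le> m"
  shows "\<forall>\<^sub>F s in at_right t. \<Gamma> (\<sigma> (w s)) \<le> \<Gamma> u - m * (s - t)"
proof (cases "\<sigma> (w t) = u")
  case True
  have "((\<lambda>s. (w s - w t) / (s - t)) \<longlongrightarrow> D) (at_right t)"
    using w by (simp add: has_field_derivative_iff)
  then have "\<forall>\<^sub>F s in at_right t. (w s - w t) / (s - t) < - m"
    by (rule order_tendstoD) (rule D[OF True])
  with eventually_at_right_less[of t] show ?thesis
  proof eventually_elim
    case (elim s)
    then have dec: "w s - w t \<le> - m * (s - t)"
      by (simp add: pos_divide_less_eq)
    moreover have "0 \<le> m * (s - t)"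
      using m elim(1) by simp
    ultimately have "w s \<le> w t"
      by simp
    then have "\<sigma> (w s) \<le> \<sigma> (w t)"
      using class_Kinf_props(3)[OF \<sigma>] nonneg elim(1) by simp
    then have "w t - w s \<le> \<Gamma> (\<sigma> (w t)) - \<Gamma> (\<sigma> (w s))"
      using expand[of "\<sigma> (w s)" "\<sigma> (w t)"] nonneg elim(1) inv0_f[OF \<sigma>] class_Kinf_props(5)[OF \<sigma>]
      by simp
    with dec True show ?case by simp
  qed
next
  \<comment> \<open>An inactive component has a gap to \<open>\<Gamma> u\<close>, which continuity
    preserves for a short time; no sign of \<open>D\<close> is needed.\<close>
  case False
  have "(w \<longlongrightarrow> w t) (at_right t)"
    using has_field_derivative_imp_has_derivative[OF w, THEN has_derivative_continuous]
    by (simp add: continuous_within)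
  moreover have "continuous_on {0..} (\<lambda>s. \<Gamma> (\<sigma> s))"
    using class_Kinf_props(1)[OF class_Kinf_comp[OF \<Gamma> \<sigma>]] .
  ultimately have "((\<lambda>s. \<Gamma> (\<sigma> (w s))) \<longlongrightarrow> \<Gamma> (\<sigma> (w t))) (at_right t)"
    using nonneg eventually_at_right_less[of t]
    by (intro continuous_on_tendsto_compose[of "{0..}" "\<lambda>s. \<Gamma> (\<sigma> s)" w]) (auto elim!: eventually_mono)
  then have "((\<lambda>s. \<Gamma> (\<sigma> (w s)) + m * (s - t)) \<longlongrightarrow> \<Gamma> (\<sigma> (w t)) + m * (t - t)) (at_right t)"
    by (intro tendsto_intros)
  moreover have "\<Gamma> (\<sigma> (w t)) < \<Gamma> u"
    using class_Kinf_props(2)[OF \<Gamma>] class_Kinf_props(5)[OF \<sigma> nonneg[of t]] le False by simp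
  ultimately have "\<forall>\<^sub>F s in at_right t. \<Gamma> (\<sigma> (w s)) + m * (s - t) < \<Gamma> u"
    by (intro order_tendstoD) auto
  then show ?thesis
    by eventually_elim simp
qed

text \<open>The derivative \<open>D\<close> must exist at every point but is bounded only where the
  component attains \<open>U\<close>, because elsewhere continuity suffices. The rate
  \<open>\<omega>\<close> depends on the value of \<open>W\<close> alone, hence is uniform in time,
  and \<open>X\<close> is any curve tangent to the field at the single time
  \<open>t\<close>.\<close>

definition dissipated ::
    "(real \<Rightarrow> 'a \<Rightarrow> 'a::real_normed_vector) \<Rightarrow> (real \<Rightarrow> 'a \<Rightarrow> real) \<Rightarrow> (real \<Rightarrow> real) \<Rightarrow> (real \<Rightarrow> 'a \<Rightarrow> real) \<Rightarrow> bool" where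
  "dissipated f U \<sigma> W \<longleftrightarrow>
     (\<forall>t\<ge>0. \<forall>x. 0 \<le> W t x \<and> \<sigma> (W t x) \<le> U t x) \<and>
     (\<exists>\<omega>\<in>class_K. \<forall>t\<ge>0. \<forall>X. (X has_vector_derivative f t (X t)) (at_right t) \<longrightarrow>
        (\<exists>D. ((\<lambda>s. W s (X s)) has_real_derivative D) (at_right t) \<and>
          (\<sigma> (W t (X t)) = U t (X t) \<longrightarrow> D \<le> - \<omega> (W t (X t)))))"

lemma zero_UGAS_max:
  fixes f :: "real \<Rightarrow> 'a::euclidean_space \<Rightarrow> 'a"
  assumes f0: "\<And>t. 0 \<le> t \<Longrightarrow> f t 0 = 0"
    and f: "continuous_on ({0..} \<times> UNIV) (\<lambda>(t, x). f t x)"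
    and U: "continuous_on ({0..} \<times> UNIV) (\<lambda>(t, x). U t x)"
    and A: "A \<in> class_Kinf" and B: "B \<in> class_Kinf"
    and AU: "\<And>t x. 0 \<le> t \<Longrightarrow> A (norm x) \<le> U t x" and UB: "\<And>t x. 0 \<le> t \<Longrightarrow> U t x \<le> B (norm x)"
    and C: "finite C" and Kinf: "\<And>\<sigma> W. (\<sigma>, W) \<in> C \<Longrightarrow> \<sigma> \<in> class_Kinf"
    and diss: "\<And>\<sigma> W. (\<sigma>, W) \<in> C \<Longrightarrow> dissipated f U \<sigma> W"
    and max: "\<And>t x. 0 \<le> t \<Longrightarrow> \<exists>(\<sigma>, W)\<in>C. \<sigma> (W t x) = U t x"
  shows "zero_UGAS f"
proof -
  have ne: "C \<noteq> {}"
    using max[of 0] by auto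
  \<comment> \<open>All summands are increasing, so an increment of \<Gamma> dominates the increment
    of each inverse separately. One function thus serves all components.\<close>
  define \<Gamma> where "\<Gamma> u = (\<Sum>(\<sigma>, W)\<in>C. inv0 \<sigma> u)" for u
  have "(\<lambda>u. \<Sum>(\<sigma>, W)\<in>C'. inv0 \<sigma> u) \<in> class_Kinf" if "finite C'" "C' \<noteq> {}" "C' \<subseteq> C" for C'
    using that
  proof (induction C' rule: finite_ne_induct)
    case (singleton c)
    then show ?case
      using inv0_Kinf Kinf by (cases c) simp
  next
    case (insert c C')
    obtain \<sigma> W where c: "c = (\<sigma>, W)" by (cases c)
    have "inv0 \<sigma> \<in> class_Kinf"
      using insert.prems c by (intro inv0_Kinf Kinf) auto
    then have "inv0 \<sigma> \<in> class_SN" "inv0 \<sigma> 0 = 0"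
      by (auto simp: class_Kinf_def class_K_def)
    then have "(\<lambda>u. inv0 \<sigma> u + (\<Sum>(\<sigma>, W)\<in>C'. inv0 \<sigma> u)) \<in> class_Kinf"
      using insert by (intro class_Kinf_add) auto
    with insert c show ?case by simp
  qed
  from this[OF C ne] have \<Gamma>: "\<Gamma> \<in> class_Kinf"
    by (simp add: \<Gamma>_def[abs_def])
  have expand: "inv0 \<sigma> u - inv0 \<sigma> v \<le> \<Gamma> u - \<Gamma> v"
    if c: "(\<sigma>, W) \<in> C" and "0 \<le> v" "v \<le> u" for \<sigma> W u v
  proof -
    let ?d = "\<lambda>(\<sigma>, W). inv0 \<sigma> u - inv0 \<sigma> v"
    have "?d (\<sigma>, W) \<le> sum ?d C"
      using class_Kinf_props(3)[OF inv0_Kinf[OF Kinf] that(2,3)] by (intro member_le_sum[OF c _ C]) auto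
    also have "sum ?d C = \<Gamma> u - \<Gamma> v"
      unfolding \<Gamma>_def sum_subtractf[symmetric] by (rule sum.cong) auto
    finally show ?thesis by simp
  qed
  have U_nonneg: "0 \<le> U t x" if "0 \<le> t" for t x
    using order_trans[OF class_Kinf_props(5)[OF A norm_ge_zero] AU[OF that]] .
  interpret decreasing_function f "\<lambda>t x. \<Gamma> (U t x)" "\<lambda>s. \<Gamma> (A s)" "\<lambda>s. \<Gamma> (B s)"
  proof
    show "continuous_on ({0..} \<times> UNIV) (\<lambda>(t, x). \<Gamma> (U t x))"
      using continuous_on_compose2[OF class_Kinf_props(1)[OF \<Gamma>] U] U_nonneg
      by (simp add: case_prod_beta image_subset_iff)
    show "\<Gamma> (A (norm x)) \<le> \<Gamma> (U t x)" "\<Gamma> (U t x) \<le> \<Gamma> (B (norm x))" if "0 \<le> t" for t x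
      using AU[OF that, of x] UB[OF that, of x] U_nonneg[OF that, of x] class_Kinf_props(5)[OF A norm_ge_zero]
      by (auto intro: class_Kinf_props(3)[OF \<Gamma>])
    show "(\<lambda>s. \<Gamma> (A s)) \<in> class_Kinf" "(\<lambda>s. \<Gamma> (B s)) \<in> class_Kinf"
      by (rule class_Kinf_comp[OF \<Gamma> A], rule class_Kinf_comp[OF \<Gamma> B])
    fix l :: real assume l: "0 < l"
    \<comment> \<open>The level \<open>l\<close> of the composed function, read as a level of
      \<open>U\<close>.\<close>
    define u where "u = inv0 \<Gamma> l"
    have u: "0 < u"
      using class_Kinf_props(6)[OF inv0_Kinf[OF \<Gamma>] l] by (simp add: u_def)
    let ?P = "\<lambda>m (\<sigma>, W). \<forall>t\<ge>0. \<forall>X. (X has_vector_derivative f t (X t)) (at_right t) \<longrightarrow>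
        (\<exists>D. ((\<lambda>s. W s (X s)) has_real_derivative D) (at_right t) \<and>
          (\<sigma> (W t (X t)) = U t (X t) \<longrightarrow> u \<le> U t (X t) \<longrightarrow> D < - m))"
    have "\<exists>m>0. ?P m c" if "c \<in> C" for c
    proof -
      obtain \<sigma> W where c: "c = (\<sigma>, W)" by (cases c)
      note \<sigma> = Kinf[OF that[unfolded c]] and d = diss[OF that[unfolded c], unfolded dissipated_def]
      obtain \<omega> where \<omega>: "\<omega> \<in> class_K" "\<forall>t\<ge>0. \<forall>X. (X has_vector_derivative f t (X t)) (at_right t) \<longrightarrow>
        (\<exists>D. ((\<lambda>s. W s (X s)) has_real_derivative D) (at_right t) \<and>
          (\<sigma> (W t (X t)) = U t (X t) \<longrightarrow> D \<le> - \<omega> (W t (X t))))"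
        using d by blast
      \<comment> \<open>Half of the rate guaranteed at level \<open>u\<close>; halving provides the
        strict inequality that \<open>component_right_decrease\<close> demands.\<close>
      let ?m = "\<omega> (inv0 \<sigma> u) / 2"
      have m: "0 < ?m"
        using class_K_pos[OF \<omega>(1) class_Kinf_props(6)[OF inv0_Kinf[OF \<sigma>] u]] by simp
      have "- \<omega> (W t x) < - ?m" if "0 \<le> t" "\<sigma> (W t x) = U t x" "u \<le> U t x" for t x
      proof -
        have "inv0 \<sigma> u \<le> W t x"
          using inv0_le_iff[OF \<sigma>, of "W t x" u] that d u by simp
        then have "\<omega> (inv0 \<sigma> u) \<le> \<omega> (W t x)"
          using inv0_nonneg[OF \<sigma>] u by (intro class_K_mono[OF \<omega>(1)]) auto
        with m show ?thesis by simp
      qed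
      then have neg: "0 \<le> t \<Longrightarrow> \<sigma> (W t x) = U t x \<Longrightarrow> u \<le> U t x \<Longrightarrow> D \<le> - \<omega> (W t x) \<Longrightarrow> D < - ?m"
        for t x D
        using le_less_trans by blast
      have "?P ?m c"
        unfolding c split_conv
      proof (intro allI impI)
        fix t X assume "0 \<le> t" "(X has_vector_derivative f t (X t)) (at_right t)"
        then obtain D where "((\<lambda>s. W s (X s)) has_real_derivative D) (at_right t)"
          "\<sigma> (W t (X t)) = U t (X t) \<longrightarrow> D \<le> - \<omega> (W t (X t))"
          using \<omega>(2) by blast
        then show "\<exists>D. ((\<lambda>s. W s (X s)) has_real_derivative D) (at_right t) \<and>
          (\<sigma> (W t (X t)) = U t (X t) \<longrightarrow> u \<le> U t (X t) \<longrightarrow> D < - ?m)"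
          using neg[OF \<open>0 \<le> t\<close>] by blast
      qed
      with m show ?thesis by blast
    qed
    then have "\<forall>c\<in>C. \<exists>m. m > 0 \<and> ?P m c"
      by simp
    from bchoice[OF this] obtain M where "\<forall>c\<in>C. M c > 0 \<and> ?P (M c) c" ..
    then have M: "\<And>c. c \<in> C \<Longrightarrow> 0 < M c" "\<And>c. c \<in> C \<Longrightarrow> ?P (M c) c"
      by simp_all
    define m where "m = Min (M ` C)"
    have m: "0 < m" "\<And>c. c \<in> C \<Longrightarrow> m \<le> M c"
      using M(1) C ne by (auto simp: m_def)
    have "\<forall>\<^sub>F s in at_right t. \<Gamma> (U s (X s)) \<le> \<Gamma> (U t (X t)) - m * (s - t)"
      if t: "0 \<le> t" and X: "(X has_vector_derivative f t (X t)) (at_right t)" and "l \<le> \<Gamma> (U t (X t))"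
      for t X
    proof -
      have ge: "u \<le> U t (X t)"
        using inv0_le_iff[OF \<Gamma> U_nonneg[OF t], of l] that(3) l by (simp add: u_def)
      have "\<forall>\<^sub>F s in at_right t. \<Gamma> (\<sigma> (W s (X s))) \<le> \<Gamma> (U t (X t)) - m * (s - t)"
        if c: "(\<sigma>, W) \<in> C" for \<sigma> W
      proof -
        note d = diss[OF c, unfolded dissipated_def]
        obtain D where D: "((\<lambda>s. W s (X s)) has_real_derivative D) (at_right t)"
          "\<sigma> (W t (X t)) = U t (X t) \<Longrightarrow> D < - M (\<sigma>, W)"
          using M(2)[OF c] t X ge by auto
        show ?thesis
        proof (rule component_right_decrease[OF \<Gamma> Kinf[OF c] expand[OF c] _ D(1)])
          show "D < - m" if "\<sigma> (W t (X t)) = U t (X t)"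
            using D(2)[OF that] m(2)[OF c] by simp
        qed (use d t m in auto)
      qed
      then have "\<forall>\<^sub>F s in at_right t. \<forall>c\<in>C. case c of (\<sigma>, W) \<Rightarrow>
          \<Gamma> (\<sigma> (W s (X s))) \<le> \<Gamma> (U t (X t)) - m * (s - t)"
        using C by (intro eventually_ball_finite) auto
      with eventually_at_right_less[of t] show ?thesis
      proof eventually_elim
        case (elim s)
        then obtain \<sigma> W where "(\<sigma>, W) \<in> C" "\<sigma> (W s (X s)) = U s (X s)"
          using max[of s "X s"] t by force
        with elim(2) show ?case by force
      qed
    qed
    with m(1) show "\<exists>m>0. \<forall>t\<ge>0. \<forall>X. (X has_vector_derivative f t (X t)) (at_right t) \<longrightarrow>
        l \<le> \<Gamma> (U t (X t)) \<longrightarrow> (\<forall>\<^sub>F s in at_right t. \<Gamma> (U s (X s)) \<le> \<Gamma> (U t (X t)) - m * (s - t))"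
      by blast
  qed (fact f0 f)+
  show ?thesis
    by (rule zero_UGAS)
qed

section \<open>The error coordinates\<close>

lemma bounded_bilinear_matrix_vector:
  "bounded_bilinear ((*v) :: real^'n^'q \<Rightarrow> real^'n \<Rightarrow> real^'q)"
proof -
  have "bilinear ((*v) :: real^'n^'q \<Rightarrow> real^'n \<Rightarrow> real^'q)"
    unfolding bilinear_def
    by (auto intro!: linearI simp: matrix_vector_right_distrib matrix_vector_mult_add_rdistrib
        matrix_vector_mult_scaleR scaleR_matrix_vector_assoc)
  then show ?thesis
    by (simp add: bilinear_conv_bounded_bilinear)
qed

text \<open>\<open>beta_a\<close> depends on its first two vector arguments only through their sum,
  so both partial derivatives come from the same derivative of \<sigma>.\<close>

lemma beta_a_derivatives:
  fixes \<sigma> :: "real^'n \<Rightarrow> real^'n^'q"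
  assumes "\<sigma> differentiable (at (eh + xr))"
  defines "\<sigma>' \<equiv> frechet_derivative \<sigma> (at (eh + xr))"
  shows "frechet_derivative (\<lambda>z. beta_a \<sigma> xr z e) (at eh) = (\<lambda>h. \<sigma>' h *v e)"
    and "frechet_derivative (\<lambda>z. beta_a \<sigma> z eh e) (at xr) = (\<lambda>h. \<sigma>' h *v e)"
proof -
  have \<sigma>: "(\<sigma> has_derivative \<sigma>') (at (eh + xr))"
    using iffD1[OF frechet_derivative_works assms(1)] by (simp add: \<sigma>'_def)
  note mv = bounded_bilinear.FDERIV[OF bounded_bilinear_matrix_vector _ has_derivative_const[of e]]
  have "((\<lambda>z. \<sigma> (z + xr)) has_derivative (\<lambda>h. \<sigma>' h)) (at eh)"
    by (rule has_derivative_compose[of "\<lambda>z. z + xr" "\<lambda>h. h", OF _ \<sigma>])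
      (auto intro!: derivative_eq_intros)
  from mv[OF this] show "frechet_derivative (\<lambda>z. beta_a \<sigma> xr z e) (at eh) = (\<lambda>h. \<sigma>' h *v e)"
    by (intro frechet_derivative_at[symmetric]) (simp add: beta_a_def)
  have "((\<lambda>z. \<sigma> (eh + z)) has_derivative (\<lambda>h. \<sigma>' h)) (at xr)"
    by (rule has_derivative_compose[of "\<lambda>z. eh + z" "\<lambda>h. h", OF _ \<sigma>])
      (auto intro!: derivative_eq_intros)
  from mv[OF this] show "frechet_derivative (\<lambda>z. beta_a \<sigma> z eh e) (at xr) = (\<lambda>h. \<sigma>' h *v e)"
    by (intro frechet_derivative_at[symmetric]) (simp add: beta_a_def)
qed

lemma has_vector_derivative_Pair_iff:
  "((\<lambda>t. (f t, g t)) has_vector_derivative (f', g')) (at x within S) \<longleftrightarrow>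
    (f has_vector_derivative f') (at x within S) \<and> (g has_vector_derivative g') (at x within S)"
proof
  assume "((\<lambda>t. (f t, g t)) has_vector_derivative (f', g')) (at x within S)"
  from bounded_linear.has_vector_derivative[OF bounded_linear_fst this]
    bounded_linear.has_vector_derivative[OF bounded_linear_snd this]
  show "(f has_vector_derivative f') (at x within S) \<and> (g has_vector_derivative g') (at x within S)"
    by simp
qed (auto intro: has_vector_derivative_Pair)

text \<open>The coordinate change is invertible: \<open>x\<close> and \<open>eh\<close> are
  recovered first, and only then is \<open>\<theta>h\<close> obtained by subtracting the correction,
  whose derivative needs those of \<open>x\<close> and \<open>eh\<close>. Hence an equivalence, and
  with it a transfer of solutions in both directions.\<close>

lemma error_coords_has_vector_derivative_iff:
  fixes \<sigma> :: "real^'n \<Rightarrow> real^'n^'q" and x eh x_r :: "real \<Rightarrow> real^'n" and \<theta>h :: "real \<Rightarrow> real^'q"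
  assumes \<sigma>: "\<sigma> differentiable (at (eh t + x_r t))"
    and x_r: "(x_r has_vector_derivative dxr) (at t within I)"
  defines "\<sigma>' \<equiv> frechet_derivative \<sigma> (at (eh t + x_r t))"
  shows "((\<lambda>t. (x t, eh t, \<theta>h t)) has_vector_derivative (c1, c2, c3)) (at t within I) \<longleftrightarrow>
    ((\<lambda>t. error_coords \<sigma> x_r \<theta> t (x t, eh t, \<theta>h t)) has_vector_derivative
      (c1 - dxr, c3 + (\<sigma>' (c2 + dxr) *v (x t - x_r t) + \<sigma> (eh t + x_r t) *v (c1 - dxr)), c1 - dxr - c2))
      (at t within I)"
    (is "?L \<longleftrightarrow> ?R")
proof -
  define B where "B t = beta_a \<sigma> (x_r t) (eh t) (x t - x_r t)" for t
  define b where "b = \<sigma>' (c2 + dxr) *v (x t - x_r t) + \<sigma> (eh t + x_r t) *v (c1 - dxr)"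
  have B: "(B has_vector_derivative b) (at t within I)"
    if "(x has_vector_derivative c1) (at t within I)" "(eh has_vector_derivative c2) (at t within I)"
  proof -
    have "(\<sigma> has_derivative \<sigma>') (at (eh t + x_r t))"
      using iffD1[OF frechet_derivative_works \<sigma>] by (simp add: \<sigma>'_def)
    then have "(\<sigma> has_derivative \<sigma>') (at ((\<lambda>t. eh t + x_r t) t) within (\<lambda>t. eh t + x_r t) ` I)"
      using has_derivative_at_withinI by blast
    from vector_derivative_diff_chain_within[OF has_vector_derivative_add[OF that(2) x_r] this]
    have "((\<lambda>t. \<sigma> (eh t + x_r t)) has_vector_derivative \<sigma>' (c2 + dxr)) (at t within I)"
      by (simp add: o_def)
    from bounded_bilinear.has_vector_derivative[OF bounded_bilinear_matrix_vector this
        has_vector_derivative_diff[OF that(1) x_r]]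
    show ?thesis
      by (simp add: B_def[abs_def] b_def beta_a_def add.commute)
  qed
  have "?L \<longleftrightarrow> (x has_vector_derivative c1) (at t within I) \<and> (eh has_vector_derivative c2) (at t within I)
      \<and> (\<theta>h has_vector_derivative c3) (at t within I)"
    by (simp add: has_vector_derivative_Pair_iff)
  also have "\<dots> \<longleftrightarrow> ((\<lambda>t. x t - x_r t) has_vector_derivative c1 - dxr) (at t within I)
      \<and> ((\<lambda>t. \<theta>h t - \<theta> + B t) has_vector_derivative c3 + b) (at t within I)
      \<and> ((\<lambda>t. x t - x_r t - eh t) has_vector_derivative c1 - dxr - c2) (at t within I)"
    (is "?x \<and> ?eh \<and> ?th \<longleftrightarrow> ?e \<and> ?tt \<and> ?ee")
  proof (intro iffI conjI; elim conjE)
    assume "?x" "?eh" "?th"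
    show ?e by (rule has_vector_derivative_diff[OF \<open>?x\<close> x_r])
    then show ?ee by (rule has_vector_derivative_diff[OF _ \<open>?eh\<close>])
    have "((\<lambda>t. \<theta>h t - \<theta> + B t) has_vector_derivative c3 - 0 + b) (at t within I)"
      using B[OF \<open>?x\<close> \<open>?eh\<close>] \<open>?th\<close>
      by (intro has_vector_derivative_add has_vector_derivative_diff has_vector_derivative_const)
    then show ?tt by simp
  next
    assume "?e" "?tt" "?ee"
    from has_vector_derivative_add[OF \<open>?e\<close> x_r] show x: ?x by simp
    from has_vector_derivative_diff[OF \<open>?e\<close> \<open>?ee\<close>] show eh: ?eh by simp
    from has_vector_derivative_add[OF has_vector_derivative_diff[OF \<open>?tt\<close> B[OF x eh]]
        has_vector_derivative_const[of \<theta>]]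
    show ?th by simp
  qed
  also have "\<dots> \<longleftrightarrow> ?R"
    by (simp add: has_vector_derivative_Pair_iff error_coords_def Let_def B_def b_def)
  finally show ?thesis .
qed

text \<open>The two derivative corrections in the estimator cancel the contribution of the varying
  matrix \<sigma> to the derivative of \<open>beta_a\<close>. What remains is \<sigma> at
  \<open>eh + x_r\<close>, applied to the model mismatch, plus the dead-zone term; the terms with
  \<sigma> at \<open>x_r\<close> cancel between \<open>H_field\<close> and
  \<open>Delta_f\<close>.\<close>

lemma closed_loop_iff_extended_error_system:
  fixes \<sigma> :: "real^'n \<Rightarrow> real^'n^'q"
  assumes \<sigma>: "\<And>x. \<sigma> differentiable (at x)" and \<theta>: "norm \<theta> \<le> l_s"
    and x_r: "\<And>t. t \<in> I \<Longrightarrow> (x_r has_vector_derivative dx_r t) (at t within I)"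
  shows "ode_solution (closed_loop l_\<theta> l_s \<epsilon>_s k_dz f_1 \<phi> g_1 \<psi> \<sigma> K x_r dx_r \<theta>) I X \<longleftrightarrow>
    ode_solution (extended_error_system l_\<theta> l_s \<epsilon>_s k_dz f_1 \<phi> g_1 \<psi> \<sigma> K x_r dx_r \<theta>) I
      (\<lambda>t. error_coords \<sigma> x_r \<theta> t (X t))"
  unfolding ode_solution_def
proof (rule ball_cong[OF refl])
  fix t assume t: "t \<in> I"
  define x eh \<theta>h where "x = (\<lambda>t. fst (X t))" and "eh = (\<lambda>t. fst (snd (X t)))"
    and "\<theta>h = (\<lambda>t. snd (snd (X t)))"
  have X: "X = (\<lambda>t. (x t, eh t, \<theta>h t))"
    by (simp add: x_def eh_def \<theta>h_def)
  define \<sigma>' where "\<sigma>' = frechet_derivative \<sigma> (at (eh t + x_r t))"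
  have "linear \<sigma>'"
    using \<sigma> by (simp add: \<sigma>'_def linear_frechet_derivative)
  then have add: "\<sigma>' (u + v) = \<sigma>' u + \<sigma>' v" for u v
    by (rule linear_add)
  obtain c1 c2 c3 where c:
    "closed_loop l_\<theta> l_s \<epsilon>_s k_dz f_1 \<phi> g_1 \<psi> \<sigma> K x_r dx_r \<theta> t (X t) = (c1, c2, c3)"
    by (cases "closed_loop l_\<theta> l_s \<epsilon>_s k_dz f_1 \<phi> g_1 \<psi> \<sigma> K x_r dx_r \<theta> t (X t)") auto
  define e \<beta> \<theta>s where "e = x t - x_r t" and "\<beta> = beta_a \<sigma> (x_r t) (eh t) e"
    and "\<theta>s = satv l_s \<epsilon>_s (\<theta>h t + \<beta>)"
  define w p d where "w = f_1 (x t) + \<phi> \<theta>s (x t) + g_1 (x t) *v \<psi> (x_r t) (dx_r t) \<theta>s e - dx_r t"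
    and "p = \<phi> \<theta>s (x t) - \<phi> \<theta> (x t)" and "d = k_dz *\<^sub>R dzv l_\<theta> (\<theta>h t + \<beta>)"
  have c123: "c1 - dx_r t = w - p" "c2 = K (e - eh t) + w"
    "c3 = - (\<sigma> (eh t + x_r t) *v w) - \<sigma>' (c2 + dx_r t) *v e - d"
    using c unfolding X closed_loop_def
    by (auto simp: Let_def beta_a_derivatives[OF \<sigma>] \<sigma>'_def[symmetric] add e_def[symmetric]
        \<beta>_def[symmetric] \<theta>s_def[symmetric] w_def p_def d_def matrix_vector_mult_add_rdistrib)
  have coords: "error_coords \<sigma> x_r \<theta> t (X t) = (e, \<theta>h t - \<theta> + \<beta>, e - eh t)"
    by (simp add: X error_coords_def Let_def e_def \<beta>_def)
  have shift: "\<theta>h t - \<theta> + \<beta> + \<theta> = \<theta>h t + \<beta>" "\<theta> + (\<theta>h t - \<theta> + \<beta>) = \<theta>h t + \<beta>"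
    "e + x_r t = x t" "x t - (e - eh t) = eh t + x_r t"
    by (simp_all add: e_def)
  \<comment> \<open>The true parameter lies in the linear range of the saturation, so the saturated
    difference is the actual mismatch.\<close>
  have phi: "phi_s l_s \<epsilon>_s \<phi> \<theta> (\<theta>h t - \<theta> + \<beta>) (x t) = p"
    by (simp add: phi_s_def shift satv_ident[OF \<theta>] p_def \<theta>s_def[symmetric])
  have "extended_error_system l_\<theta> l_s \<epsilon>_s k_dz f_1 \<phi> g_1 \<psi> \<sigma> K x_r dx_r \<theta> t (error_coords \<sigma> x_r \<theta> t (X t))
    = (w - p, - d - \<sigma> (eh t + x_r t) *v p, - K (e - eh t) - p)"
    unfolding coords extended_error_system_def
    by (simp add: F_field_def H_field_def Delta_f_def shift phi \<theta>s_def[symmetric] w_def d_def)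
  also have "\<dots> = (c1 - dx_r t,
      c3 + (\<sigma>' (c2 + dx_r t) *v (x t - x_r t) + \<sigma> (eh t + x_r t) *v (c1 - dx_r t)),
      c1 - dx_r t - c2)"
    unfolding c123(1) e_def[symmetric]
    by (simp add: c123(2,3) matrix_vector_mult_diff_distrib)
  finally have "extended_error_system l_\<theta> l_s \<epsilon>_s k_dz f_1 \<phi> g_1 \<psi> \<sigma> K x_r dx_r \<theta> t (error_coords \<sigma> x_r \<theta> t (X t))
    = (c1 - dx_r t, c3 + (\<sigma>' (c2 + dx_r t) *v (x t - x_r t) + \<sigma> (eh t + x_r t) *v (c1 - dx_r t)),
       c1 - dx_r t - c2)" .
  then show "(X has_vector_derivative closed_loop l_\<theta> l_s \<epsilon>_s k_dz f_1 \<phi> g_1 \<psi> \<sigma> K x_r dx_r \<theta> t (X t))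
      (at t within I) \<longleftrightarrow>
    ((\<lambda>t. error_coords \<sigma> x_r \<theta> t (X t)) has_vector_derivative
      extended_error_system l_\<theta> l_s \<epsilon>_s k_dz f_1 \<phi> g_1 \<psi> \<sigma> K x_r dx_r \<theta> t (error_coords \<sigma> x_r \<theta> t (X t)))
      (at t within I)"
    using error_coords_has_vector_derivative_iff[OF \<sigma> x_r[OF t], of x eh \<theta>h c1 c2 c3 \<theta>]
    unfolding c unfolding X \<sigma>'_def by simp
qed

section \<open>The adaptive closed loop\<close>

text \<open>Testing the sign condition along the ray through \<open>- K 0\<close> and letting the
  point tend to 0 gives that the squared norm of \<open>K 0\<close> is at most 0. Needed because
  \<open>K_1\<close> and \<open>K_2\<close> are known only through such inequalities, yet the origin
  must be an equilibrium.\<close>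

lemma zero_of_inner_nonneg:
  fixes K :: "'a::real_inner \<Rightarrow> 'a"
  assumes "continuous_on UNIV K" and nonneg: "\<And>x. 0 \<le> x \<bullet> K x"
  shows "K 0 = 0"
proof -
  define v where "v = - K 0"
  have "((\<lambda>s. K (s *\<^sub>R v)) \<longlongrightarrow> K (0 *\<^sub>R v)) (at_right 0)"
    by (intro continuous_on_tendsto_compose[OF assms(1)] tendsto_intros) auto
  then have "((\<lambda>s. v \<bullet> K (s *\<^sub>R v)) \<longlongrightarrow> v \<bullet> K 0) (at_right 0)"
    by (intro tendsto_intros) simp
  moreover have "\<forall>\<^sub>F s in at_right 0. 0 \<le> v \<bullet> K (s *\<^sub>R v)"
    using eventually_at_right_less[of "0::real"]
  proof eventually_elim
    case (elim s)
    have "0 \<le> s * (v \<bullet> K (s *\<^sub>R v))"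
      using nonneg[of "s *\<^sub>R v"] by simp
    with elim show ?case
      by (simp add: zero_le_mult_iff)
  qed
  ultimately have "0 \<le> v \<bullet> K 0"
    by (intro tendsto_lowerbound[of _ "v \<bullet> K 0" "at_right 0"]) auto
  then have "K 0 \<bullet> K 0 \<le> 0"
    by (simp add: v_def)
  then show ?thesis
    using inner_ge_zero[of "K 0"] inner_eq_zero_iff[of "K 0"] by linarith
qed

text \<open>Mean value inequality on the box of saturated values, which is convex and contains both
  end points. The bound keeps the actual deviation of \<open>satv\<close> instead of \<gamma>_s, so
  that \<open>satv_deviation_scaled\<close> can still act on it.\<close>

lemma phi_s_norm_le:
  fixes \<phi> :: "real^'q \<Rightarrow> real^'n \<Rightarrow> real^'n"
  assumes l: "0 \<le> l_s" "0 < \<epsilon>_s" and \<phi>: "C1_in_parameter \<phi>" and \<theta>: "norm \<theta> \<le> l_s"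
    and B: "\<And>\<theta>. (\<And>i. \<bar>\<theta> $ i\<bar> \<le> l_s + 0.5 * \<epsilon>_s) \<Longrightarrow> onorm (frechet_derivative (\<lambda>\<theta>. \<phi> \<theta> x) (at \<theta>)) \<le> B"
  shows "norm (phi_s l_s \<epsilon>_s \<phi> \<theta> \<theta>t x) \<le> B * norm (satv l_s \<epsilon>_s (\<theta> + \<theta>t) - \<theta>)"
proof -
  define S :: "(real^'q) set" where "S = cbox (\<chi> i. - (l_s + 0.5 * \<epsilon>_s)) (\<chi> i. l_s + 0.5 * \<epsilon>_s)"
  have S: "v \<in> S \<longleftrightarrow> (\<forall>i. \<bar>v $ i\<bar> \<le> l_s + 0.5 * \<epsilon>_s)" for v
  proof -
    have "(- (l_s + 0.5 * \<epsilon>_s) \<le> v $ i \<and> v $ i \<le> l_s + 0.5 * \<epsilon>_s) = (\<bar>v $ i\<bar> \<le> l_s + 0.5 * \<epsilon>_s)" for i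
      by linarith
    then show ?thesis
      by (simp only: S_def mem_box_cart vec_lambda_beta)
  qed
  have satv: "satv l_s \<epsilon>_s v \<in> S" for v :: "real^'q"
    using sat_bound[OF l] by (simp add: S satv_def)
  have "norm (\<phi> (satv l_s \<epsilon>_s (\<theta> + \<theta>t)) x - \<phi> (satv l_s \<epsilon>_s \<theta>) x)
      \<le> B * norm (satv l_s \<epsilon>_s (\<theta> + \<theta>t) - satv l_s \<epsilon>_s \<theta>)"
  proof (rule differentiable_bound[where S = S])
    show "convex S"
      by (simp add: S_def convex_box)
    fix v assume v: "v \<in> S"
    obtain D :: "real^'q \<Rightarrow> real^'q^'n" where "((\<lambda>\<theta>. \<phi> \<theta> x) has_derivative (\<lambda>h. D v *v h)) (at v)"
      using \<phi> unfolding C1_in_parameter_def by blast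
    then have "(\<lambda>\<theta>. \<phi> \<theta> x) differentiable (at v)"
      by (rule differentiableI)
    then have "((\<lambda>\<theta>. \<phi> \<theta> x) has_derivative frechet_derivative (\<lambda>\<theta>. \<phi> \<theta> x) (at v)) (at v)"
      by (rule iffD1[OF frechet_derivative_works])
    then show "((\<lambda>\<theta>. \<phi> \<theta> x) has_derivative frechet_derivative (\<lambda>\<theta>. \<phi> \<theta> x) (at v)) (at v within S)"
      by (rule has_derivative_at_withinI)
    show "onorm (frechet_derivative (\<lambda>\<theta>. \<phi> \<theta> x) (at v)) \<le> B"
      using v by (intro B) (simp add: S)
  qed (rule satv)+
  then show ?thesis
    by (simp add: phi_s_def satv_ident[OF \<theta>])
qed

lemma continuous_on_extended_error_system:
  fixes f_1 :: "real^'n \<Rightarrow> real^'n" and \<phi> :: "real^'q \<Rightarrow> real^'n \<Rightarrow> real^'n"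
    and g_1 :: "real^'n \<Rightarrow> real^'m^'n"
    and \<psi> :: "real^'n \<Rightarrow> real^'n \<Rightarrow> real^'q \<Rightarrow> real^'n \<Rightarrow> real^'m"
    and \<sigma> :: "real^'n \<Rightarrow> real^'n^'q"
  assumes l: "0 \<le> l_\<theta>" "0 \<le> l_s" "0 < \<epsilon>_s"
    and f_1: "continuous_on UNIV f_1" and g_1: "continuous_on UNIV g_1"
    and \<phi>: "continuous_on UNIV (\<lambda>(\<theta>, x). \<phi> \<theta> x)"
    and \<psi>: "continuous_on UNIV (\<lambda>(xr, dxr, \<theta>, e). \<psi> xr dxr \<theta> e)"
    and \<sigma>: "continuous_on UNIV \<sigma>" and K: "continuous_on UNIV K"
    and x_r: "continuous_on T x_r" and dx_r: "continuous_on T dx_r"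
  shows "continuous_on (T \<times> UNIV)
    (\<lambda>(t, x). extended_error_system l_\<theta> l_s \<epsilon>_s k_dz f_1 \<phi> g_1 \<psi> \<sigma> K x_r dx_r \<theta> t x)"
proof -
  note proj = continuous_on_fst continuous_on_snd continuous_on_id
  have xr: "continuous_on (T \<times> UNIV) (\<lambda>p. x_r (fst p))"
    and dxr: "continuous_on (T \<times> UNIV) (\<lambda>p. dx_r (fst p))"
    by (auto intro!: continuous_on_compose2[OF x_r] continuous_on_compose2[OF dx_r] proj)
  have comp: "continuous_on S (\<lambda>p. h (a p))"
    if "continuous_on UNIV h" "continuous_on S a"
    for h :: "'b::topological_space \<Rightarrow> 'c::topological_space" and a :: "'d::topological_space \<Rightarrow> 'b" and S
    using continuous_on_compose2[OF that] by simp
  have \<phi>': "continuous_on S (\<lambda>p. \<phi> (a p) (b p))" if "continuous_on S a" "continuous_on S b"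
    for a b and S :: "'b::topological_space set"
    using comp[OF \<phi> continuous_on_Pair[OF that]] by simp
  have \<psi>': "continuous_on S (\<lambda>p. \<psi> (a p) (b p) (c p) (d p))"
    if "continuous_on S a" "continuous_on S b" "continuous_on S c" "continuous_on S d"
    for a b c d and S :: "'b::topological_space set"
    using comp[OF \<psi>
        continuous_on_Pair[OF that(1) continuous_on_Pair[OF that(2) continuous_on_Pair[OF that(3,4)]]]]
    by simp
  note mv = bounded_bilinear.continuous_on[OF bounded_bilinear_matrix_vector]
  show ?thesis
    unfolding extended_error_system_def F_field_def phi_s_def H_field_def Delta_f_def case_prod_beta
    by (intro continuous_on_Pair continuous_on_add continuous_on_diff continuous_on_minus
        continuous_on_scaleR continuous_on_const xr dxr \<phi>' \<psi>' mv comp[OF f_1] comp[OF g_1] comp[OF \<sigma>] comp[OF K]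
        comp[OF continuous_on_satv[OF l(2,3)]] comp[OF continuous_on_dzv[OF l(1)]] proj)
qed

text \<open>\<open>a_s\<close> is built for this cancellation: \<open>a_1 * a_s\<^sup>2\<close>
  equals \<open>a_2 * (a_4 / a_3)\<^sup>2\<close>, so a comparison of Lyapunov values becomes one
  between the gradient bound and the decay rate.\<close>

lemma gain_bound:
  fixes a_1 a_2 a_3 a_4 q r :: real
  assumes pos: "0 < a_1" "0 < a_2" "0 < a_3" "0 < a_4" and "0 \<le> q"
    and a_s: "a_s = sqrt a_2 * a_4 / (sqrt a_1 * a_3)" and "a_1 * (r * a_s)\<^sup>2 \<le> a_2 * q\<^sup>2"
  shows "r * a_4 \<le> a_3 * q"
proof -
  have "a_1 * (r * a_s)\<^sup>2 = a_2 * (r * a_4 / a_3)\<^sup>2"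
    using pos by (simp add: a_s power_mult_distrib power_divide)
  then have "(r * a_4 / a_3)\<^sup>2 \<le> q\<^sup>2"
    using assms(2,7) by simp
  then have "r * a_4 / a_3 \<le> q"
    using \<open>0 \<le> q\<close> by (rule power2_le_imp_le)
  then show ?thesis
    using pos by (simp add: field_simps)
qed

theorem theorem4:
  fixes \<Theta> :: "(real^'q) set" and \<theta> :: "real^'q"
    and f_1 :: "real^'n \<Rightarrow> real^'n" and \<phi> :: "real^'q \<Rightarrow> real^'n \<Rightarrow> real^'n"
    and g_1 :: "real^'n \<Rightarrow> real^'m^'n"
    and \<psi> :: "real^'n \<Rightarrow> real^'n \<Rightarrow> real^'q \<Rightarrow> real^'n \<Rightarrow> real^'m"
    and \<sigma> :: "real^'n \<Rightarrow> real^'n^'q"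
    and x_r dx_r :: "real \<Rightarrow> real^'n"
    and V_err :: "real \<Rightarrow> real^'n \<Rightarrow> real" and V_est :: "real \<Rightarrow> real^'q \<Rightarrow> real"
    and K_1 K_2 :: "real^'n \<Rightarrow> real^'n"
    and \<gamma>_s \<kappa>_1 \<rho>_1 \<rho>_2 \<rho>_3 \<alpha>_1 \<alpha>_2 \<alpha>_3 \<alpha>_4 g_\<theta>e g_\<theta>\<epsilon> g_e\<theta> \<pi>_\<epsilon>\<theta> \<pi>_\<epsilon>e :: "real \<Rightarrow> real"
    and l_\<theta> l_s \<epsilon>_s l_\<gamma> \<rho>_1s k_dz a_1 a_2 a_3 a_4 a_s r_1 k_\<epsilon> \<tau>_err \<tau>_err' \<tau>_est :: real
  assumes "compact \<Theta>" and "\<theta> \<in> \<Theta>"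
    and "\<forall>\<theta>\<in>\<Theta>. norm \<theta> \<le> l_\<theta>" and "l_s > l_\<theta>" and "0 < \<epsilon>_s" and "\<epsilon>_s \<le> 1"
    \<comment> \<open>well-posedness of the differential equations involved\<close>
    and "continuous_on UNIV f_1" and "continuous_on UNIV g_1"
    and "continuous_on UNIV (\<lambda>(\<theta>, x). \<phi> \<theta> x)"
    and "continuous_on UNIV (\<lambda>(xr, dxr, \<theta>, e). \<psi> xr dxr \<theta> e)"
    and "continuous_on UNIV K_1" and "continuous_on UNIV K_2"
    and "\<forall>x. \<sigma> differentiable (at x)"
    and "C1_in_parameter \<phi>"
    and "reference_signal x_r dx_r r_1"
    and "monotone_excited \<Theta> l_\<theta> l_s \<phi> x_r \<sigma>"
    and "error_lyapunov (F_field f_1 \<phi> g_1 \<psi>) x_r dx_r V_err \<alpha>_1 \<alpha>_2 \<alpha>_3 \<alpha>_4"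
    and "\<gamma>_s \<in> class_K - class_Kinf" and "l_\<gamma> > 0"
    and "\<forall>s\<ge>0. \<gamma>_s s \<le> l_\<gamma> \<and> \<gamma>_s s \<le> s"
    and "\<forall>\<theta>\<in>\<Theta>. \<forall>\<theta>t. norm (satv l_s \<epsilon>_s (\<theta> + \<theta>t) - \<theta>) \<le> \<gamma>_s (norm \<theta>t)"
    and "\<kappa>_1 \<in> class_SN"
    \<comment> \<open>the supremum runs over the box of all values of \<open>satv\<close>\<close>
    and "\<forall>s\<ge>0. \<forall>\<theta> xr e. (\<forall>i. \<bar>\<theta> $ i\<bar> \<le> l_s + 0.5 * \<epsilon>_s) \<and> xr \<in> cball 0 r_1 \<and> e \<in> cball 0 s \<longrightarrow>
           onorm (frechet_derivative (\<lambda>\<theta>. \<phi> \<theta> (e + xr)) (at \<theta>)) \<le> \<kappa>_1 s"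
    and "{\<rho>_1, \<rho>_2, \<rho>_3} \<subseteq> class_K" and "\<rho>_1s \<ge> 0"
    and "\<forall>\<theta>\<in>\<Theta>. \<forall>\<theta>t. \<forall>xr\<in>cball 0 r_1. \<forall>e.
           norm (phi_s l_s \<epsilon>_s \<phi> \<theta> \<theta>t (e + xr)) \<le> (\<rho>_1 (norm e) + \<rho>_1s) * \<gamma>_s (norm \<theta>t)"
    and "\<forall>\<theta>\<in>\<Theta>. \<forall>\<theta>t. \<forall>xr\<in>cball 0 r_1. \<forall>e \<epsilon>e.
           norm (Delta_f l_s \<epsilon>_s \<phi> \<sigma> \<theta> \<theta>t xr e \<epsilon>e)
             \<le> (\<rho>_2 (norm e) + \<rho>_3 (norm \<epsilon>e)) * \<gamma>_s (norm \<theta>t)"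
    and "k_dz > 0"
    and "estimation_lyapunov \<Theta> (H_field l_\<theta> l_s \<epsilon>_s k_dz \<phi> \<sigma>) x_r V_est a_1 a_2 a_3 a_4"
    and "a_s = sqrt a_2 * a_4 / (sqrt a_1 * a_3)"
    and "\<tau>_err > \<tau>_err'" and "\<tau>_err' > \<tau>_est" and "\<tau>_est > 1"
    and "\<forall>s\<ge>0. \<alpha>_3 s \<ge>
           \<tau>_err * \<gamma>_s (a_s * l_\<gamma> * \<rho>_2 (inv_into {0..} \<alpha>_1 (\<alpha>_2 s))) * \<alpha>_4 s * \<kappa>_1 s"
    and "g_\<theta>e = (\<lambda>s. a_1 * (\<tau>_est * a_s * l_\<gamma>)\<^sup>2 * (\<rho>_2 (inv_into {0..} \<alpha>_1 s))\<^sup>2)"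
    and "g_\<theta>\<epsilon> = (\<lambda>s. 4 * \<tau>_est\<^sup>2 / (\<tau>_est - 1)\<^sup>2 * a_1 * (\<tau>_est * a_s * l_\<gamma>)\<^sup>2 * (\<rho>_3 (sqrt s))\<^sup>2)"
    \<comment> \<open>the inverse of \<open>g_\<theta>e\<close> is defined on all of \<open>{0..}\<close>\<close>
    and "g_\<theta>e ` {0..} = {0..}"
    and "g_e\<theta> = (\<lambda>s. inv_into {0..} g_\<theta>e (\<tau>_est / \<tau>_err' * s))"
    and "\<pi>_\<epsilon>\<theta> = (\<lambda>s. \<rho>_1s * \<gamma>_s (sqrt (s / a_1)) + 1/4 * (\<gamma>_s (sqrt (s / a_1)))\<^sup>2)"
    and "\<pi>_\<epsilon>e = (\<lambda>s. (\<rho>_1 (inv_into {0..} \<alpha>_1 s))\<^sup>2)"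
    and "\<forall>\<epsilon>e. \<epsilon>e \<bullet> K_1 \<epsilon>e \<ge> norm \<epsilon>e * (\<pi>_\<epsilon>e \<circ> g_e\<theta> \<circ> g_\<theta>\<epsilon>) ((norm \<epsilon>e)\<^sup>2)"
    and "\<forall>\<epsilon>e. \<epsilon>e \<bullet> K_2 \<epsilon>e \<ge> norm \<epsilon>e * (\<pi>_\<epsilon>\<theta> \<circ> g_\<theta>\<epsilon>) ((norm \<epsilon>e)\<^sup>2)"
    and "k_\<epsilon> > 0"
  shows "let K = (\<lambda>\<epsilon>e. k_\<epsilon> *\<^sub>R \<epsilon>e + K_1 \<epsilon>e + K_2 \<epsilon>e);
             original = closed_loop l_\<theta> l_s \<epsilon>_s k_dz f_1 \<phi> g_1 \<psi> \<sigma> K x_r dx_r \<theta>;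
             extended = extended_error_system l_\<theta> l_s \<epsilon>_s k_dz f_1 \<phi> g_1 \<psi> \<sigma> K x_r dx_r \<theta>
         in (\<forall>I X. I \<subseteq> {0..} \<longrightarrow>
               (ode_solution original I X \<longleftrightarrow>
                ode_solution extended I (\<lambda>t. error_coords \<sigma> x_r \<theta> t (X t)))) \<and>
            zero_UGAS extended"
proof -
  define K where "K \<epsilon>e = k_\<epsilon> *\<^sub>R \<epsilon>e + K_1 \<epsilon>e + K_2 \<epsilon>e" for \<epsilon>e
  define original where "original = closed_loop l_\<theta> l_s \<epsilon>_s k_dz f_1 \<phi> g_1 \<psi> \<sigma> K x_r dx_r \<theta>"
  define extended where
    "extended = extended_error_system l_\<theta> l_s \<epsilon>_s k_dz f_1 \<phi> g_1 \<psi> \<sigma> K x_r dx_r \<theta>"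
  have \<theta>: "norm \<theta> \<le> l_\<theta>" "norm \<theta> \<le> l_s" "\<And>i. \<bar>\<theta> $ i\<bar> \<le> l_s" and l: "0 \<le> l_\<theta>" "0 \<le> l_s"
    using assms(2-4) component_le_norm_cart[of \<theta>] norm_ge_zero[of \<theta>] by (force intro: order_trans)+
  note \<epsilon>_s = \<open>0 < \<epsilon>_s\<close>
  have x_r: "\<And>t. 0 \<le> t \<Longrightarrow> (x_r has_vector_derivative dx_r t) (at t within {0..})"
    and dx_r: "continuous_on {0..} dx_r" and x_r_ball: "\<And>t. 0 \<le> t \<Longrightarrow> x_r t \<in> cball 0 r_1"
    using assms(15) by (auto simp: reference_signal_def)
  obtain Vt Ve where \<alpha>: "\<alpha>_1 \<in> class_Kinf" "\<alpha>_2 \<in> class_Kinf" "\<alpha>_3 \<in> class_Kinf" "\<alpha>_4 \<in> class_Kinf"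
    and F0: "\<And>t \<theta>. 0 \<le> t \<Longrightarrow> F_field f_1 \<phi> g_1 \<psi> (x_r t) (dx_r t) \<theta> 0 = 0"
    and V_err: "C1_time_state V_err Vt Ve"
    and V_err_bounds: "\<And>t e. 0 \<le> t \<Longrightarrow> \<alpha>_1 (norm e) \<le> V_err t e" "\<And>t e. 0 \<le> t \<Longrightarrow> V_err t e \<le> \<alpha>_2 (norm e)"
      "\<And>t e. 0 \<le> t \<Longrightarrow> norm (Ve t e) \<le> \<alpha>_4 (norm e)"
    and V_err_decay: "\<And>t e \<theta>. 0 \<le> t \<Longrightarrow>
      Vt t e + Ve t e \<bullet> F_field f_1 \<phi> g_1 \<psi> (x_r t) (dx_r t) \<theta> e \<le> - \<alpha>_3 (norm e)"
    using assms(17) unfolding error_lyapunov_def by auto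
  obtain Wt W\<theta> where a: "0 < a_1" "0 < a_2" "0 < a_3" "0 < a_4"
    and V_est: "C1_time_state V_est Wt W\<theta>"
    and V_est_bounds: "\<And>t v. 0 \<le> t \<Longrightarrow> a_1 * (norm v)\<^sup>2 \<le> V_est t v"
      "\<And>t v. 0 \<le> t \<Longrightarrow> V_est t v \<le> a_2 * (norm v)\<^sup>2"
      "\<And>t v. 0 \<le> t \<Longrightarrow> norm (W\<theta> t v) \<le> a_4 * norm v"
    and V_est_decay: "\<And>t v. 0 \<le> t \<Longrightarrow>
      Wt t v + W\<theta> t v \<bullet> H_field l_\<theta> l_s \<epsilon>_s k_dz \<phi> \<sigma> \<theta> v (x_r t) \<le> - a_3 * (norm v)\<^sup>2"
    using assms(29) \<open>\<theta> \<in> \<Theta>\<close> unfolding estimation_lyapunov_def by auto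
  have \<gamma>: "\<gamma>_s \<in> class_K" and \<rho>: "\<rho>_1 \<in> class_K" "\<rho>_2 \<in> class_K" "\<rho>_3 \<in> class_K"
    using assms(18,24) by auto
  have \<gamma>_le: "\<gamma>_s s \<le> l_\<gamma>" if "0 \<le> s" for s
    using assms(20) that by simp
  have satv_le: "norm (satv l_s \<epsilon>_s (\<theta> + v) - \<theta>) \<le> \<gamma>_s (norm v)" for v
    using assms(21) \<open>\<theta> \<in> \<Theta>\<close> by simp
  have \<tau>: "1 < \<tau>_est" "\<tau>_est < \<tau>_err'" "\<tau>_err' < \<tau>_err" "0 < \<tau>_est" "0 < \<tau>_err'" "0 < \<tau>_err"
    using assms(31-33) by auto
  have a_s: "0 < a_s"
    using a by (simp add: assms(30))
  note k = \<open>k_\<epsilon> > 0\<close>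

  \<comment> \<open>Gains and rescaling functions\<close>
  define y where "y v = a_s * l_\<gamma> * \<rho>_2 (inv0 \<alpha>_1 v)" for v
  have y: "y \<in> class_K"
    unfolding y_def[abs_def] using a_s \<open>l_\<gamma> > 0\<close>
    by (intro class_K_scale class_K_comp[OF \<rho>(2) class_Kinf_K[OF inv0_Kinf[OF \<alpha>(1)]]]) simp
  \<comment> \<open>\<open>y\<close> is the expression shared by the gain \<open>g_\<theta>e\<close>
    and, through \<open>y (\<alpha>_2 s)\<close>, by the small-gain inequality for
    \<open>\<alpha>_3\<close>.\<close>
  have g_\<theta>e_eq: "g_\<theta>e v = a_1 * (\<tau>_est * y v)\<^sup>2" for v
    by (simp add: assms(35) y_def power_mult_distrib)
  have g_\<theta>e: "g_\<theta>e \<in> class_Kinf"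
  proof (rule class_KinfI)
    have "g_\<theta>e \<in> class_K"
      using class_K_scale[OF class_K_power2[OF class_K_scale[OF y \<tau>(4)]] a(1)] g_\<theta>e_eq by presburger
    then show "strict_mono_on {0..} g_\<theta>e"
      by (simp add: class_K_def)
  qed (rule assms(37))
  \<comment> \<open>The inverse of \<open>g_e\<theta>\<close>: comparing \<open>\<sigma>1\<close> of
    \<open>V_err\<close> with a number is comparing \<open>V_err\<close> with
    \<open>g_e\<theta>\<close> of it.\<close>
  define \<sigma>1 where "\<sigma>1 v = \<tau>_err' / \<tau>_est * g_\<theta>e v" for v
  have \<sigma>1: "\<sigma>1 \<in> class_Kinf"
    unfolding \<sigma>1_def[abs_def] using \<tau> by (intro class_Kinf_comp[OF class_Kinf_scale g_\<theta>e]) simp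
  have \<sigma>1_eq: "\<sigma>1 v = a_1 * (sqrt (\<tau>_err' * \<tau>_est) * y v)\<^sup>2" for v
    using \<tau> by (simp add: \<sigma>1_def g_\<theta>e_eq power_mult_distrib power2_eq_square)

  \<comment> \<open>The sum of the two gains that \<open>K_2\<close> and \<open>K_1\<close>
    compensate.\<close>
  define P where "P u = (\<pi>_\<epsilon>e \<circ> g_e\<theta>) u + \<pi>_\<epsilon>\<theta> u" for u
  have g_e\<theta>: "g_e\<theta> \<in> class_Kinf"
    unfolding assms(38) using \<tau>
    by (intro class_Kinf_comp[OF inv0_Kinf[OF g_\<theta>e] class_Kinf_scale]) simp
  have \<pi>_\<epsilon>e: "\<pi>_\<epsilon>e \<in> class_K"
    unfolding assms(40)
    by (intro class_K_power2 class_K_comp[OF \<rho>(1) class_Kinf_K[OF inv0_Kinf[OF \<alpha>(1)]]])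
  have \<pi>_\<epsilon>\<theta>: "\<pi>_\<epsilon>\<theta> \<in> class_K"
  proof -
    have "(\<lambda>s. 1 / a_1 * s) \<in> class_Kinf"
      using a by (intro class_Kinf_scale) simp
    then have "(\<lambda>s. sqrt (1 / a_1 * s)) \<in> class_Kinf"
      by (rule class_Kinf_comp[OF class_Kinf_sqrt])
    then have "(\<lambda>s. \<gamma>_s (sqrt (1 / a_1 * s))) \<in> class_K"
      by (rule class_K_comp[OF \<gamma> class_Kinf_K])
    then have g: "(\<lambda>s. \<gamma>_s (sqrt (s / a_1))) \<in> class_K"
      by simp
    show ?thesis
      unfolding assms(39)
      by (rule class_K_add[OF class_SN_scale[OF class_K_SN[OF g] assms(25)] _
            class_K_scale[OF class_K_power2[OF g]]]) (simp_all add: class_K_0[OF \<gamma>])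
  qed
  have P: "P \<in> class_K"
    unfolding P_def[abs_def] o_def
    by (rule class_K_add[OF class_K_SN[OF class_K_comp[OF \<pi>_\<epsilon>e class_Kinf_K[OF g_e\<theta>]]] _ \<pi>_\<epsilon>\<theta>])
      (simp add: class_Kinf_props(4)[OF g_e\<theta>] class_K_0[OF \<pi>_\<epsilon>e])

  \<comment> \<open>\<open>\<rho>_3\<close> may be bounded, so \<open>g_\<theta>\<epsilon>\<close> alone would not make \<open>\<sigma>3\<close> unbounded; the additional term
    \<open>inv0 Q\<close> is so small that half of the linear damping \<open>k_\<epsilon>\<close> pays for it.\<close>
  define Q where "Q u = 2 / k_\<epsilon> * P u + u" for u
  have Q: "Q \<in> class_Kinf"
    unfolding Q_def[abs_def] using k
    by (intro class_Kinf_add class_SN_scale class_K_SN P class_Kinf_id) (auto simp: class_K_0[OF P])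
  have P_Q: "P (inv0 Q s) \<le> k_\<epsilon> / 2 * s" if "0 \<le> s" for s
  proof -
    have "2 / k_\<epsilon> * P (inv0 Q s) \<le> s"
      using f_inv0[OF Q that] inv0_nonneg[OF Q that] by (simp add: Q_def)
    then show ?thesis
      using k by (simp add: field_simps)
  qed
  have g_\<theta>\<epsilon>: "g_\<theta>\<epsilon> \<in> class_K"
    unfolding assms(36) using a a_s \<tau> \<open>l_\<gamma> > 0\<close>
    by (intro class_K_scale class_K_power2 class_K_comp[OF \<rho>(3) class_Kinf_K[OF class_Kinf_sqrt]]) simp
  define \<sigma>3 where "\<sigma>3 w = max (g_\<theta>\<epsilon> w) (inv0 Q (sqrt w))" for w
  have \<sigma>3: "\<sigma>3 \<in> class_Kinf"
    unfolding \<sigma>3_def[abs_def]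
    by (rule class_Kinf_max[OF g_\<theta>\<epsilon> class_Kinf_comp[OF inv0_Kinf[OF Q] class_Kinf_sqrt]])
  have P_\<sigma>3: "P (\<sigma>3 (s\<^sup>2)) \<le> P (g_\<theta>\<epsilon> (s\<^sup>2)) + k_\<epsilon> / 2 * s" if "0 \<le> s" for s
  proof (cases "inv0 Q s \<le> g_\<theta>\<epsilon> (s\<^sup>2)")
    case True
    then show ?thesis
      using that k by (simp add: \<sigma>3_def max_absorb1)
  next
    case False
    then show ?thesis
      using that P_Q[OF that] class_K_nonneg[OF P class_K_nonneg[OF g_\<theta>\<epsilon>, of "s\<^sup>2"]]
      by (simp add: \<sigma>3_def max_absorb2)
  qed

  \<comment> \<open>The maximum function and its class K-infinity bounds\<close>
  define W1 W2 W3 where "W1 t x = V_err t (fst x)" and "W2 t x = V_est t (fst (snd x))"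
    and "W3 t x = (norm (snd (snd x)))\<^sup>2" for t :: real and x :: "(real^'n) \<times> (real^'q) \<times> (real^'n)"
  define U where "U t x = max (\<sigma>1 (W1 t x)) (max (W2 t x) (\<sigma>3 (W3 t x)))" for t x
  have W_nonneg: "0 \<le> W1 t x" "0 \<le> W2 t x" "0 \<le> W3 t x" if "0 \<le> t" for t x
    using order_trans[OF class_Kinf_props(5)[OF \<alpha>(1) norm_ge_zero] V_err_bounds(1)[OF that]]
      order_trans[OF _ V_est_bounds(1)[OF that], of 0] a(1)
    by (simp_all add: W1_def W2_def W3_def)
  \<comment> \<open>At least one of the three components carries a third of the norm; the minimum
    covers whichever it is.\<close>
  define A where "A s = min (\<sigma>1 (\<alpha>_1 (1 / 3 * s))) (min (a_1 * (1 / 3 * s)\<^sup>2) (\<sigma>3 ((1 / 3 * s)\<^sup>2)))" for s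
  define B where "B s = max (\<sigma>1 (\<alpha>_2 s)) (max (a_2 * s\<^sup>2) (\<sigma>3 (s\<^sup>2)))" for s
  have third: "(\<lambda>s::real. 1 / 3 * s) \<in> class_Kinf"
    by (rule class_Kinf_scale) simp
  note third_sq = class_Kinf_comp[OF class_Kinf_power2 third]
  have A: "A \<in> class_Kinf"
    unfolding A_def[abs_def]
    by (rule class_Kinf_min[OF class_Kinf_comp[OF \<sigma>1 class_Kinf_comp[OF \<alpha>(1) third]]
        class_Kinf_min[OF class_Kinf_comp[OF class_Kinf_scale[OF a(1)] third_sq]
        class_Kinf_comp[OF \<sigma>3 third_sq]]])
  have B: "B \<in> class_Kinf"
    unfolding B_def[abs_def]
    by (rule class_Kinf_max[OF class_Kinf_K[OF class_Kinf_comp[OF \<sigma>1 \<alpha>(2)]]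
        class_Kinf_max[OF class_Kinf_K[OF class_Kinf_comp[OF class_Kinf_scale[OF a(2)] class_Kinf_power2]]
        class_Kinf_comp[OF \<sigma>3 class_Kinf_power2]]])
  have AU: "A (norm x) \<le> U t x" if t: "0 \<le> t" for t x
  proof -
    obtain e v \<epsilon>e where x: "x = (e, v, \<epsilon>e)" by (cases x)
    have "norm x \<le> norm e + (norm v + norm \<epsilon>e)"
      unfolding x by (rule order_trans[OF norm_Pair_le add_left_mono[OF norm_Pair_le]])
    then consider "1 / 3 * norm x \<le> norm e" | "1 / 3 * norm x \<le> norm v" | "1 / 3 * norm x \<le> norm \<epsilon>e"
      by linarith
    then show ?thesis
    proof cases
      case 1
      then have "\<alpha>_1 (1 / 3 * norm x) \<le> V_err t e"
        by (intro order_trans[OF class_Kinf_props(3)[OF \<alpha>(1)] V_err_bounds(1)[OF t]]) auto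
      then have "\<sigma>1 (\<alpha>_1 (1 / 3 * norm x)) \<le> \<sigma>1 (V_err t e)"
        by (intro class_Kinf_props(3)[OF \<sigma>1] class_Kinf_props(5)[OF \<alpha>(1)]) simp_all
      then show ?thesis
        by (simp add: A_def U_def W1_def x)
    next
      case 2
      then have "a_1 * (1 / 3 * norm x)\<^sup>2 \<le> a_1 * (norm v)\<^sup>2"
        using a by (intro mult_left_mono power_mono) auto
      also have "\<dots> \<le> V_est t v"
        by (rule V_est_bounds(1)[OF t])
      finally show ?thesis
        by (simp add: A_def U_def W2_def x)
    next
      case 3
      then have "(1 / 3 * norm x)\<^sup>2 \<le> (norm \<epsilon>e)\<^sup>2"
        by (intro power_mono) auto
      then have "\<sigma>3 ((1 / 3 * norm x)\<^sup>2) \<le> \<sigma>3 ((norm \<epsilon>e)\<^sup>2)"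
        by (intro class_Kinf_props(3)[OF \<sigma>3]) simp_all
      then show ?thesis
        by (simp add: A_def U_def W3_def x)
    qed
  qed
  have UB: "U t x \<le> B (norm x)" if t: "0 \<le> t" for t x
  proof -
    obtain e v \<epsilon>e where x: "x = (e, v, \<epsilon>e)" by (cases x)
    have n: "norm e \<le> norm x" "norm v \<le> norm x" "norm \<epsilon>e \<le> norm x"
      using norm_fst_le[of e "(v, \<epsilon>e)"] norm_snd_le[of "(v, \<epsilon>e)" e] norm_fst_le[of v \<epsilon>e] norm_snd_le[of \<epsilon>e v]
      unfolding x by linarith+
    have "V_err t e \<le> \<alpha>_2 (norm x)"
      using V_err_bounds(2)[OF t] class_Kinf_props(3)[OF \<alpha>(2) norm_ge_zero n(1)] by (rule order_trans)
    then have 1: "\<sigma>1 (W1 t x) \<le> \<sigma>1 (\<alpha>_2 (norm x))"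
      using W_nonneg(1)[OF t, of x] by (intro class_Kinf_props(3)[OF \<sigma>1]) (simp_all add: W1_def x)
    have "V_est t v \<le> a_2 * (norm x)\<^sup>2"
      using a n(2) by (intro order_trans[OF V_est_bounds(2)[OF t]] mult_left_mono power_mono) auto
    then have 2: "W2 t x \<le> a_2 * (norm x)\<^sup>2"
      by (simp add: W2_def x)
    have 3: "\<sigma>3 (W3 t x) \<le> \<sigma>3 ((norm x)\<^sup>2)"
      using n(3) by (intro class_Kinf_props(3)[OF \<sigma>3]) (simp_all add: W3_def x)
    from 1 2 3 show ?thesis
      unfolding U_def B_def by (intro max.mono)
  qed
  have U: "continuous_on ({0..} \<times> UNIV) (\<lambda>(t, x). U t x)"
  proof -
    have W1: "continuous_on ({0..} \<times> UNIV) (\<lambda>p. W1 (fst p) (snd p))"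
      using continuous_on_compose2[OF C1_time_state_continuous[OF V_err], of "{0..} \<times> UNIV" "\<lambda>p. (fst p, fst (snd p))"]
      by (force simp: W1_def intro!: continuous_intros)
    have W2: "continuous_on ({0..} \<times> UNIV) (\<lambda>p. W2 (fst p) (snd p))"
      using continuous_on_compose2[OF C1_time_state_continuous[OF V_est], of "{0..} \<times> UNIV" "\<lambda>p. (fst p, fst (snd (snd p)))"]
      by (force simp: W2_def intro!: continuous_intros)
    have W3: "continuous_on ({0..} \<times> UNIV) (\<lambda>p. W3 (fst p) (snd p))"
      unfolding W3_def by (intro continuous_intros)
    have "continuous_on ({0..} \<times> UNIV) (\<lambda>p. \<sigma>1 (W1 (fst p) (snd p)))"
      by (rule continuous_on_compose2[OF class_Kinf_props(1)[OF \<sigma>1] W1]) (use W_nonneg in auto)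
    moreover have "continuous_on ({0..} \<times> UNIV) (\<lambda>p. \<sigma>3 (W3 (fst p) (snd p)))"
      by (rule continuous_on_compose2[OF class_Kinf_props(1)[OF \<sigma>3] W3]) (use W_nonneg in auto)
    ultimately show ?thesis
      unfolding U_def case_prod_beta using W2 by (intro continuous_on_max)
  qed

  \<comment> \<open>Decrease of each function where it dominates\<close>
  have coords: "extended t (e, v, \<epsilon>e) =
     (F_field f_1 \<phi> g_1 \<psi> (x_r t) (dx_r t) (satv l_s \<epsilon>_s (v + \<theta>)) e - phi_s l_s \<epsilon>_s \<phi> \<theta> v (e + x_r t),
      H_field l_\<theta> l_s \<epsilon>_s k_dz \<phi> \<sigma> \<theta> v (x_r t) + Delta_f l_s \<epsilon>_s \<phi> \<sigma> \<theta> v (x_r t) e \<epsilon>e,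
      - K \<epsilon>e - phi_s l_s \<epsilon>_s \<phi> \<theta> v (e + x_r t))" for t e v \<epsilon>e
    by (simp add: extended_def extended_error_system_def)
  have derivs: "((\<lambda>s. fst (X s)) has_vector_derivative fst d) (at_right t)"
    "((\<lambda>s. fst (snd (X s))) has_vector_derivative fst (snd d)) (at_right t)"
    "((\<lambda>s. snd (snd (X s))) has_vector_derivative snd (snd d)) (at_right t)"
    if "(X has_vector_derivative d) (at_right t)"
    for X :: "real \<Rightarrow> (real^'n) \<times> (real^'q) \<times> (real^'n)" and d t
    using bounded_linear.has_vector_derivative[OF bounded_linear_fst that]
      bounded_linear.has_vector_derivative[OF bounded_linear_fst
        bounded_linear.has_vector_derivative[OF bounded_linear_snd that]]
      bounded_linear.has_vector_derivative[OF bounded_linear_snd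
        bounded_linear.has_vector_derivative[OF bounded_linear_snd that]]
    by auto
  have le_inv: "norm e \<le> inv0 \<alpha>_1 (V_err t e)" if "0 \<le> t" for t e
    using le_inv0_iff[OF \<alpha>(1) norm_ge_zero, of "V_err t e" e] V_err_bounds(1)[OF that, of e]
      W_nonneg(1)[OF that, of "(e, 0, 0)"] by (simp add: W1_def)

  have margin: "0 < 1 - sqrt (\<tau>_err' * \<tau>_est) / \<tau>_err"
  proof -
    have "sqrt (\<tau>_err' * \<tau>_est) < sqrt (\<tau>_err' * \<tau>_err')"
      using \<tau> by (intro real_sqrt_less_mono mult_strict_left_mono) auto
    then show ?thesis
      using \<tau> by (simp add: field_simps)
  qed
  have e_decay: "Vt t e + Ve t e \<bullet> fst (extended t (e, v, \<epsilon>e))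
      \<le> - ((1 - sqrt (\<tau>_err' * \<tau>_est) / \<tau>_err) * \<alpha>_3 (inv0 \<alpha>_2 (V_err t e)))"
    if t: "0 \<le> t" and active: "V_est t v \<le> \<sigma>1 (V_err t e)" for t e v \<epsilon>e
  proof -
    let ?c = "sqrt (\<tau>_err' * \<tau>_est)" and ?p = "phi_s l_s \<epsilon>_s \<phi> \<theta> v (e + x_r t)"
      and ?V = "V_err t e" and ?F = "F_field f_1 \<phi> g_1 \<psi> (x_r t) (dx_r t) (satv l_s \<epsilon>_s (v + \<theta>)) e"
    define Y where "Y = \<gamma>_s (y (\<alpha>_2 (norm e)))"
    have V: "0 \<le> ?V"
      using W_nonneg(1)[OF t, of "(e, v, \<epsilon>e)"] by (simp add: W1_def)
    have yV: "0 \<le> y ?V"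
      by (rule class_K_nonneg[OF y V])
    have "1 * 1 \<le> \<tau>_err' * \<tau>_est"
      using \<tau> by (intro mult_mono) auto
    then have c: "1 \<le> ?c"
      by simp
    have "a_1 * (norm v)\<^sup>2 \<le> a_1 * (?c * y ?V)\<^sup>2"
      using V_est_bounds(1)[OF t] active unfolding \<sigma>1_eq by (rule order_trans)
    then have "(norm v)\<^sup>2 \<le> (?c * y ?V)\<^sup>2"
      using a(1) by simp
    then have "norm v \<le> ?c * y ?V"
      using c yV by (intro power2_le_imp_le[of "norm v"]) auto
    \<comment> \<open>Monotonicity would only give \<gamma>_s at \<open>?c * y ?V\<close>. The
      small-gain inequality controls \<gamma>_s without that inner factor, so \<open>?c\<close> has
      to come out in front, where \<tau>_err absorbs it.\<close>
    then have "norm (satv l_s \<epsilon>_s (\<theta> + v) - \<theta>) \<le> ?c * \<gamma>_s (y ?V)"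
      by (rule satv_deviation_scaled[OF \<epsilon>_s \<theta>(3) \<gamma> satv_le c yV])
    also have "\<dots> \<le> ?c * Y"
      unfolding Y_def using c V V_err_bounds(2)[OF t]
      by (intro mult_left_mono class_K_mono[OF \<gamma>] class_K_mono[OF y] yV) auto
    finally have dev: "norm (satv l_s \<epsilon>_s (\<theta> + v) - \<theta>) \<le> ?c * Y" .
    have \<kappa>: "0 \<le> \<kappa>_1 (norm e)"
      using assms(22) by (simp add: class_SN_def)
    have "norm ?p \<le> \<kappa>_1 (norm e) * norm (satv l_s \<epsilon>_s (\<theta> + v) - \<theta>)"
      using x_r_ball[OF t] assms(23)[rule_format, of "norm e" _ "x_r t" e]
      by (intro phi_s_norm_le[OF l(2) \<epsilon>_s assms(14) \<theta>(2)]) auto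
    also have "\<dots> \<le> \<kappa>_1 (norm e) * (?c * Y)"
      by (rule mult_left_mono[OF dev \<kappa>])
    finally have p: "norm ?p \<le> \<kappa>_1 (norm e) * (?c * Y)" .
    have "- (Ve t e \<bullet> ?p) \<le> norm (Ve t e) * norm ?p"
      using Cauchy_Schwarz_ineq2[of "Ve t e" ?p] by linarith
    also have "\<dots> \<le> \<alpha>_4 (norm e) * (\<kappa>_1 (norm e) * (?c * Y))"
      by (intro mult_mono V_err_bounds(3)[OF t] p class_Kinf_props(5)[OF \<alpha>(4)]) auto
    also have "\<dots> = ?c / \<tau>_err * (\<tau>_err * Y * \<alpha>_4 (norm e) * \<kappa>_1 (norm e))"
      using \<tau> by simp
    also have "\<dots> \<le> ?c / \<tau>_err * \<alpha>_3 (norm e)"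
      using assms(34)[rule_format, of "norm e"] c \<tau> unfolding Y_def y_def
      by (intro mult_left_mono) auto
    finally have "Vt t e + Ve t e \<bullet> fst (extended t (e, v, \<epsilon>e)) \<le> - ((1 - ?c / \<tau>_err) * \<alpha>_3 (norm e))"
      using V_err_decay[OF t, of e "satv l_s \<epsilon>_s (v + \<theta>)"]
      by (simp add: coords inner_diff_right algebra_simps)
    \<comment> \<open>The rate has to be a function of the value of \<open>V_err\<close>, as
      \<open>dissipated\<close> asks.\<close>
    also have "\<dots> \<le> - ((1 - ?c / \<tau>_err) * \<alpha>_3 (inv0 \<alpha>_2 ?V))"
    proof -
      have "inv0 \<alpha>_2 ?V \<le> norm e"
        using inv0_le_iff[OF \<alpha>(2) norm_ge_zero V, of e] V_err_bounds(2)[OF t] by simp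
      then have "\<alpha>_3 (inv0 \<alpha>_2 ?V) \<le> \<alpha>_3 (norm e)"
        by (rule class_Kinf_props(3)[OF \<alpha>(3) inv0_nonneg[OF \<alpha>(2) V]])
      then show ?thesis
        using margin by (intro le_imp_neg_le mult_left_mono) auto
    qed
    finally show ?thesis .
  qed
  have \<theta>_decay: "Wt t v + W\<theta> t v \<bullet> fst (snd (extended t (e, v, \<epsilon>e)))
      \<le> - ((2 * \<tau>_est - 1) * (\<tau>_est - 1) / (2 * \<tau>_est\<^sup>2) * a_3 / a_2 * V_est t v)"
    if t: "0 \<le> t" and active: "\<sigma>1 (V_err t e) \<le> V_est t v" "\<sigma>3 ((norm \<epsilon>e)\<^sup>2) \<le> V_est t v" for t e v \<epsilon>e
  proof -
    let ?\<Delta> = "Delta_f l_s \<epsilon>_s \<phi> \<sigma> \<theta> v (x_r t) e \<epsilon>e" and ?V = "V_err t e" and ?q = "norm v"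
    have V: "0 \<le> ?V"
      using W_nonneg(1)[OF t, of "(e, v, \<epsilon>e)"] by (simp add: W1_def)
    have \<rho>_nonneg: "0 \<le> \<rho>_2 (norm e)" "0 \<le> \<rho>_3 (norm \<epsilon>e)"
      using class_K_nonneg[OF \<rho>(2)] class_K_nonneg[OF \<rho>(3)] by auto
    have \<rho>2: "\<tau>_est * l_\<gamma> * \<rho>_2 (norm e) * a_4 \<le> a_3 * ?q"
    proof (rule gain_bound[OF a norm_ge_zero assms(30)])
      have "\<rho>_2 (norm e) \<le> \<rho>_2 (inv0 \<alpha>_1 ?V)"
        by (rule class_K_mono[OF \<rho>(2) norm_ge_zero le_inv[OF t]])
      then have "\<tau>_est * l_\<gamma> * \<rho>_2 (norm e) * a_s \<le> \<tau>_est * y ?V"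
        using \<tau> a_s \<open>l_\<gamma> > 0\<close> by (simp add: y_def)
      then have "(\<tau>_est * l_\<gamma> * \<rho>_2 (norm e) * a_s)\<^sup>2 \<le> (\<tau>_est * y ?V)\<^sup>2"
        using \<tau> a_s \<open>l_\<gamma> > 0\<close> \<rho>_nonneg by (intro power_mono) auto
      then have "a_1 * (\<tau>_est * l_\<gamma> * \<rho>_2 (norm e) * a_s)\<^sup>2 \<le> 1 * g_\<theta>e ?V"
        using a(1) by (simp add: g_\<theta>e_eq)
      also have "\<dots> \<le> \<sigma>1 ?V"
        unfolding \<sigma>1_def using \<tau> class_Kinf_props(5)[OF g_\<theta>e V] by (intro mult_right_mono) auto
      also have "\<dots> \<le> a_2 * ?q\<^sup>2"
        using active(1) V_est_bounds(2)[OF t] by (rule order_trans)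
      finally show "a_1 * (\<tau>_est * l_\<gamma> * \<rho>_2 (norm e) * a_s)\<^sup>2 \<le> a_2 * ?q\<^sup>2" .
    qed
    have \<rho>3: "2 * \<tau>_est\<^sup>2 / (\<tau>_est - 1) * l_\<gamma> * \<rho>_3 (norm \<epsilon>e) * a_4 \<le> a_3 * ?q"
    proof (rule gain_bound[OF a norm_ge_zero assms(30)])
      have "a_1 * (2 * \<tau>_est\<^sup>2 / (\<tau>_est - 1) * l_\<gamma> * \<rho>_3 (norm \<epsilon>e) * a_s)\<^sup>2 = g_\<theta>\<epsilon> ((norm \<epsilon>e)\<^sup>2)"
        by (simp add: assms(36) power_mult_distrib power_divide power2_eq_square)
      also have "\<dots> \<le> \<sigma>3 ((norm \<epsilon>e)\<^sup>2)"
        by (simp add: \<sigma>3_def)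
      also have "\<dots> \<le> a_2 * ?q\<^sup>2"
        using active(2) V_est_bounds(2)[OF t] by (rule order_trans)
      finally show "a_1 * (2 * \<tau>_est\<^sup>2 / (\<tau>_est - 1) * l_\<gamma> * \<rho>_3 (norm \<epsilon>e) * a_s)\<^sup>2 \<le> a_2 * ?q\<^sup>2" .
    qed
    \<comment> \<open>Of the decay \<open>a_3 * ?q\<^sup>2\<close> the coupling with
      \<open>e\<close> may use the share 1 / \<tau>_est and the coupling with the filter error the
      share (\<tau>_est - 1) / (2 \<tau>_est^2), which the leading factor of
      \<open>g_\<theta>\<epsilon>\<close> is tuned to. The rest, (2 \<tau>_est - 1)(\<tau>_est - 1)
      / (2 \<tau>_est^2), is positive.\<close>
    have \<rho>2': "a_4 * (\<rho>_2 (norm e) * l_\<gamma>) \<le> 1 / \<tau>_est * (a_3 * ?q)"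
      using \<rho>2 \<tau> by (simp add: field_simps)
    have \<rho>3': "a_4 * (\<rho>_3 (norm \<epsilon>e) * l_\<gamma>) \<le> (\<tau>_est - 1) / (2 * \<tau>_est\<^sup>2) * (a_3 * ?q)"
    proof -
      have "(\<tau>_est - 1) / (2 * \<tau>_est\<^sup>2) * (2 * \<tau>_est\<^sup>2 / (\<tau>_est - 1) * l_\<gamma> * \<rho>_3 (norm \<epsilon>e) * a_4)
          \<le> (\<tau>_est - 1) / (2 * \<tau>_est\<^sup>2) * (a_3 * ?q)"
        using \<tau> by (intro mult_left_mono \<rho>3) auto
      moreover have "(\<tau>_est - 1) / (2 * \<tau>_est\<^sup>2) * (2 * \<tau>_est\<^sup>2 / (\<tau>_est - 1)) = 1"
        using \<tau> by simp
      then have "(\<tau>_est - 1) / (2 * \<tau>_est\<^sup>2) * (2 * \<tau>_est\<^sup>2 / (\<tau>_est - 1) * l_\<gamma> * \<rho>_3 (norm \<epsilon>e) * a_4)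
          = a_4 * (\<rho>_3 (norm \<epsilon>e) * l_\<gamma>)"
        by (metis (no_types, lifting) mult.assoc mult.commute mult_1)
      ultimately show ?thesis by linarith
    qed
    have "norm ?\<Delta> \<le> (\<rho>_2 (norm e) + \<rho>_3 (norm \<epsilon>e)) * \<gamma>_s ?q"
      using assms(27) \<open>\<theta> \<in> \<Theta>\<close> x_r_ball[OF t] by blast
    also have "\<dots> \<le> (\<rho>_2 (norm e) + \<rho>_3 (norm \<epsilon>e)) * l_\<gamma>"
      using \<rho>_nonneg \<gamma>_le by (intro mult_left_mono) auto
    finally have \<Delta>: "norm ?\<Delta> \<le> (\<rho>_2 (norm e) + \<rho>_3 (norm \<epsilon>e)) * l_\<gamma>" .
    have "W\<theta> t v \<bullet> ?\<Delta> \<le> norm (W\<theta> t v) * norm ?\<Delta>"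
      by (rule norm_cauchy_schwarz)
    also have "\<dots> \<le> a_4 * ?q * ((\<rho>_2 (norm e) + \<rho>_3 (norm \<epsilon>e)) * l_\<gamma>)"
      using a by (intro mult_mono V_est_bounds(3)[OF t] \<Delta>) auto
    also have "\<dots> = ?q * (a_4 * (\<rho>_2 (norm e) * l_\<gamma>) + a_4 * (\<rho>_3 (norm \<epsilon>e) * l_\<gamma>))"
      by (simp add: algebra_simps)
    also have "\<dots> \<le> ?q * (1 / \<tau>_est * (a_3 * ?q) + (\<tau>_est - 1) / (2 * \<tau>_est\<^sup>2) * (a_3 * ?q))"
      using \<rho>2' \<rho>3' by (intro mult_left_mono add_mono) auto
    also have "\<dots> = (1 / \<tau>_est + (\<tau>_est - 1) / (2 * \<tau>_est\<^sup>2)) * (a_3 * ?q\<^sup>2)"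
      by (simp add: algebra_simps power2_eq_square)
    finally have "Wt t v + W\<theta> t v \<bullet> fst (snd (extended t (e, v, \<epsilon>e)))
        \<le> - a_3 * ?q\<^sup>2 + (1 / \<tau>_est + (\<tau>_est - 1) / (2 * \<tau>_est\<^sup>2)) * (a_3 * ?q\<^sup>2)"
      using V_est_decay[OF t, of v] by (simp add: coords inner_add_right)
    also have "\<dots> = - ((2 * \<tau>_est - 1) * (\<tau>_est - 1) / (2 * \<tau>_est\<^sup>2) * a_3 / a_2 * (a_2 * ?q\<^sup>2))"
      using \<tau> a by (simp add: field_simps power2_eq_square)
    also have "\<dots> \<le> - ((2 * \<tau>_est - 1) * (\<tau>_est - 1) / (2 * \<tau>_est\<^sup>2) * a_3 / a_2 * V_est t v)"
      using \<tau> a by (intro le_imp_neg_le mult_left_mono V_est_bounds(2)[OF t]) auto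
    finally show ?thesis .
  qed
  have \<epsilon>_decay: "2 * (\<epsilon>e \<bullet> snd (snd (extended t (e, v, \<epsilon>e)))) \<le> - (k_\<epsilon> * (norm \<epsilon>e)\<^sup>2)"
    if t: "0 \<le> t" and active: "\<sigma>1 (V_err t e) \<le> \<sigma>3 ((norm \<epsilon>e)\<^sup>2)" "V_est t v \<le> \<sigma>3 ((norm \<epsilon>e)\<^sup>2)"
    for t e v \<epsilon>e
  proof -
    let ?p = "phi_s l_s \<epsilon>_s \<phi> \<theta> v (e + x_r t)" and ?V = "V_err t e" and ?n = "norm \<epsilon>e"
    let ?w = "?n\<^sup>2" and ?g = "\<gamma>_s (norm v)" and ?r = "\<rho>_1 (norm e)"
    have V: "0 \<le> ?V"
      using W_nonneg(1)[OF t, of "(e, v, \<epsilon>e)"] by (simp add: W1_def)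
    have w: "0 \<le> \<sigma>3 ?w"
      by (rule class_Kinf_props(5)[OF \<sigma>3]) simp
    have e: "?r\<^sup>2 \<le> \<pi>_\<epsilon>e (g_e\<theta> (\<sigma>3 ?w))"
    proof -
      \<comment> \<open>Dominance of the filter error is turned into a bound on \<open>V_err\<close>
        by inverting \<open>\<sigma>1\<close>.\<close>
      have "g_\<theta>e ?V \<le> \<tau>_est / \<tau>_err' * \<sigma>3 ?w"
        using active(1) \<tau> by (simp add: \<sigma>1_def field_simps)
      then have "?V \<le> g_e\<theta> (\<sigma>3 ?w)"
        using le_inv0_iff[OF g_\<theta>e V, of "\<tau>_est / \<tau>_err' * \<sigma>3 ?w"] w \<tau> by (simp add: assms(38))
      then have "inv0 \<alpha>_1 ?V \<le> inv0 \<alpha>_1 (g_e\<theta> (\<sigma>3 ?w))"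
        by (rule class_Kinf_props(3)[OF inv0_Kinf[OF \<alpha>(1)] V])
      with le_inv[OF t] have "norm e \<le> inv0 \<alpha>_1 (g_e\<theta> (\<sigma>3 ?w))"
        by (rule order_trans)
      then show ?thesis
        unfolding assms(40)
        by (intro power_mono class_K_mono[OF \<rho>(1)] class_K_nonneg[OF \<rho>(1)]) auto
    qed
    have g: "?g \<le> \<gamma>_s (sqrt (\<sigma>3 ?w / a_1))" "0 \<le> ?g"
    proof -
      have "a_1 * (norm v)\<^sup>2 \<le> \<sigma>3 ?w"
        using V_est_bounds(1)[OF t] active(2) by (rule order_trans)
      then have "norm v \<le> sqrt (\<sigma>3 ?w / a_1)"
        using a(1) by (intro real_le_rsqrt) (simp add: field_simps)
      then show "?g \<le> \<gamma>_s (sqrt (\<sigma>3 ?w / a_1))"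
        by (intro class_K_mono[OF \<gamma>]) auto
      show "0 \<le> ?g"
        by (intro class_K_nonneg[OF \<gamma>]) simp
    qed
    have "\<rho>_1s * ?g + 1/4 * ?g\<^sup>2 \<le> \<pi>_\<epsilon>\<theta> (\<sigma>3 ?w)"
      unfolding assms(39) using g assms(25) by (intro add_mono mult_left_mono power_mono) auto
    moreover have "norm ?p \<le> (?r + \<rho>_1s) * ?g"
      using assms(26) \<open>\<theta> \<in> \<Theta>\<close> x_r_ball[OF t] by blast
    \<comment> \<open>Young's inequality separates the product; this is the origin of the square in
      \<open>\<pi>_\<epsilon>e\<close> and of the coefficient 1/4 in
      \<open>\<pi>_\<epsilon>\<theta>\<close>.\<close>
    moreover have "?r * ?g \<le> ?r\<^sup>2 + 1/4 * ?g\<^sup>2"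
      using zero_le_power2[of "?r - ?g / 2"] by (simp add: power2_eq_square algebra_simps)
    ultimately have "norm ?p \<le> P (\<sigma>3 ?w)"
      using e by (simp add: P_def algebra_simps)
    then have p: "norm ?p \<le> P (g_\<theta>\<epsilon> ?w) + k_\<epsilon> / 2 * ?n"
      using P_\<sigma>3[of ?n] by simp
    have "- (\<epsilon>e \<bullet> ?p) \<le> ?n * norm ?p"
      using Cauchy_Schwarz_ineq2[of \<epsilon>e ?p] by linarith
    also have "\<dots> \<le> ?n * (P (g_\<theta>\<epsilon> ?w) + k_\<epsilon> / 2 * ?n)"
      by (rule mult_left_mono[OF p norm_ge_zero])
    finally have "- (\<epsilon>e \<bullet> ?p) \<le> ?n * P (g_\<theta>\<epsilon> ?w) + k_\<epsilon> / 2 * ?w"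
      by (simp add: algebra_simps power2_eq_square)
    \<comment> \<open>Half of the linear damping absorbs the term
      \<open>k_\<epsilon> / 2 * ?w\<close>; the factor 2 from differentiating the squared norm turns
      the other half into the full rate \<open>k_\<epsilon>\<close>.\<close>
    moreover have "\<epsilon>e \<bullet> K \<epsilon>e \<ge> k_\<epsilon> * ?w + ?n * P (g_\<theta>\<epsilon> ?w)"
      using assms(41)[rule_format, of \<epsilon>e] assms(42)[rule_format, of \<epsilon>e]
      by (simp add: K_def inner_add_right P_def power2_norm_eq_inner algebra_simps)
    ultimately show ?thesis
      by (simp add: coords inner_diff_right)
  qed

  \<comment> \<open>Dissipation along curves tangent to the field\<close>
  have diss1: "dissipated extended U \<sigma>1 W1"
    unfolding dissipated_def
  proof (intro conjI allI impI bexI)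
    show "(\<lambda>w. (1 - sqrt (\<tau>_err' * \<tau>_est) / \<tau>_err) * \<alpha>_3 (inv0 \<alpha>_2 w)) \<in> class_K"
      using margin by (intro class_K_scale class_Kinf_K[OF class_Kinf_comp[OF \<alpha>(3) inv0_Kinf[OF \<alpha>(2)]]])
    fix t X assume t: "(0::real) \<le> t" and X: "(X has_vector_derivative extended t (X t)) (at_right t)"
    obtain e v \<epsilon>e where Xt: "X t = (e, v, \<epsilon>e)" by (cases "X t")
    show "\<exists>D. ((\<lambda>s. W1 s (X s)) has_real_derivative D) (at_right t) \<and> (\<sigma>1 (W1 t (X t)) = U t (X t) \<longrightarrow>
        D \<le> - ((1 - sqrt (\<tau>_err' * \<tau>_est) / \<tau>_err) * \<alpha>_3 (inv0 \<alpha>_2 (W1 t (X t)))))"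
      using C1_time_state_derivative[OF V_err t derivs(1)[OF X]] e_decay[OF t, of v e \<epsilon>e]
      by (intro exI[of _ "Vt t e + Ve t e \<bullet> fst (extended t (e, v, \<epsilon>e))"])
        (auto simp: W1_def W2_def U_def Xt)
  qed (auto simp: W_nonneg U_def)
  have diss2: "dissipated extended U (\<lambda>u. u) W2"
    unfolding dissipated_def
  proof (intro conjI allI impI bexI)
    show "(\<lambda>w. (2 * \<tau>_est - 1) * (\<tau>_est - 1) / (2 * \<tau>_est\<^sup>2) * a_3 / a_2 * w) \<in> class_K"
      using \<tau> a by (intro class_Kinf_K class_Kinf_scale) simp
    fix t X assume t: "(0::real) \<le> t" and X: "(X has_vector_derivative extended t (X t)) (at_right t)"
    obtain e v \<epsilon>e where Xt: "X t = (e, v, \<epsilon>e)" by (cases "X t")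
    show "\<exists>D. ((\<lambda>s. W2 s (X s)) has_real_derivative D) (at_right t) \<and> (W2 t (X t) = U t (X t) \<longrightarrow>
        D \<le> - ((2 * \<tau>_est - 1) * (\<tau>_est - 1) / (2 * \<tau>_est\<^sup>2) * a_3 / a_2 * W2 t (X t)))"
      using C1_time_state_derivative[OF V_est t derivs(2)[OF X]] \<theta>_decay[OF t, of e v \<epsilon>e]
      by (intro exI[of _ "Wt t v + W\<theta> t v \<bullet> fst (snd (extended t (e, v, \<epsilon>e)))"])
        (auto simp: W1_def W2_def W3_def U_def Xt)
  qed (auto simp: W_nonneg U_def)
  have diss3: "dissipated extended U \<sigma>3 W3"
    unfolding dissipated_def
  proof (intro conjI allI impI bexI)
    show "(\<lambda>w. k_\<epsilon> * w) \<in> class_K"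
      using k by (intro class_Kinf_K class_Kinf_scale)
    fix t X assume t: "(0::real) \<le> t" and X: "(X has_vector_derivative extended t (X t)) (at_right t)"
    obtain e v \<epsilon>e where Xt: "X t = (e, v, \<epsilon>e)" by (cases "X t")
    have "((\<lambda>s. W3 s (X s)) has_real_derivative 2 * (\<epsilon>e \<bullet> snd (snd (extended t (e, v, \<epsilon>e))))) (at_right t)"
      using bounded_bilinear.has_vector_derivative[OF bounded_bilinear_inner derivs(3)[OF X] derivs(3)[OF X]]
      by (simp add: W3_def power2_norm_eq_inner has_real_derivative_iff_has_vector_derivative Xt inner_commute)
    then show "\<exists>D. ((\<lambda>s. W3 s (X s)) has_real_derivative D) (at_right t) \<and> (\<sigma>3 (W3 t (X t)) = U t (X t) \<longrightarrow>
        D \<le> - (k_\<epsilon> * W3 t (X t)))"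
      using \<epsilon>_decay[OF t, of e \<epsilon>e v]
      by (intro exI[of _ "2 * (\<epsilon>e \<bullet> snd (snd (extended t (e, v, \<epsilon>e))))"])
        (auto simp: W1_def W2_def W3_def U_def Xt)
  qed (auto simp: W_nonneg U_def)

  \<comment> \<open>Equilibrium, continuity and conclusion\<close>
  have K: "continuous_on UNIV K" and K0: "K 0 = 0"
  proof -
    show "continuous_on UNIV K"
      unfolding K_def[abs_def] by (intro continuous_intros assms(11,12))
    have 0: "0 \<le> (\<pi>_\<epsilon>e \<circ> g_e\<theta> \<circ> g_\<theta>\<epsilon>) ((norm z)\<^sup>2)" "0 \<le> (\<pi>_\<epsilon>\<theta> \<circ> g_\<theta>\<epsilon>) ((norm z)\<^sup>2)" for z :: "real^'n"
      unfolding o_def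
      by (intro class_K_nonneg[OF \<pi>_\<epsilon>e] class_Kinf_props(5)[OF g_e\<theta>] class_K_nonneg[OF g_\<theta>\<epsilon>] zero_le_power2)
        (intro class_K_nonneg[OF \<pi>_\<epsilon>\<theta>] class_K_nonneg[OF g_\<theta>\<epsilon>] zero_le_power2)
    have "0 \<le> z \<bullet> K_1 z" "0 \<le> z \<bullet> K_2 z" for z
      using order_trans[OF mult_nonneg_nonneg[OF norm_ge_zero 0(1)] assms(41)[rule_format, of z]]
        order_trans[OF mult_nonneg_nonneg[OF norm_ge_zero 0(2)] assms(42)[rule_format, of z]] by auto
    then show "K 0 = 0"
      using zero_of_inner_nonneg[OF assms(11)] zero_of_inner_nonneg[OF assms(12)] by (simp add: K_def)
  qed
  have "zero_UGAS extended"
  proof (rule zero_UGAS_max[OF _ _ U A B AU UB])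
    \<comment> \<open>The dead zone vanishes at the true parameter, whose norm is at most
      \<open>l_\<theta>\<close>, and all saturated differences vanish at zero estimation
      error.\<close>
    show "extended t 0 = 0" if "0 \<le> t" for t
      using F0[OF that] dzv_eq_0[OF \<theta>(1)] K0
      by (simp add: coords zero_prod_def H_field_def Delta_f_def phi_s_def)
    show "continuous_on ({0..} \<times> UNIV) (\<lambda>(t, x). extended t x)"
      unfolding extended_def
    proof (rule continuous_on_extended_error_system[OF l \<epsilon>_s assms(7-10) _ K _ dx_r])
      show "continuous_on UNIV \<sigma>"
        using assms(13) by (simp add: continuous_on_eq_continuous_within differentiable_imp_continuous_within)
      show "continuous_on {0..} x_r"
        using x_r by (auto simp: continuous_on_eq_continuous_within intro: has_vector_derivative_continuous)
    qed
    show "finite {(\<sigma>1, W1), (\<lambda>u. u, W2), (\<sigma>3, W3)}"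
      by simp
    show "s \<in> class_Kinf" if "(s, W) \<in> {(\<sigma>1, W1), (\<lambda>u. u, W2), (\<sigma>3, W3)}" for s W
      using that \<sigma>1 \<sigma>3 class_Kinf_id by auto
    show "dissipated extended U s W" if "(s, W) \<in> {(\<sigma>1, W1), (\<lambda>u. u, W2), (\<sigma>3, W3)}" for s W
      using that diss1 diss2 diss3 by auto
    show "\<exists>(s, W)\<in>{(\<sigma>1, W1), (\<lambda>u. u, W2), (\<sigma>3, W3)}. s (W t x) = U t x" for t x
      by (simp add: U_def max_def)
  qed
  moreover have "ode_solution original I X \<longleftrightarrow> ode_solution extended I (\<lambda>t. error_coords \<sigma> x_r \<theta> t (X t))"
    if "I \<subseteq> {0..}" for I X
    unfolding original_def extended_def
    using assms(13) \<theta>(2) has_vector_derivative_within_subset[OF x_r that] that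
    by (intro closed_loop_iff_extended_error_system) auto
  ultimately show ?thesis
    by (simp add: Let_def original_def extended_def K_def[abs_def])
qed

end
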